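(* For rank two lattices $M\subset L\subset\mathbb{C}$ let $R_{L:M}$ be the rational function of degree $|L:M|$ determined by $R_{L:M}(\wp(u|M))=\wp(u|L)$, $u\in\mathbb{C}$. The assignment $(L,M)\mapsto R_{L:M}$ induces a one-to-one correspondence between (i) pairs of embedded rank two lattices $M\subset L\subset\mathbb{C}$ with $|L:M|\neq 1$, $|L:M|\neq 2$ and $M\neq 2L$, considered modulo simultaneous multiplication by a nonzero complex number, $(L,M)\sim(cL,cM)$, $c\in\mathbb{C}\setminus\{0\}$; and (ii) classes of twisted Zolotarëv fractions. That is, for every pair as in (i) the function $R_{L:M}$ is a twisted Zolotarëv fraction; every twisted Zolotarëv fraction lies in the same class as $R_{L:M}$ for some pair as in (i); and for two pairs as in (i), $R_{L:M}$ and $R_{L':M'}$ lie in the same class if and only if $(L',M')=(cL,cM)$ for some $c\in\mathbb{C}\setminus\{0\}$.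
   Context: A rank two lattice $L\subset\mathbb{C}$ is a discrete subgroup of $\mathbb{C}$ generated by two elements linearly independent over $\mathbb{R}$. For lattices $M\subset L$, $|L:M|$ denotes the index (finite, since both have rank two). The Weierstrass function is $$\wp(u|L)=u^{-2}+\sum_{0\neq v\in L}\left((u-v)^{-2}-v^{-2}\right).$$ It is a global coordinate on the Riemann sphere $\mathbb{C}/L^+$, where $L^+$ is the group generated by the translations by elements of $L$ and by $u\mapsto -u$. For $M\subset L$ the natural holomorphic map $\mathbb{C}/M^+\to\mathbb{C}/L^+$, written in the coordinates $\wp(u|M)$ and $\wp(u|L)$, is a rational function $R_{L:M}$ of degree $|L:M|$ satisfying $R_{L:M}(\wp(u|M))=\wp(u|L)$. A rational function $R:\mathbb{C}P^1\to\mathbb{C}P^1$ is called a twisted Zolotarëv fraction if all of its critical points (including those at infinity, and at poles, if any) are simple, i.e. of local degree exactly $2$, and the set of its critical values consists of exactly four elements. Two such fractions $R_1,R_2$ are in the same class if $R_2=l\circ R_1\circ l_1$ for some linear fractional transformations $l,l_1\in PSL_2(\mathbb{C})$. *)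

theory Defs
  imports "HOL-Complex_Analysis.Complex_Analysis" "HOL-Computational_Algebra.Computational_Algebra"
begin

section \<open>Lattices and the Weierstrass function\<close>

datatype csphere = Pt complex | Infty

text \<open>Discreteness of the group is automatic, by linear independence over the reals.\<close>

definition rank_two_lattice :: "complex set \<Rightarrow> bool" where
  "rank_two_lattice L \<longleftrightarrow>
     (\<exists>\<omega>1 \<omega>2. \<omega>1 \<noteq> \<omega>2 \<and> independent {\<omega>1, \<omega>2} \<and>
        L = {of_int m * \<omega>1 + of_int n * \<omega>2 | m n. True})"

text \<open>Number of cosets. For rank two lattices \<open>M \<subseteq> L\<close> it is finite, so the convention
  that an infinite set has cardinality 0 plays no role.\<close>

definition lattice_index :: "complex set \<Rightarrow> complex set \<Rightarrow> nat" where
  "lattice_index L M = card ((\<lambda>v. (+) v ` M) ` L)"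

definition weierstrass_p :: "complex set \<Rightarrow> complex \<Rightarrow> csphere" where
  "weierstrass_p L u =
     (if u \<in> L then Infty
      else Pt (1 / u ^ 2 + (\<Sum>\<^sub>\<infinity>v\<in>L - {0}. 1 / (u - v) ^ 2 - 1 / v ^ 2)))"


section \<open>Rational functions on the Riemann sphere\<close>

text \<open>The map \<open>[x : y] \<mapsto> [P(x, y) : Q(x, y)]\<close>, where \<open>P\<close> and \<open>Q\<close> are the homogenisations of
  \<open>p\<close> and \<open>q\<close> of the common degree \<open>n\<close>. It is only meant for coprime \<open>p\<close> and \<open>q\<close>.\<close>

fun rat_map :: "complex poly \<Rightarrow> complex poly \<Rightarrow> csphere \<Rightarrow> csphere" where
  "rat_map p q (Pt z) = (if poly q z = 0 then Infty else Pt (poly p z / poly q z))"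
| "rat_map p q Infty =
     (let n = max (degree p) (degree q)
      in if coeff q n = 0 then Infty else Pt (coeff p n / coeff q n))"

definition rational_of_degree :: "nat \<Rightarrow> (csphere \<Rightarrow> csphere) \<Rightarrow> bool" where
  "rational_of_degree n R \<longleftrightarrow>
     (\<exists>p q. coprime p q \<and> max (degree p) (degree q) = n \<and> R = rat_map p q)"

definition linear_fractional :: "(csphere \<Rightarrow> csphere) \<Rightarrow> bool" where
  "linear_fractional l \<longleftrightarrow>
     (\<exists>a b c d. a * d - b * c = 1 \<and> l = rat_map [:b, a:] [:d, c:])"

text \<open>\<open>local_param x\<close> parametrises a neighbourhood of \<open>x\<close>, sending 0 to \<open>x\<close>, and \<open>local_coord y\<close>
  is a coordinate near \<open>y\<close> that vanishes at \<open>y\<close>. The values \<open>local_coord (Pt a) Infty\<close> and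
  \<open>local_coord Infty (Pt 0)\<close> are junk; they lie outside the chart and do not affect
  the order at 0 below, which depends only on the germ.\<close>

fun local_param :: "csphere \<Rightarrow> complex \<Rightarrow> csphere" where
  "local_param (Pt a) t = Pt (a + t)"
| "local_param Infty t = (if t = 0 then Infty else Pt (1 / t))"

fun local_coord :: "csphere \<Rightarrow> csphere \<Rightarrow> complex" where
  "local_coord (Pt a) (Pt z) = z - a"
| "local_coord (Pt a) Infty = 0"
| "local_coord Infty (Pt z) = 1 / z"
| "local_coord Infty Infty = 0"

definition local_degree :: "(csphere \<Rightarrow> csphere) \<Rightarrow> csphere \<Rightarrow> int" where
  "local_degree R x = zorder (\<lambda>t. local_coord (R x) (R (local_param x t))) 0"

definition critical_points :: "(csphere \<Rightarrow> csphere) \<Rightarrow> csphere set" where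
  "critical_points R = {x. local_degree R x > 1}"


section \<open>Twisted Zolotarev fractions\<close>

text \<open>The local degree of a constant map is unspecified, but a constant map has at most one
  critical value, so the last conjunct excludes it.\<close>

definition twisted_zolotarev :: "(csphere \<Rightarrow> csphere) \<Rightarrow> bool" where
  "twisted_zolotarev R \<longleftrightarrow>
     (\<exists>n. rational_of_degree n R) \<and>
     (\<forall>x\<in>critical_points R. local_degree R x = 2) \<and>
     card (R ` critical_points R) = 4"

definition same_class :: "(csphere \<Rightarrow> csphere) \<Rightarrow> (csphere \<Rightarrow> csphere) \<Rightarrow> bool" where
  "same_class R1 R2 \<longleftrightarrow>
     (\<exists>l l1. linear_fractional l \<and> linear_fractional l1 \<and> R2 = l \<circ> R1 \<circ> l1)"

definition zolotarev_rel :: "((csphere \<Rightarrow> csphere) \<times> (csphere \<Rightarrow> csphere)) set" where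
  "zolotarev_rel =
     {(R1, R2). twisted_zolotarev R1 \<and> twisted_zolotarev R2 \<and> same_class R1 R2}"


section \<open>Pairs of lattices and their fractions\<close>

definition is_lattice_fraction ::
    "complex set \<Rightarrow> complex set \<Rightarrow> (csphere \<Rightarrow> csphere) \<Rightarrow> bool" where
  "is_lattice_fraction L M R \<longleftrightarrow>
     rational_of_degree (lattice_index L M) R \<and>
     (\<forall>u. R (weierstrass_p M u) = weierstrass_p L u)"

definition lattice_fraction :: "complex set \<Rightarrow> complex set \<Rightarrow> csphere \<Rightarrow> csphere" where
  "lattice_fraction L M = (THE R. is_lattice_fraction L M R)"

definition lattice_pairs :: "(complex set \<times> complex set) set" where
  "lattice_pairs =
     {(L, M). rank_two_lattice L \<and> rank_two_lattice M \<and> M \<subseteq> L \<and>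
        lattice_index L M \<noteq> 1 \<and> lattice_index L M \<noteq> 2 \<and> M \<noteq> (*) 2 ` L}"

definition homothetic ::
    "complex set \<times> complex set \<Rightarrow> complex set \<times> complex set \<Rightarrow> bool" where
  "homothetic = (\<lambda>(L, M) (L', M'). \<exists>c. c \<noteq> 0 \<and> L' = (*) c ` L \<and> M' = (*) c ` M)"

definition homothety_rel :: "((complex set \<times> complex set) \<times> (complex set \<times> complex set)) set" where
  "homothety_rel = {(P, P'). P \<in> lattice_pairs \<and> P' \<in> lattice_pairs \<and> homothetic P P'}"

end

theory Submission
  imports Defs
begin

text \<open>Critical points of \<open>R = R\<^bsub>L:M\<^esub>\<close> come from half periods: at \<open>\<wp>(u|M)\<close> the local degree is the
  quotient of those of \<open>\<wp>(\<cdot>|L)\<close> and \<open>\<wp>(\<cdot>|M)\<close> at \<open>u\<close>, hence 2 if \<open>2u \<in> L - M\<close> and 1 otherwise.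
  Conversely, a twisted fraction with four critical values has four unramified points over
  them. If one of them is moved to infinity (and to the value infinity), counting degrees shows
  \<open>R'\<^sup>2 P = g \<circ> R\<close> for squarefree cubics \<open>P\<close> (vanishing at the other unramified points) and
  \<open>g\<close> (vanishing at the other critical values). So \<open>R\<close> maps solutions of \<open>y'\<^sup>2 = P(y)\<close> to
  solutions of \<open>y'\<^sup>2 = g(y)\<close>.

  The uniformisation of \<open>y'\<^sup>2 = f(y)\<close> for a squarefree cubic \<open>f\<close> uses only the local uniqueness
  of solutions with values in the sphere. The duplication formula extends a local solution with
  a pole at 0 to the plane, and local uniqueness makes its poles a discrete group of periods. Composing the
  solution with the Moebius maps that permute the branch points gives further solutions; by
  Liouville's theorem their values overlap, so all roots of \<open>f\<close> are attained. Their half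
  periods show that the group of poles is not cyclic, so it is a lattice.\<close>

text \<open>Composition with \<open>R\<close> in the differential equation replaces the lifting of
  \<open>R\<close> to orbifold covers. The count of four is Riemann-Hurwitz: if all critical points
  are simple, a map of degree n has 2n - 2 of them, the four critical values have 4n preimages with
  multiplicity, and 4n - 2(2n - 2) = 4 of these are unramified. The excluded pairs are those with 2L
  contained in M. The critical values of \<open>R\<close> are the \<wp>(u|L) with
  \<open>2u \<in> L - M\<close>; they lie among the four values at half periods. Infinity, the value
  at \<open>u \<in> L\<close>, is one of them exactly if some v in L has 2v outside M, and
  translation by such a v then produces the other three as well. For uniqueness of the pair, the
  unramified points over the critical values are intrinsic to \<open>R\<close>. A Moebius
  equivalence carries those of one fraction to those of the other, hence one Weierstrass function to
  the other up to an affine change of u. The same change of variable serves M and L, so the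
  homothety is simultaneous.\<close>

section \<open>Germs of analytic functions\<close>

lemma eventually_at_nested:
  fixes a :: complex
  assumes "\<forall>\<^sub>F t in at a. P t"
  shows "\<forall>\<^sub>F t in at a. \<forall>\<^sub>F s in nhds t. P s"
proof -
  obtain S where S: "open S" "a \<in> S" "\<And>t. t \<in> S \<Longrightarrow> t \<noteq> a \<Longrightarrow> P t"
    using assms unfolding eventually_at_topological by auto
  have "\<forall>\<^sub>F s in nhds t. P s" if "t \<in> S" "t \<noteq> a" for t
  proof -
    have "open (S - {a})" using S by auto
    then show ?thesis
      unfolding eventually_nhds using that S by (intro exI[of _ "S - {a}"]) auto
  qed
  then show ?thesis
    unfolding eventually_at_topological using S by blast
qed

lemma eventually_at_of_nhds: "\<forall>\<^sub>F t in nhds a. P t \<Longrightarrow> \<forall>\<^sub>F t in at a. P t"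
  by (simp add: eventually_nhds_conv_at)

lemma eventually_nhds_at_point: "\<forall>\<^sub>F t in nhds a. P t \<Longrightarrow> P a"
  by (rule eventually_nhds_x_imp_x)

lemma analytic_eventually: "f analytic_on {a} \<Longrightarrow> \<forall>\<^sub>F t in nhds a. f analytic_on {t}"
  unfolding analytic_at eventually_nhds by blast

lemma analytic_tendsto: "f analytic_on {a} \<Longrightarrow> (f \<longlongrightarrow> f a) (nhds a)"
  using analytic_at_imp_isCont[of f a] by (simp add: isCont_def tendsto_at_iff_tendsto_nhds)

lemma analytic_affine: "(\<lambda>t :: complex. k * t + c) analytic_on S"
  by (rule analytic_on_add[OF analytic_on_mult[OF analytic_on_const analytic_on_ident] analytic_on_const])

lemma analytic_DERIV:
  fixes f :: "complex \<Rightarrow> complex"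
  assumes "f analytic_on {a}"
  shows "(f has_field_derivative deriv f a) (at a)"
  using analytic_on_imp_differentiable_at[OF assms] DERIV_deriv_iff_field_differentiable by auto

lemma deriv_reflect:
  fixes h :: "complex \<Rightarrow> complex"
  assumes "h analytic_on {0}"
  shows "deriv (\<lambda>t. h (- t)) 0 = - deriv h 0"
proof (rule DERIV_imp_deriv)
  have "(h has_field_derivative deriv h 0) (at (- 0))" using analytic_DERIV[OF assms] by simp
  then have "((\<lambda>t. h (- t)) has_field_derivative deriv h 0 * (- 1)) (at 0)"
    by (rule DERIV_chain2[where f = h and g = uminus]) (auto intro!: derivative_eq_intros)
  then show "((\<lambda>t. h (- t)) has_field_derivative - deriv h 0) (at 0)" by simp
qed

lemma analytic_cong_nhds:
  assumes "f analytic_on {a}" "\<forall>\<^sub>F t in nhds a. f t = g t"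
  shows "g analytic_on {a}"
  using analytic_at_cong[OF assms(2) refl] assms(1) by simp

lemma analytic_zero_cases:
  assumes "f analytic_on {a}"
  shows "(\<forall>\<^sub>F t in nhds a. f t = 0) \<or> (\<forall>\<^sub>F t in at a. f t \<noteq> 0)"
proof (cases "\<exists>\<^sub>F t in at a. f t = 0")
  case True
  have "\<forall>\<^sub>F t in at a. f t = 0"
    by (rule not_essential_frequently_0_imp_eventually_0
          [OF isolated_singularity_at_analytic[OF assms] not_essential_analytic[OF assms] True])
  moreover have "f a = 0"
  proof -
    have "(f \<longlongrightarrow> f a) (at a)"
      using analytic_at_imp_isCont[OF assms] by (simp add: isCont_def)
    moreover have "(f \<longlongrightarrow> 0) (at a)"
      using calculation \<open>\<forall>\<^sub>F t in at a. f t = 0\<close> by (simp add: tendsto_eventually)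
    ultimately show ?thesis by (rule LIM_unique)
  qed
  ultimately show ?thesis by (auto simp: eventually_nhds_conv_at)
next
  case False
  then show ?thesis by (simp add: not_frequently)
qed

text \<open>Identities may be derived off \<open>a\<close>, where divisions are harmless, and then
  extend to \<open>a\<close>. The local differential equations below are obtained in this
  way.\<close>

lemma analytic_eq_punctured:
  fixes f g :: "complex \<Rightarrow> complex"
  assumes "f analytic_on {a}" "g analytic_on {a}" "\<forall>\<^sub>F t in at a. f t = g t"
  shows "\<forall>\<^sub>F t in nhds a. f t = g t"
proof -
  have "(\<lambda>t. f t - g t) analytic_on {a}" using assms by (intro analytic_intros)
  from analytic_zero_cases[OF this] show ?thesis
  proof
    assume "\<forall>\<^sub>F t in at a. f t - g t \<noteq> 0"
    with assms(3) have "\<forall>\<^sub>F t in at a. False" by eventually_elim auto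
    then show ?thesis by simp
  qed (simp)
qed

section \<open>Holomorphic maps to the sphere\<close>

text \<open>The point \<open>[A : B]\<close> of the projective line. The pair (0, 0) is not a point,
  and its value \<open>Infty\<close> is junk.\<close>

definition mk :: "complex \<Rightarrow> complex \<Rightarrow> csphere" where
  "mk A B = (if B = 0 then Infty else Pt (A / B))"

text \<open>A pair of germs without common zero treats poles like all other points, so no chart has
  to be chosen.\<close>

definition hol_at :: "(complex \<Rightarrow> csphere) \<Rightarrow> complex \<Rightarrow> bool" where
  "hol_at F a \<longleftrightarrow> (\<exists>A B. A analytic_on {a} \<and> B analytic_on {a} \<and> (A a \<noteq> 0 \<or> B a \<noteq> 0) \<and>
      (\<forall>\<^sub>F t in nhds a. F t = mk (A t) (B t)))"

primrec fin :: "csphere \<Rightarrow> complex" where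
  "fin (Pt z) = z"
| "fin Infty = 0"

text \<open>For holomorphic maps this is the same as not being constant near \<open>a\<close>, by
  \<open>hol_at_avoid_cases\<close>; in this form it extends at once to finite sets of
  values.\<close>

definition nonconst_at :: "(complex \<Rightarrow> csphere) \<Rightarrow> complex \<Rightarrow> bool" where
  "nonconst_at F a \<longleftrightarrow> (\<forall>x. \<forall>\<^sub>F t in at a. F t \<noteq> x)"

lemma mk_scale: "c \<noteq> 0 \<Longrightarrow> mk (c * A) (c * B) = mk A B"
  by (simp add: mk_def)

lemma mk_eq_iff:
  assumes "A \<noteq> 0 \<or> B \<noteq> 0" "C \<noteq> 0 \<or> D \<noteq> 0"
  shows "mk A B = mk C D \<longleftrightarrow> A * D = C * B"
  using assms by (auto simp: mk_def field_simps)

lemma csphere_mk: "\<exists>A B. (A \<noteq> 0 \<or> B \<noteq> 0) \<and> x = mk A B"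
proof (cases x)
  case (Pt z)
  then show ?thesis by (intro exI[of _ z] exI[of _ 1]) (auto simp: mk_def)
next
  case Infty
  then show ?thesis by (intro exI[of _ 1] exI[of _ 0]) (auto simp: mk_def)
qed

lemma local_param_mk:
  "local_param (Pt c) s = mk (c + s) 1" "local_param Infty s = mk 1 s"
  by (auto simp: mk_def)

lemma local_coord_param [simp]: "local_coord x (local_param x s) = s"
  by (cases x) auto

lemma local_param_0 [simp]: "local_param x 0 = x"
  by (cases x) auto

lemma local_param_inj: "local_param x s = local_param x t \<longleftrightarrow> s = t"
  by (metis local_coord_param)

lemma hol_atI:
  assumes "A analytic_on {a}" "B analytic_on {a}" "A a \<noteq> 0 \<or> B a \<noteq> 0"
    "\<forall>\<^sub>F t in nhds a. F t = mk (A t) (B t)"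
  shows "hol_at F a"
  using assms unfolding hol_at_def by blast

lemma hol_at_local_param: "hol_at (local_param x) a"
proof (cases x)
  case (Pt c)
  show ?thesis
    by (rule hol_atI[of "\<lambda>s. c + s" _ "\<lambda>_. 1"]) (auto simp: Pt mk_def intro!: analytic_intros)
next
  case Infty
  show ?thesis
    by (rule hol_atI[of "\<lambda>_. 1" _ "\<lambda>s. s"]) (simp_all add: Infty local_param_mk del: local_param.simps)
qed

lemma hol_at_Pt:
  assumes "h analytic_on {a}" "\<forall>\<^sub>F t in nhds a. F t = Pt (h t)"
  shows "hol_at F a"
  by (rule hol_atI[of h _ "\<lambda>_. 1"]) (use assms in \<open>auto simp: mk_def\<close>)

lemma hol_at_cong:
  assumes "\<forall>\<^sub>F t in nhds a. F t = G t" "hol_at F a"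
  shows "hol_at G a"
proof -
  obtain A B where AB: "A analytic_on {a}" "B analytic_on {a}" "A a \<noteq> 0 \<or> B a \<noteq> 0"
      "\<forall>\<^sub>F t in nhds a. F t = mk (A t) (B t)"
    using assms(2) unfolding hol_at_def by blast
  show ?thesis
    by (rule hol_atI[OF AB(1-3)]) (use AB(4) assms(1) in eventually_elim, simp)
qed

lemma pair_nonzero_eventually:
  fixes A B :: "complex \<Rightarrow> complex"
  assumes "A analytic_on {a}" "B analytic_on {a}" "A a \<noteq> 0 \<or> B a \<noteq> 0"
  shows "\<forall>\<^sub>F t in nhds a. A t \<noteq> 0 \<or> B t \<noteq> 0"
  using assms(3)
proof
  assume "A a \<noteq> 0"
  then have "\<forall>\<^sub>F t in nhds a. A t \<noteq> 0"
    using analytic_tendsto[OF assms(1)] tendsto_imp_eventually_ne by blast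
  then show ?thesis by eventually_elim simp
next
  assume "B a \<noteq> 0"
  then have "\<forall>\<^sub>F t in nhds a. B t \<noteq> 0"
    using analytic_tendsto[OF assms(2)] tendsto_imp_eventually_ne by blast
  then show ?thesis by eventually_elim simp
qed

lemma hol_at_eventually:
  assumes "hol_at F a"
  shows "\<forall>\<^sub>F t in nhds a. hol_at F t"
proof -
  obtain A B where AB: "A analytic_on {a}" "B analytic_on {a}" "A a \<noteq> 0 \<or> B a \<noteq> 0"
      "\<forall>\<^sub>F t in nhds a. F t = mk (A t) (B t)"
    using assms(1) unfolding hol_at_def by blast
  have "\<forall>\<^sub>F t in nhds a. \<forall>\<^sub>F s in nhds t. F s = mk (A s) (B s)"
    using AB(4) by (simp add: eventually_eventually)
  with analytic_eventually[OF AB(1)] analytic_eventually[OF AB(2)] pair_nonzero_eventually[OF AB(1-3)]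
  show ?thesis by eventually_elim (auto intro: hol_atI)
qed

lemma hol_at_affine:
  assumes "hol_at F (k * a + c)"
  shows "hol_at (\<lambda>t. F (k * t + c)) a"
proof -
  obtain A B where AB: "A analytic_on {k * a + c}" "B analytic_on {k * a + c}"
      "A (k * a + c) \<noteq> 0 \<or> B (k * a + c) \<noteq> 0"
      "\<forall>\<^sub>F t in nhds (k * a + c). F t = mk (A t) (B t)"
    using assms(1) unfolding hol_at_def by blast
  have lim: "filterlim (\<lambda>t. k * t + c) (nhds (k * a + c)) (nhds a)"
    by (rule analytic_tendsto[OF analytic_affine])
  have an: "(\<lambda>t. f (k * t + c)) analytic_on {a}" if "f analytic_on {k * a + c}" for f
  proof -
    have "(\<lambda>t. k * t + c) analytic_on {a}" by (rule analytic_affine)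
    then show ?thesis
      using analytic_on_compose[of "\<lambda>t. k * t + c" "{a}" f] that by (simp add: o_def)
  qed
  show ?thesis
    by (rule hol_atI[OF an[OF AB(1)] an[OF AB(2)]])
       (use AB(3) filterlim_iff[THEN iffD1, OF lim, rule_format, OF AB(4)] in auto)
qed

text \<open>Reduces a map to the sphere to an analytic germ vanishing at \<open>a\<close>: B/A at a
  pole, and A/B minus its value elsewhere.\<close>

lemma hol_at_germ:
  assumes "hol_at F a"
  obtains h where "h analytic_on {a}" "h a = 0" "\<forall>\<^sub>F t in nhds a. F t = local_param (F a) (h t)"
proof -
  obtain A B where AB: "A analytic_on {a}" "B analytic_on {a}" "A a \<noteq> 0 \<or> B a \<noteq> 0"
      "\<forall>\<^sub>F t in nhds a. F t = mk (A t) (B t)"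
    using assms(1) unfolding hol_at_def by blast
  have Fa: "F a = mk (A a) (B a)" using eventually_nhds_at_point[OF AB(4)] .
  show thesis
  proof (cases "B a = 0")
    case True
    then have A0: "A a \<noteq> 0" using AB by simp
    have "\<forall>\<^sub>F t in nhds a. A t \<noteq> 0"
      using analytic_tendsto[OF AB(1)] A0 tendsto_imp_eventually_ne by blast
    then have "\<forall>\<^sub>F t in nhds a. F t = local_param (F a) (B t / A t)"
      using AB(4) by eventually_elim (auto simp: Fa True mk_def)
    moreover have "(\<lambda>t. B t / A t) analytic_on {a}"
      using AB A0 by (intro analytic_intros) auto
    ultimately show ?thesis using that[of "\<lambda>t. B t / A t"] True by auto
  next
    case False
    have "\<forall>\<^sub>F t in nhds a. B t \<noteq> 0"
      using analytic_tendsto[OF AB(2)] False tendsto_imp_eventually_ne by blast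
    then have "\<forall>\<^sub>F t in nhds a. F t = local_param (F a) (A t / B t - A a / B a)"
      using AB(4) by eventually_elim (auto simp: Fa False mk_def)
    moreover have "(\<lambda>t. A t / B t - A a / B a) analytic_on {a}"
      using AB False by (intro analytic_intros) auto
    ultimately show ?thesis using that[of "\<lambda>t. A t / B t - A a / B a"] by auto
  qed
qed

lemma hol_at_fin:
  assumes "hol_at F a" "F a \<noteq> Infty"
  shows "(\<lambda>t. fin (F t)) analytic_on {a}" "\<forall>\<^sub>F t in nhds a. F t \<noteq> Infty"
proof -
  obtain h where h: "h analytic_on {a}" "h a = 0" "\<forall>\<^sub>F t in nhds a. F t = local_param (F a) (h t)"
    using hol_at_germ[OF assms(1)] .
  obtain c where c: "F a = Pt c" using assms(2) by (cases "F a") auto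
  have ev: "\<forall>\<^sub>F t in nhds a. F t = Pt (c + h t)"
    using h(3) by (simp add: c)
  show "\<forall>\<^sub>F t in nhds a. F t \<noteq> Infty"
    using ev by eventually_elim auto
  have "(\<lambda>t. c + h t) analytic_on {a}" using h by (intro analytic_intros)
  then show "(\<lambda>t. fin (F t)) analytic_on {a}"
    by (rule analytic_cong_nhds) (use ev in eventually_elim, simp)
qed

text \<open>For x = \<open>[C : D]\<close> the equation \<open>F t = x\<close> is the vanishing of
  the analytic function A D - C B.\<close>

lemma hol_at_avoid_cases:
  assumes "hol_at F a"
  shows "(\<forall>\<^sub>F t in nhds a. F t = x) \<or> (\<forall>\<^sub>F t in at a. F t \<noteq> x)"
proof -
  obtain A B where AB: "A analytic_on {a}" "B analytic_on {a}" "A a \<noteq> 0 \<or> B a \<noteq> 0"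
      "\<forall>\<^sub>F t in nhds a. F t = mk (A t) (B t)"
    using assms(1) unfolding hol_at_def by blast
  obtain C D where CD: "C \<noteq> 0 \<or> D \<noteq> 0" "x = mk C D" using csphere_mk by blast
  have "(\<lambda>t. A t * D - C * B t) analytic_on {a}" using AB by (intro analytic_intros)
  from analytic_zero_cases[OF this] show ?thesis
  proof
    assume "\<forall>\<^sub>F t in nhds a. A t * D - C * B t = 0"
    then have "\<forall>\<^sub>F t in nhds a. F t = x"
      using AB(4) pair_nonzero_eventually[OF AB(1-3)]
      by eventually_elim (auto simp: CD(2) mk_eq_iff[OF _ CD(1)])
    then show ?thesis ..
  next
    assume "\<forall>\<^sub>F t in at a. A t * D - C * B t \<noteq> 0"
    then have "\<forall>\<^sub>F t in at a. F t \<noteq> x"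
      using eventually_at_of_nhds[OF AB(4)] eventually_at_of_nhds[OF pair_nonzero_eventually[OF AB(1-3)]]
      by eventually_elim (auto simp: CD(2) mk_eq_iff[OF _ CD(1)])
    then show ?thesis ..
  qed
qed

text \<open>Equality of \<open>[A : B]\<close> and \<open>[C : D]\<close> is the vanishing of A D -
  C B, so near each point of \<open>S\<close> the maps either agree or differ everywhere off the
  point. Both alternatives are open conditions, and connectedness leaves only the first.\<close>

lemma hol_eq_on:
  assumes "open S" "connected S" "a \<in> S"
    and F: "\<And>t. t \<in> S \<Longrightarrow> hol_at F t" and G: "\<And>t. t \<in> S \<Longrightarrow> hol_at G t"
    and eq: "\<forall>\<^sub>F t in nhds a. F t = G t" and "t \<in> S"
  shows "F t = G t"
proof -
  define U where "U = {t \<in> S. \<forall>\<^sub>F s in nhds t. F s = G s}"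
  have U: "open U"
    unfolding open_subopen[of U]
  proof
    fix t assume t: "t \<in> U"
    then have "\<forall>\<^sub>F s in nhds t. s \<in> U"
      unfolding U_def using assms(1)
      by (auto simp: eventually_eventually eventually_conj_iff eventually_nhds_in_open)
    then show "\<exists>T. open T \<and> t \<in> T \<and> T \<subseteq> U"
      unfolding eventually_nhds by blast
  qed
  have dich: "(\<forall>\<^sub>F s in nhds t. F s = G s) \<or> (\<forall>\<^sub>F s in at t. F s \<noteq> G s)" if tS: "t \<in> S" for t
  proof -
    obtain A B where AB: "A analytic_on {t}" "B analytic_on {t}" "A t \<noteq> 0 \<or> B t \<noteq> 0"
      "\<forall>\<^sub>F s in nhds t. F s = mk (A s) (B s)"
      using F[OF tS] unfolding hol_at_def by blast
    obtain C D where CD: "C analytic_on {t}" "D analytic_on {t}" "C t \<noteq> 0 \<or> D t \<noteq> 0"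
      "\<forall>\<^sub>F s in nhds t. G s = mk (C s) (D s)"
      using G[OF tS] unfolding hol_at_def by blast
    have ev: "\<forall>\<^sub>F s in nhds t. F s = G s \<longleftrightarrow> A s * D s - C s * B s = 0"
      using AB(4) CD(4) pair_nonzero_eventually[OF AB(1-3)] pair_nonzero_eventually[OF CD(1-3)]
      by eventually_elim (simp add: mk_eq_iff)
    have "(\<lambda>s. A s * D s - C s * B s) analytic_on {t}" using AB CD by (intro analytic_intros)
    from analytic_zero_cases[OF this] show ?thesis
    proof
      assume "\<forall>\<^sub>F s in nhds t. A s * D s - C s * B s = 0"
      with ev have "\<forall>\<^sub>F s in nhds t. F s = G s" by eventually_elim simp
      then show ?thesis ..
    next
      assume "\<forall>\<^sub>F s in at t. A s * D s - C s * B s \<noteq> 0"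
      with eventually_at_of_nhds[OF ev] have "\<forall>\<^sub>F s in at t. F s \<noteq> G s" by eventually_elim simp
      then show ?thesis ..
    qed
  qed
  define V where "V = {t \<in> S. \<forall>\<^sub>F s in at t. F s \<noteq> G s}"
  have V: "open V"
    unfolding open_subopen[of V]
  proof
    fix t assume t: "t \<in> V"
    then have "\<forall>\<^sub>F s in at t. \<forall>\<^sub>F r in nhds s. F r \<noteq> G r"
      unfolding V_def by (auto intro: eventually_at_nested)
    then have "\<forall>\<^sub>F s in at t. \<forall>\<^sub>F r in at s. F r \<noteq> G r"
      by eventually_elim (rule eventually_at_of_nhds)
    then have "\<forall>\<^sub>F s in nhds t. \<forall>\<^sub>F r in at s. F r \<noteq> G r"
      using t by (auto simp: V_def eventually_nhds_conv_at)
    moreover have "\<forall>\<^sub>F s in nhds t. s \<in> S"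
      using t assms(1) by (auto simp: V_def eventually_nhds_in_open)
    ultimately have "\<forall>\<^sub>F s in nhds t. s \<in> V"
      unfolding V_def by eventually_elim simp
    then show "\<exists>T. open T \<and> t \<in> T \<and> T \<subseteq> V"
      unfolding eventually_nhds by blast
  qed
  have "U \<inter> V = {}"
  proof -
    have False if "t \<in> U" "t \<in> V" for t
    proof -
      have "\<forall>\<^sub>F s in at t. F s = G s" "\<forall>\<^sub>F s in at t. F s \<noteq> G s"
        using that eventually_at_of_nhds[of "\<lambda>s. F s = G s" t] unfolding U_def V_def by auto
      then have "\<forall>\<^sub>F s in at t. False"
        by eventually_elim simp
      then show False by simp
    qed
    then show ?thesis by auto
  qed
  moreover have "S = U \<union> V" using dich unfolding U_def V_def by auto
  moreover have "a \<in> U" using assms unfolding U_def by auto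
  ultimately have "V = {}"
    using connectedD[OF assms(2) U V] \<open>S = U \<union> V\<close> by auto
  then have "t \<in> U" using \<open>S = U \<union> V\<close> assms(7) by auto
  then show ?thesis unfolding U_def using eventually_nhds_at_point by auto
qed

lemma hol_eq_UNIV:
  assumes "\<And>t. hol_at F t" "\<And>t. hol_at G t" "\<forall>\<^sub>F t in nhds a. F t = G t"
  shows "F t = G t"
  by (rule hol_eq_on[of UNIV a]) (use assms in auto)

section \<open>Rational maps in homogeneous coordinates\<close>

text \<open>Homogenisation in a prescribed degree \<open>n\<close>, which may exceed the degree of
  \<open>p\<close>: numerator and denominator of a fraction are treated in their common
  degree.\<close>

definition hom :: "nat \<Rightarrow> complex poly \<Rightarrow> complex \<Rightarrow> complex \<Rightarrow> complex" where
  "hom n p A B = (\<Sum>i\<le>n. coeff p i * A ^ i * B ^ (n - i))"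

lemma hom_nonzero:
  assumes "B \<noteq> 0" "degree p \<le> n"
  shows "hom n p A B = B ^ n * poly p (A / B)"
proof -
  have "poly p (A / B) = (\<Sum>i\<le>n. coeff p i * (A / B) ^ i)"
    unfolding poly_altdef using assms(2)
    by (intro sum.mono_neutral_left) (auto simp: coeff_eq_0)
  also have "B ^ n * \<dots> = (\<Sum>i\<le>n. coeff p i * A ^ i * B ^ (n - i))"
    unfolding sum_distrib_left
    by (intro sum.cong) (use assms in \<open>auto simp: power_divide power_diff\<close>)
  finally show ?thesis unfolding hom_def by simp
qed

lemma hom_0: "hom n p A 0 = coeff p n * A ^ n"
proof -
  have "hom n p A 0 = (\<Sum>i\<in>{n}. coeff p i * A ^ i * 0 ^ (n - i))"
    unfolding hom_def by (intro sum.mono_neutral_right) auto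
  then show ?thesis by simp
qed

lemma coprime_no_common_root:
  fixes p q :: "complex poly"
  assumes "coprime p q" "poly p z = 0" "poly q z = 0"
  shows False
proof -
  have "[:- z, 1:] dvd p" "[:- z, 1:] dvd q"
    using assms by (simp_all add: poly_eq_0_iff_dvd)
  then have "is_unit [:- z, 1:]"
    by (rule coprime_common_divisor[OF assms(1)])
  then show False by (simp add: is_unit_iff_degree)
qed

text \<open>For B = 0 only the coefficients of index \<open>n\<close> survive, and one of them is a
  leading coefficient; for B nonzero a common zero would be a common root.\<close>

lemma hom_pair_nonzero:
  assumes "coprime p q" "n = max (degree p) (degree q)" "A \<noteq> 0 \<or> B \<noteq> 0"
  shows "hom n p A B \<noteq> 0 \<or> hom n q A B \<noteq> 0"
proof (cases "B = 0")
  case True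
  have "coeff p n \<noteq> 0 \<or> coeff q n \<noteq> 0"
  proof (cases "degree p \<ge> degree q")
    case True
    then have n: "n = degree p" using assms by simp
    show ?thesis
    proof (cases "p = 0")
      case True
      then have "degree q = 0" using \<open>degree p \<ge> degree q\<close> by simp
      moreover have "q \<noteq> 0" using assms(1) True by auto
      ultimately show ?thesis using n True by (metis degree_0 leading_coeff_neq_0)
    qed (simp add: n)
  next
    case False
    then have "n = degree q" "q \<noteq> 0" using assms by auto
    then show ?thesis by simp
  qed
  then show ?thesis using assms True by (auto simp: hom_0)
next
  case False
  then show ?thesis
    using coprime_no_common_root[OF assms(1), of "A / B"] assms(2) by (auto simp: hom_nonzero)
qed

lemma rat_map_mk:
  assumes "coprime p q" "n = max (degree p) (degree q)" "A \<noteq> 0 \<or> B \<noteq> 0"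
  shows "rat_map p q (mk A B) = mk (hom n p A B) (hom n q A B)"
proof (cases "B = 0")
  case True
  then show ?thesis using assms by (auto simp: mk_def hom_0 Let_def)
next
  case False
  then show ?thesis using assms by (auto simp: mk_def hom_nonzero)
qed

lemma hom_analytic:
  assumes "A analytic_on {a}" "B analytic_on {a}"
  shows "(\<lambda>t. hom n p (A t) (B t)) analytic_on {a}"
  unfolding hom_def using assms by (intro analytic_intros)

lemma hol_at_rat_map:
  assumes "hol_at F a" "coprime p q"
  shows "hol_at (\<lambda>t. rat_map p q (F t)) a"
proof -
  obtain A B where AB: "A analytic_on {a}" "B analytic_on {a}" "A a \<noteq> 0 \<or> B a \<noteq> 0"
      "\<forall>\<^sub>F t in nhds a. F t = mk (A t) (B t)"
    using assms(1) unfolding hol_at_def by blast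
  define n where "n = max (degree p) (degree q)"
  show ?thesis
  proof (rule hol_atI[OF hom_analytic[OF AB(1,2)] hom_analytic[OF AB(1,2)]])
    show "hom n p (A a) (B a) \<noteq> 0 \<or> hom n q (A a) (B a) \<noteq> 0"
      using hom_pair_nonzero[OF assms(2) n_def AB(3)] .
    show "\<forall>\<^sub>F t in nhds a. rat_map p q (F t) = mk (hom n p (A t) (B t)) (hom n q (A t) (B t))"
      using AB(4) pair_nonzero_eventually[OF AB(1-3)]
      by eventually_elim (simp add: rat_map_mk[OF assms(2) n_def])
  qed
qed

section \<open>Solutions of the differential equation\<close>

lemma analytic_poly: "h analytic_on S \<Longrightarrow> (\<lambda>t. poly G (h t)) analytic_on S"
proof (induction G)
  case (pCons c G)
  then show ?case by (simp add: analytic_on_add analytic_on_mult)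
qed simp

text \<open>Turns the difference d of two solutions of h'' = G(h) into a solution of a linear
  equation d'' = d k. The factor k is built along Horner's scheme.\<close>

lemma poly_difference_factor:
  fixes h1 h2 :: "complex \<Rightarrow> complex"
  assumes "h1 analytic_on {a}" "h2 analytic_on {a}"
  shows "\<exists>k. k analytic_on {a} \<and> (\<forall>t. poly G (h1 t) - poly G (h2 t) = (h1 t - h2 t) * k t)"
proof (induction G)
  case 0
  show ?case by (rule exI[of _ "\<lambda>_. 0"]) auto
next
  case (pCons c G)
  then obtain k where k: "k analytic_on {a}"
    "\<And>t. poly G (h1 t) - poly G (h2 t) = (h1 t - h2 t) * k t" by auto
  have an: "(\<lambda>t. poly G (h1 t) + h2 t * k t) analytic_on {a}"
    using assms k(1) by (intro analytic_on_add analytic_on_mult analytic_poly)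
  have "poly (pCons c G) (h1 t) - poly (pCons c G) (h2 t)
      = (h1 t - h2 t) * (poly G (h1 t) + h2 t * k t)" for t
  proof -
    have "poly (pCons c G) (h1 t) - poly (pCons c G) (h2 t)
      = (h1 t - h2 t) * poly G (h1 t) + h2 t * (poly G (h1 t) - poly G (h2 t))"
      by (simp add: algebra_simps)
    then show ?thesis by (simp add: k(2) algebra_simps)
  qed
  with an show ?case by blast
qed

text \<open>By the Leibniz rule each derivative of \<open>d\<close> at \<open>a\<close> from the
  second on is a combination of lower ones, so the whole Taylor series vanishes.\<close>

lemma second_order_linear_zero:
  assumes d: "d analytic_on {a}" and k: "k analytic_on {a}"
    and eq: "\<forall>\<^sub>F t in nhds a. deriv (deriv d) t = d t * k t"
    and ini: "d a = 0" "deriv d a = 0"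
  shows "\<forall>\<^sub>F t in nhds a. d t = 0"
proof -
  obtain S1 where S1: "open S1" "a \<in> S1" "d holomorphic_on S1" using d analytic_at by blast
  obtain S2 where S2: "open S2" "a \<in> S2" "k holomorphic_on S2" using k analytic_at by blast
  obtain S3 where S3: "open S3" "a \<in> S3" "\<And>t. t \<in> S3 \<Longrightarrow> deriv (deriv d) t = d t * k t"
    using eq unfolding eventually_nhds by blast
  have "open (S1 \<inter> S2 \<inter> S3)" "a \<in> S1 \<inter> S2 \<inter> S3" using S1 S2 S3 by auto
  then obtain r where r: "r > 0" "ball a r \<subseteq> S1 \<inter> S2 \<inter> S3"
    using openE by blast
  have hd: "d holomorphic_on ball a r" and hk: "k holomorphic_on ball a r"
    using r S1(3) S2(3) holomorphic_on_subset by blast+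
  have vanish: "(deriv ^^ n) d a = 0" for n
  proof (induction n rule: less_induct)
    case (less n)
    consider "n = 0" | "n = 1" | m where "n = Suc (Suc m)"
      by (metis One_nat_def not0_implies_Suc)
    then show ?case
    proof cases
      case 3
      have "(deriv ^^ n) d a = (deriv ^^ m) (\<lambda>t. deriv (deriv d) t) a"
        by (simp add: 3 funpow_swap1)
      also have "\<dots> = (deriv ^^ m) (\<lambda>t. d t * k t) a"
      proof (rule higher_deriv_cong_ev)
        show "\<forall>\<^sub>F t in nhds a. deriv (deriv d) t = d t * k t" by (rule eq)
      qed simp
      also have "\<dots> = (\<Sum>i = 0..m. of_nat (m choose i) * (deriv ^^ i) d a * (deriv ^^ (m - i)) k a)"
        by (rule higher_deriv_mult[OF hd hk]) (use r in auto)
      also have "\<dots> = 0"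
        by (rule sum.neutral) (use less 3 in auto)
      finally show ?thesis .
    qed (use ini in auto)
  qed
  have "d t = 0" if "t \<in> ball a r" for t
    by (rule holomorphic_fun_eq_0_on_ball[OF hd that vanish])
  then show ?thesis
    unfolding eventually_nhds using r(1) by (intro exI[of _ "ball a r"]) auto
qed

lemma ode_unique:
  assumes h: "h1 analytic_on {a}" "h2 analytic_on {a}"
    and eq: "\<forall>\<^sub>F t in nhds a. deriv (deriv h1) t = poly G (h1 t)"
            "\<forall>\<^sub>F t in nhds a. deriv (deriv h2) t = poly G (h2 t)"
    and ini: "h1 a = h2 a" "deriv h1 a = deriv h2 a"
  shows "\<forall>\<^sub>F t in nhds a. h1 t = h2 t"
proof -
  obtain k where k: "k analytic_on {a}"
    "\<And>t. poly G (h1 t) - poly G (h2 t) = (h1 t - h2 t) * k t"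
    using poly_difference_factor[OF h] by blast
  have diff: "f field_differentiable (at t)" if "f analytic_on {t}" for f :: "complex \<Rightarrow> complex" and t
    using that analytic_on_imp_differentiable_at by blast
  have d1: "\<forall>\<^sub>F t in nhds a. deriv (\<lambda>t. h1 t - h2 t) t = deriv h1 t - deriv h2 t"
    using analytic_eventually[OF h(1)] analytic_eventually[OF h(2)]
    by eventually_elim (simp add: diff)
  then have "\<forall>\<^sub>F t in nhds a. \<forall>\<^sub>F s in nhds t. deriv (\<lambda>t. h1 t - h2 t) s = deriv h1 s - deriv h2 s"
    by (simp add: eventually_eventually)
  then have "\<forall>\<^sub>F t in nhds a. deriv (deriv (\<lambda>t. h1 t - h2 t)) t = deriv (deriv h1) t - deriv (deriv h2) t"
    using analytic_eventually[OF h(1)] analytic_eventually[OF h(2)]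
  proof eventually_elim
    case (elim t)
    have "deriv (deriv (\<lambda>t. h1 t - h2 t)) t = deriv (\<lambda>s. deriv h1 s - deriv h2 s) t"
      by (rule deriv_cong_ev[OF elim(1) refl])
    also have "\<dots> = deriv (deriv h1) t - deriv (deriv h2) t"
      using elim by (intro deriv_diff diff analytic_deriv)
    finally show ?case .
  qed
  with eq have "\<forall>\<^sub>F t in nhds a. deriv (deriv (\<lambda>t. h1 t - h2 t)) t = (h1 t - h2 t) * k t"
    by eventually_elim (simp add: k(2))
  then have "\<forall>\<^sub>F t in nhds a. h1 t - h2 t = 0"
    by (rule second_order_linear_zero[OF analytic_on_diff[OF h] k(1)])
       (use ini eventually_nhds_at_point[OF d1] in auto)
  then show ?thesis by simp
qed

text \<open>The first order equation has no uniqueness at a zero of \<open>g\<close>, where the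
  constant is a solution too. Differentiation gives 2 h' h'' = g'(h) h'; cancelling h' off its
  isolated zeros leaves a regular second order equation.\<close>

lemma first_order_imp_second_order:
  assumes h: "h analytic_on {a}"
    and eq: "\<forall>\<^sub>F t in nhds a. (deriv h t) ^ 2 = poly g (h t)"
    and nz: "\<forall>\<^sub>F t in at a. deriv h t \<noteq> 0"
  shows "\<forall>\<^sub>F t in nhds a. deriv (deriv h) t = poly (smult (1/2) (pderiv g)) (h t)"
proof (rule analytic_eq_punctured)
  show "deriv (deriv h) analytic_on {a}" using h by (intro analytic_deriv)
  show "(\<lambda>t. poly (smult (1/2) (pderiv g)) (h t)) analytic_on {a}" by (rule analytic_poly[OF h])
  have "\<forall>\<^sub>F t in nhds a. \<forall>\<^sub>F s in nhds t. (deriv h s) ^ 2 = poly g (h s)"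
    using eq by (simp add: eventually_eventually)
  from eventually_at_of_nhds[OF this] eventually_at_of_nhds[OF analytic_eventually[OF h]] nz
  show "\<forall>\<^sub>F t in at a. deriv (deriv h) t = poly (smult (1/2) (pderiv g)) (h t)"
  proof eventually_elim
    case (elim t)
    have d: "(h has_field_derivative deriv h t) (at t)"
      by (rule analytic_DERIV[OF elim(2)])
    have d2: "(deriv h has_field_derivative deriv (deriv h) t) (at t)"
      by (rule analytic_DERIV[OF analytic_deriv[OF elim(2)]])
    have "((\<lambda>s. (deriv h s) ^ 2) has_field_derivative 2 * deriv h t * deriv (deriv h) t) (at t)"
      using DERIV_power[OF d2, of 2] by (simp add: mult_ac)
    moreover have "((\<lambda>s. poly g (h s)) has_field_derivative poly (pderiv g) (h t) * deriv h t) (at t)"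
      using DERIV_chain2[OF poly_DERIV d] .
    moreover have "deriv (\<lambda>s. (deriv h s) ^ 2) t = deriv (\<lambda>s. poly g (h s)) t"
      by (rule deriv_cong_ev[OF elim(1) refl])
    ultimately have "2 * deriv h t * deriv (deriv h) t = poly (pderiv g) (h t) * deriv h t"
      by (metis DERIV_imp_deriv)
    then show ?case using elim(3) by (simp add: field_simps)
  qed
qed

section \<open>Solutions with values in the sphere\<close>

text \<open>The equation is imposed only off \<open>a\<close>, so that \<open>a\<close> may be a
  pole. The condition on the derivative rules out the constant solutions at the roots of
  \<open>f\<close>.\<close>

definition sol_at :: "complex poly \<Rightarrow> (complex \<Rightarrow> csphere) \<Rightarrow> complex \<Rightarrow> bool" where
  "sol_at f F a \<longleftrightarrow> hol_at F a \<and>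
     (\<forall>\<^sub>F t in at a. F t \<noteq> Infty \<and> deriv (\<lambda>s. fin (F s)) t \<noteq> 0 \<and>
        (deriv (\<lambda>s. fin (F s)) t) ^ 2 = poly f (fin (F t)))"

text \<open>In the coordinate \<open>local_param x\<close> the equation \<open>y'\<^sup>2 = f(y)\<close> with cubic \<open>f\<close> becomes
  \<open>h'\<^sup>2 = g(h)\<close> with \<open>g = loc f x\<close>; at infinity \<open>y = 1/h\<close> and \<open>g(h) = h\<^sup>4 f(1/h)\<close>.\<close>

definition loc :: "complex poly \<Rightarrow> csphere \<Rightarrow> complex poly" where
  "loc f x = (case x of Pt c \<Rightarrow> pcompose f [:c, 1:]
     | Infty \<Rightarrow> [:0, coeff f 3, coeff f 2, coeff f 1, coeff f 0:])"

text \<open>Includes squarefreeness, so that the curve y^2 = f(x) is smooth; the leading coefficient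
  is arbitrary.\<close>

definition cubic :: "complex poly \<Rightarrow> bool" where
  "cubic f \<longleftrightarrow> degree f = 3 \<and> (\<forall>z. poly f z = 0 \<longrightarrow> poly (pderiv f) z \<noteq> 0)"

text \<open>The branch points of the double cover y^2 = f(x) of the sphere; infinity is one of them
  because a cubic has odd degree.\<close>

definition branch :: "complex poly \<Rightarrow> csphere set" where
  "branch f = insert Infty (Pt ` {z. poly f z = 0})"

lemma branch_iff: "x \<in> branch f \<longleftrightarrow> poly (loc f x) 0 = 0"
  by (cases x) (auto simp: branch_def loc_def poly_pcompose)

lemma Infty_branch [simp]: "Infty \<in> branch f"
  by (simp add: branch_def)

lemma cubic_poly_eq:
  fixes f :: "complex poly"
  assumes "degree f = 3"
  shows "poly f z = coeff f 0 + coeff f 1 * z + coeff f 2 * z ^ 2 + coeff f 3 * z ^ 3"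
  unfolding poly_altdef assms by (simp add: eval_nat_numeral atMost_Suc algebra_simps)

lemma cubic_loc_simple:
  assumes "cubic f" "x \<in> branch f"
  shows "poly (pderiv (loc f x)) 0 \<noteq> 0"
proof (cases x)
  case (Pt c)
  then have "poly f c = 0" using assms(2) by (auto simp: branch_def)
  then have "poly (pderiv f) c \<noteq> 0" using assms(1) by (auto simp: cubic_def)
  then show ?thesis by (simp add: Pt loc_def pderiv_pcompose poly_pcompose pderiv_pCons)
next
  case Infty
  have "coeff f 3 \<noteq> 0" using assms(1) unfolding cubic_def by (metis degree_0 leading_coeff_0_iff zero_neq_numeral)
  then show ?thesis by (simp add: Infty loc_def pderiv_pCons)
qed

lemma sol_at_hol: "sol_at f F a \<Longrightarrow> hol_at F a"
  by (simp add: sol_at_def)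

lemma sol_at_nonconst:
  assumes "sol_at f F a"
  shows "nonconst_at F a"
  unfolding nonconst_at_def
proof
  fix x
  have hol: "hol_at F a" and ev: "\<forall>\<^sub>F t in at a. F t \<noteq> Infty \<and> deriv (\<lambda>s. fin (F s)) t \<noteq> 0"
    using assms unfolding sol_at_def by (auto elim: eventually_mono)
  from hol_at_avoid_cases[OF hol, of x] show "\<forall>\<^sub>F t in at a. F t \<noteq> x"
  proof
    assume "\<forall>\<^sub>F t in nhds a. F t = x"
    then have "\<forall>\<^sub>F t in nhds a. \<forall>\<^sub>F s in nhds t. F s = x" by (simp add: eventually_eventually)
    from eventually_at_of_nhds[OF this] ev have "\<forall>\<^sub>F t in at a. False"
    proof eventually_elim
      case (elim t)
      have "\<forall>\<^sub>F s in nhds t. fin (F s) = fin x" using elim(1) by eventually_elim simp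
      then have "deriv (\<lambda>s. fin (F s)) t = deriv (\<lambda>s. fin x) t" by (rule deriv_cong_ev) simp
      with elim(2) show ?case by simp
    qed
    then show ?thesis by simp
  qed
qed

text \<open>At infinity y = 1/h gives y' = - h'/h^2, hence h'^2 = h^4 f(1/h). The computation takes
  place off \<open>a\<close>, where y is finite, and extends to \<open>a\<close> because h is
  analytic there.\<close>

lemma sol_germ:
  assumes f: "degree f = 3" and sol: "sol_at f F a"
  obtains h where "h analytic_on {a}" "h a = 0"
    "\<forall>\<^sub>F t in nhds a. F t = local_param (F a) (h t)"
    "\<forall>\<^sub>F t in nhds a. (deriv h t) ^ 2 = poly (loc f (F a)) (h t)"
    "\<forall>\<^sub>F t in at a. deriv h t \<noteq> 0"
proof -
  obtain h where h: "h analytic_on {a}" "h a = 0" "\<forall>\<^sub>F t in nhds a. F t = local_param (F a) (h t)"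
    using hol_at_germ[OF sol_at_hol[OF sol]] .
  have ev: "\<forall>\<^sub>F t in at a. F t \<noteq> Infty \<and> deriv (\<lambda>s. fin (F s)) t \<noteq> 0 \<and>
        (deriv (\<lambda>s. fin (F s)) t) ^ 2 = poly f (fin (F t))"
    using sol unfolding sol_at_def by auto
  have nested: "\<forall>\<^sub>F t in nhds a. \<forall>\<^sub>F s in nhds t. F s = local_param (F a) (h s)"
    using h(3) by (simp add: eventually_eventually)
  have key: "\<forall>\<^sub>F t in at a. (deriv h t) ^ 2 = poly (loc f (F a)) (h t) \<and> deriv h t \<noteq> 0"
    using ev eventually_at_of_nhds[OF nested] eventually_at_of_nhds[OF h(3)]
      eventually_at_of_nhds[OF analytic_eventually[OF h(1)]]
  proof eventually_elim
    case (elim t)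
    have dh: "(h has_field_derivative deriv h t) (at t)"
      by (rule analytic_DERIV[OF elim(4)])
    show ?case
    proof (cases "F a")
      case (Pt c)
      have "deriv (\<lambda>s. fin (F s)) t = deriv (\<lambda>s. c + h s) t"
        by (rule deriv_cong_ev) (use elim(2) in \<open>auto simp: Pt elim: eventually_mono\<close>)
      also have "\<dots> = deriv h t"
        by (rule DERIV_imp_deriv) (auto intro!: derivative_eq_intros dh)
      finally show ?thesis using elim(1,3) by (simp add: Pt loc_def poly_pcompose)
    next
      case Infty
      have ht: "h t \<noteq> 0" and Ft: "F t = Pt (1 / h t)"
        using elim(1,3) by (auto simp: Infty split: if_splits)
      have "\<forall>\<^sub>F s in nhds t. h s \<noteq> 0"
        using analytic_tendsto[OF elim(4)] ht tendsto_imp_eventually_ne by blast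
      then have "\<forall>\<^sub>F s in nhds t. fin (F s) = 1 / h s"
        using elim(2) by eventually_elim (simp add: Infty)
      then have "deriv (\<lambda>s. fin (F s)) t = deriv (\<lambda>s. 1 / h s) t"
        by (rule deriv_cong_ev) simp
      also have "\<dots> = - deriv h t / (h t) ^ 2"
        by (rule DERIV_imp_deriv) (use ht in \<open>auto intro!: derivative_eq_intros dh simp: power2_eq_square\<close>)
      finally have D: "deriv (\<lambda>s. fin (F s)) t = - deriv h t / (h t) ^ 2" .
      have "(deriv h t) ^ 2 / (h t) ^ 4 = poly f (1 / h t)"
        using elim(1) unfolding D Ft by (simp add: power_divide power_mult[symmetric])
      then have "(deriv h t) ^ 2 = (h t) ^ 4 * poly f (1 / h t)"
        using ht by (simp add: field_simps)
      also have "\<dots> = poly (loc f (F a)) (h t)"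
        using ht unfolding cubic_poly_eq[OF f]
        by (simp add: Infty loc_def field_simps power_numeral_reduce)
      finally show ?thesis using elim(1) unfolding D by auto
    qed
  qed
  have "(\<lambda>t. (deriv h t) ^ 2) analytic_on {a}"
    using analytic_deriv[OF h(1)] by (rule analytic_on_power)
  moreover have "(\<lambda>t. poly (loc f (F a)) (h t)) analytic_on {a}" by (rule analytic_poly[OF h(1)])
  moreover have "\<forall>\<^sub>F t in at a. (deriv h t) ^ 2 = poly (loc f (F a)) (h t)"
    using key by eventually_elim simp
  ultimately have "\<forall>\<^sub>F t in nhds a. (deriv h t) ^ 2 = poly (loc f (F a)) (h t)"
    by (rule analytic_eq_punctured)
  moreover have "\<forall>\<^sub>F t in at a. deriv h t \<noteq> 0" using key by eventually_elim simp
  ultimately show thesis using that h by blast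
qed

lemma sol_unique_core:
  assumes f: "degree f = 3" and sol: "sol_at f F a" "sol_at f G a" and "F a = G a"
    and h: "h analytic_on {a}" "h a = 0"
    "\<forall>\<^sub>F t in nhds a. F t = local_param (F a) (h t)"
    "\<forall>\<^sub>F t in nhds a. (deriv h t) ^ 2 = poly (loc f (F a)) (h t)"
    "\<forall>\<^sub>F t in at a. deriv h t \<noteq> 0"
    and k: "k analytic_on {a}" "k a = 0"
    "\<forall>\<^sub>F t in nhds a. G t = local_param (G a) (k t)"
    "\<forall>\<^sub>F t in nhds a. (deriv k t) ^ 2 = poly (loc f (G a)) (k t)"
    "\<forall>\<^sub>F t in at a. deriv k t \<noteq> 0"
    and "deriv h a = deriv k a"
  shows "\<forall>\<^sub>F t in nhds a. F t = G t"
proof -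
  have "\<forall>\<^sub>F t in nhds a. h t = k t"
    by (rule ode_unique[OF h(1) k(1) first_order_imp_second_order[OF h(1,4,5)]
          first_order_imp_second_order[OF k(1,4,5), folded \<open>F a = G a\<close>]])
       (use assms in auto)
  with h(3) k(3) show ?thesis by eventually_elim (simp add: \<open>F a = G a\<close>)
qed

text \<open>At a branch point the local equation forces h'(a) = 0, so the value alone determines the
  solution. Elsewhere two signs of h'(a) remain.\<close>

lemma sol_unique_branch:
  assumes f: "degree f = 3" and sol: "sol_at f F a" "sol_at f G a" and eq: "F a = G a" "F a \<in> branch f"
  shows "\<forall>\<^sub>F t in nhds a. F t = G t"
proof -
  obtain h where h: "h analytic_on {a}" "h a = 0" "\<forall>\<^sub>F t in nhds a. F t = local_param (F a) (h t)"
    "\<forall>\<^sub>F t in nhds a. (deriv h t) ^ 2 = poly (loc f (F a)) (h t)" "\<forall>\<^sub>F t in at a. deriv h t \<noteq> 0"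
    using sol_germ[OF f sol(1)] .
  obtain k where k: "k analytic_on {a}" "k a = 0" "\<forall>\<^sub>F t in nhds a. G t = local_param (G a) (k t)"
    "\<forall>\<^sub>F t in nhds a. (deriv k t) ^ 2 = poly (loc f (G a)) (k t)" "\<forall>\<^sub>F t in at a. deriv k t \<noteq> 0"
    using sol_germ[OF f sol(2)] .
  have "deriv h a = deriv k a"
    using eventually_nhds_at_point[OF h(4)] eventually_nhds_at_point[OF k(4)] eq
    by (simp add: branch_iff h(2) k(2))
  then show ?thesis by (rule sol_unique_core[OF f sol eq(1) h k])
qed

section \<open>Rational substitutions in the differential equation\<close>

lemma rat_map_id: "rat_map [:0, 1:] 1 x = x"
  by (cases x) auto

definition wronskian :: "complex poly \<Rightarrow> complex poly \<Rightarrow> complex poly" where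
  "wronskian p q = pderiv p * q - p * pderiv q"

text \<open>The quartic form B^4 f(A/B). Degree 4 instead of 3 makes it vanish at infinity as well,
  hence exactly at \<open>branch f\<close> if \<open>f\<close> is a cubic.\<close>

definition hat :: "complex poly \<Rightarrow> complex \<Rightarrow> complex \<Rightarrow> complex" where
  "hat f A B = B * (coeff f 3 * A ^ 3 + coeff f 2 * A ^ 2 * B + coeff f 1 * A * B ^ 2 + coeff f 0 * B ^ 3)"

lemma hat_eq:
  assumes "degree f = 3" "B \<noteq> 0"
  shows "hat f A B = B ^ 4 * poly f (A / B)"
  using assms(2) unfolding cubic_poly_eq[OF assms(1)] hat_def
  by (simp add: field_simps power_numeral_reduce)

lemma nonconst_avoid_finite:
  assumes "nonconst_at F a" "finite S"
  shows "\<forall>\<^sub>F t in at a. F t \<notin> S"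
  using assms(2)
proof (induction S)
  case (insert x S)
  have "\<forall>\<^sub>F t in at a. F t \<noteq> x" using assms(1) unfolding nonconst_at_def by blast
  with insert(3) show ?case by eventually_elim simp
qed simp

lemma nonconst_avoid_roots:
  assumes "nonconst_at F a" "q \<noteq> 0"
  shows "\<forall>\<^sub>F t in at a. poly q (fin (F t)) \<noteq> 0"
proof -
  have "finite (insert Infty (Pt ` {z. poly q z = 0}))" using poly_roots_finite[OF assms(2)] by simp
  from nonconst_avoid_finite[OF assms(1) this] show ?thesis
  proof eventually_elim
    case (elim t)
    then show ?case by (cases "F t") auto
  qed
qed

lemma eventually_at_affine:
  fixes k a c :: complex
  assumes "k \<noteq> 0" "\<forall>\<^sub>F s in at (k * a + c). P s"
  shows "\<forall>\<^sub>F t in at a. P (k * t + c)"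
proof -
  have "filterlim (\<lambda>t. k * t + c) (at (k * a + c)) (at a)"
    unfolding filterlim_at
  proof
    show "\<forall>\<^sub>F t in at a. k * t + c \<in> UNIV \<and> k * t + c \<noteq> k * a + c"
      using assms(1) by (auto simp: eventually_at_filter)
    show "((\<lambda>t. k * t + c) \<longlongrightarrow> k * a + c) (at a)"
      using analytic_at_imp_isCont[OF analytic_affine] by (simp add: isCont_def)
  qed
  then show ?thesis using assms(2) unfolding filterlim_iff by blast
qed

text \<open>With y = p(z)/q(z) the chain rule gives y' = k W(z) z' / q(z)^2, where W is the
  Wronskian; \<open>id\<close> is the equation y'^2 = g(y) multiplied by q(z)^4.\<close>

lemma sol_compose:
  assumes f: "degree f = 3" "degree g = 3" and k: "k \<noteq> 0" and sol: "sol_at f F (k * a + c)"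
    and pq: "coprime p q" "wronskian p q \<noteq> 0"
    and id: "\<And>z. k ^ 2 * (poly (wronskian p q) z) ^ 2 * poly f z = hat g (poly p z) (poly q z)"
  shows "sol_at g (\<lambda>t. rat_map p q (F (k * t + c))) a"
proof -
  define G where "G = (\<lambda>t. rat_map p q (F (k * t + c)))"
  have q0: "q \<noteq> 0" using pq(2) by (auto simp: wronskian_def)
  have hF: "hol_at F (k * a + c)" by (rule sol_at_hol[OF sol])
  have nF: "nonconst_at F (k * a + c)" by (rule sol_at_nonconst[OF sol])
  have "hol_at (\<lambda>t. F (k * t + c)) a" by (rule hol_at_affine[OF hF])
  then have hG: "hol_at G a" unfolding G_def by (rule hol_at_rat_map[OF _ pq(1)])
  have ev: "\<forall>\<^sub>F s in at (k * a + c). F s \<noteq> Infty \<and> deriv (\<lambda>s. fin (F s)) s \<noteq> 0 \<and>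
        (deriv (\<lambda>s. fin (F s)) s) ^ 2 = poly f (fin (F s))"
    using sol unfolding sol_at_def by auto
  \<comment> \<open>Poles of \<open>F\<close>, roots of \<open>q\<close> and roots of the Wronskian
    are met only at isolated parameters, because \<open>F\<close> is not constant.\<close>
  have ev2: "\<forall>\<^sub>F s in at (k * a + c). (F s \<noteq> Infty \<and> deriv (\<lambda>s. fin (F s)) s \<noteq> 0 \<and>
        (deriv (\<lambda>s. fin (F s)) s) ^ 2 = poly f (fin (F s))) \<and> hol_at F s \<and>
        poly q (fin (F s)) \<noteq> 0 \<and> poly (wronskian p q) (fin (F s)) \<noteq> 0"
    using ev eventually_at_of_nhds[OF hol_at_eventually[OF hF]]
      nonconst_avoid_roots[OF nF q0] nonconst_avoid_roots[OF nF pq(2)]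
    by eventually_elim simp
  have "\<forall>\<^sub>F t in at a. G t \<noteq> Infty \<and> deriv (\<lambda>s. fin (G s)) t \<noteq> 0 \<and>
        (deriv (\<lambda>s. fin (G s)) t) ^ 2 = poly g (fin (G t))"
    using eventually_at_affine[OF k ev2]
  proof eventually_elim
    case (elim t)
    define \<phi> where "\<phi> = (\<lambda>s. fin (F s))"
    define s0 where "s0 = k * t + c"
    have an: "\<phi> analytic_on {s0}" and fev: "\<forall>\<^sub>F s in nhds s0. F s \<noteq> Infty"
      unfolding \<phi>_def s0_def using elim by (auto intro: hol_at_fin)
    have d: "(\<phi> has_field_derivative deriv \<phi> s0) (at s0)"
      by (rule analytic_DERIV[OF an])
    have q1: "poly q (\<phi> s0) \<noteq> 0" using elim by (simp add: \<phi>_def s0_def)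
    have "((\<lambda>s. poly q (\<phi> s)) \<longlongrightarrow> poly q (\<phi> s0)) (nhds s0)"
      by (rule analytic_tendsto[OF analytic_poly[OF an]])
    then have "\<forall>\<^sub>F s in nhds s0. poly q (\<phi> s) \<noteq> 0"
      using q1 tendsto_imp_eventually_ne by blast
    then have loc: "\<forall>\<^sub>F s in nhds s0. rat_map p q (F s) = Pt (poly p (\<phi> s) / poly q (\<phi> s))"
      using fev
    proof eventually_elim
      case (elim s)
      then show ?case by (cases "F s") (auto simp: \<phi>_def)
    qed
    have lim: "filterlim (\<lambda>t. k * t + c) (nhds s0) (nhds t)"
      unfolding s0_def by (rule analytic_tendsto[OF analytic_affine])
    have Gev: "\<forall>\<^sub>F r in nhds t. G r = Pt (poly p (\<phi> (k * r + c)) / poly q (\<phi> (k * r + c)))"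
      using filterlim_iff[THEN iffD1, OF lim, rule_format, OF loc] by (simp add: G_def)
    have Gt: "G t = Pt (poly p (\<phi> s0) / poly q (\<phi> s0))"
      using eventually_nhds_at_point[OF Gev] by (simp add: s0_def)
    have "((\<lambda>r. poly p (\<phi> (k * r + c)) / poly q (\<phi> (k * r + c))) has_field_derivative
        (poly (pderiv p) (\<phi> s0) * (deriv \<phi> s0 * k) * poly q (\<phi> s0)
          - poly p (\<phi> s0) * (poly (pderiv q) (\<phi> s0) * (deriv \<phi> s0 * k))) / (poly q (\<phi> s0) * poly q (\<phi> s0))) (at t)"
    proof -
      have dd: "((\<lambda>r. \<phi> (k * r + c)) has_field_derivative deriv \<phi> s0 * k) (at t)"
        by (rule DERIV_chain2[where f = \<phi> and g = "\<lambda>r. k * r + c"])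
           (use d in \<open>auto simp: s0_def intro!: derivative_eq_intros\<close>)
      have P: "((\<lambda>r. poly P (\<phi> (k * r + c))) has_field_derivative poly (pderiv P) (\<phi> s0) * (deriv \<phi> s0 * k)) (at t)" for P
        using DERIV_chain2[OF poly_DERIV dd, of P] by (simp add: s0_def)
      show ?thesis
        using DERIV_divide[OF P[of p] P[of q]] q1 by (simp add: s0_def)
    qed
    then have "deriv (\<lambda>r. poly p (\<phi> (k * r + c)) / poly q (\<phi> (k * r + c))) t =
        k * deriv \<phi> s0 * poly (wronskian p q) (\<phi> s0) / (poly q (\<phi> s0)) ^ 2"
      by (subst DERIV_imp_deriv, assumption)
         (simp add: wronskian_def algebra_simps power2_eq_square diff_divide_distrib)
    moreover have "deriv (\<lambda>r. fin (G r)) t = deriv (\<lambda>r. poly p (\<phi> (k * r + c)) / poly q (\<phi> (k * r + c))) t"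
      by (rule deriv_cong_ev) (use Gev in \<open>auto elim: eventually_mono\<close>)
    ultimately have D: "deriv (\<lambda>r. fin (G r)) t =
        k * deriv \<phi> s0 * poly (wronskian p q) (\<phi> s0) / (poly q (\<phi> s0)) ^ 2" by simp
    have nz: "deriv \<phi> s0 \<noteq> 0" "(deriv \<phi> s0) ^ 2 = poly f (\<phi> s0)" "poly (wronskian p q) (\<phi> s0) \<noteq> 0"
      using elim by (auto simp: \<phi>_def s0_def)
    have "(deriv (\<lambda>r. fin (G r)) t) ^ 2
        = k ^ 2 * (poly (wronskian p q) (\<phi> s0)) ^ 2 * poly f (\<phi> s0) / (poly q (\<phi> s0)) ^ 4"
      unfolding D nz(2)[symmetric] by (simp add: power_divide power_mult_distrib mult_ac flip: power_mult)
    also have "\<dots> = poly g (poly p (\<phi> s0) / poly q (\<phi> s0))"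
      unfolding id hat_eq[OF f(2) q1] using q1 by simp
    finally have "(deriv (\<lambda>r. fin (G r)) t) ^ 2 = poly g (fin (G t))" by (simp add: Gt)
    moreover have "deriv (\<lambda>r. fin (G r)) t \<noteq> 0" unfolding D using k nz q1 by simp
    ultimately show ?case by (simp add: Gt)
  qed
  with hG show ?thesis unfolding sol_at_def G_def by auto
qed

text \<open>The case of the identity fraction in \<open>sol_compose\<close>; k is 1 or -1, so these
  are the translations and reflections of the parameter.\<close>

lemma sol_affine:
  assumes "degree f = 3" "k ^ 2 = 1" "sol_at f F (k * a + c)"
  shows "sol_at f (\<lambda>t. F (k * t + c)) a"
proof -
  have W: "wronskian [:0, 1:] 1 = 1" by (simp add: wronskian_def pderiv_pCons)
  have "sol_at f (\<lambda>t. rat_map [:0, 1:] 1 (F (k * t + c))) a"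
  proof (rule sol_compose[OF assms(1,1) _ assms(3)])
    show "k \<noteq> 0" using assms(2) by auto
    show "k ^ 2 * (poly (wronskian [:0, 1:] 1) z) ^ 2 * poly f z = hat f (poly [:0, 1:] z) (poly 1 z)" for z
      using hat_eq[OF assms(1), of 1 z] by (simp add: W assms(2))
  qed (auto simp: W)
  then show ?thesis by (simp add: rat_map_id)
qed

lemma sol_shift:
  assumes "degree f = 3" "sol_at f F (a + c)"
  shows "sol_at f (\<lambda>t. F (t + c)) a"
  using sol_affine[OF assms(1), of 1 F a c] assms(2) by simp

lemma sol_reflect:
  assumes "degree f = 3" "sol_at f F (c - a)"
  shows "sol_at f (\<lambda>t. F (c - t)) a"
  using sol_affine[OF assms(1), of "-1" F a c] assms(2) by simp

text \<open>The equation determines h'(0) up to sign, and reversing the parameter switches the sign;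
  so one of the two comparisons has matching initial data.\<close>

lemma sol_unique:
  assumes f: "degree f = 3" and sol: "sol_at f F a" "sol_at f G b" and eq: "F a = G b"
  shows "(\<forall>\<^sub>F t in nhds 0. F (a + t) = G (b + t)) \<or> (\<forall>\<^sub>F t in nhds 0. F (a + t) = G (b - t))"
proof -
  define F0 where "F0 = (\<lambda>t. F (t + a))"
  define G0 where "G0 = (\<lambda>t. G (t + b))"
  define G1 where "G1 = (\<lambda>t. G (b - t))"
  have s: "sol_at f F0 0" "sol_at f G0 0" "sol_at f G1 0"
    unfolding F0_def G0_def G1_def using sol by (auto intro!: sol_shift sol_reflect f)
  have e: "F0 0 = G0 0" "F0 0 = G1 0" using eq by (auto simp: F0_def G0_def G1_def)
  obtain h where h: "h analytic_on {0}" "h 0 = 0" "\<forall>\<^sub>F t in nhds 0. F0 t = local_param (F0 0) (h t)"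
    "\<forall>\<^sub>F t in nhds 0. (deriv h t) ^ 2 = poly (loc f (F0 0)) (h t)" "\<forall>\<^sub>F t in at 0. deriv h t \<noteq> 0"
    using sol_germ[OF f s(1)] .
  obtain k where k: "k analytic_on {0}" "k 0 = 0" "\<forall>\<^sub>F t in nhds 0. G0 t = local_param (G0 0) (k t)"
    "\<forall>\<^sub>F t in nhds 0. (deriv k t) ^ 2 = poly (loc f (G0 0)) (k t)" "\<forall>\<^sub>F t in at 0. deriv k t \<noteq> 0"
    using sol_germ[OF f s(2)] .
  obtain m where m: "m analytic_on {0}" "m 0 = 0" "\<forall>\<^sub>F t in nhds 0. G1 t = local_param (G1 0) (m t)"
    "\<forall>\<^sub>F t in nhds 0. (deriv m t) ^ 2 = poly (loc f (G1 0)) (m t)" "\<forall>\<^sub>F t in at 0. deriv m t \<noteq> 0"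
    using sol_germ[OF f s(3)] .
  have lim: "filterlim uminus (nhds 0) (nhds (0 :: complex))"
    using analytic_tendsto[OF analytic_affine[of "-1" 0 "{0}"]] by simp
  have "\<forall>\<^sub>F t in nhds 0. G0 (- t) = local_param (G0 0) (k (- t))"
    using filterlim_iff[THEN iffD1, OF lim, rule_format, OF k(3)] by simp
  then have "\<forall>\<^sub>F t in nhds 0. m t = k (- t)"
    using m(3)
  proof eventually_elim
    case (elim t)
    then have "local_param (G0 0) (m t) = local_param (G0 0) (k (- t))"
      by (simp add: G0_def G1_def)
    then show ?case by (simp only: local_param_inj)
  qed
  then have "deriv m 0 = deriv (\<lambda>t. k (- t)) 0" by (rule deriv_cong_ev) simp
  also have "\<dots> = - deriv k 0" by (rule deriv_reflect[OF k(1)])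
  finally have mk: "deriv m 0 = - deriv k 0" .
  have "(deriv h 0) ^ 2 = (deriv k 0) ^ 2"
    using eventually_nhds_at_point[OF h(4)] eventually_nhds_at_point[OF k(4)] e
    by (simp add: h(2) k(2))
  then consider "deriv h 0 = deriv k 0" | "deriv h 0 = deriv m 0"
    unfolding mk power2_eq_iff by blast
  then show ?thesis
  proof cases
    case 1
    have "\<forall>\<^sub>F t in nhds 0. F0 t = G0 t" by (rule sol_unique_core[OF f s(1,2) e(1) h k 1])
    then show ?thesis by (simp add: F0_def G0_def add.commute)
  next
    case 2
    have "\<forall>\<^sub>F t in nhds 0. F0 t = G1 t" by (rule sol_unique_core[OF f s(1,3) e(2) h m 2])
    then show ?thesis by (simp add: F0_def G1_def add.commute)
  qed
qed

section \<open>Local degrees\<close>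

text \<open>Multiplicity for maps defined on the plane, such as \<wp>. Local degrees of a fraction
  \<open>R\<close> are read off from those of \<open>R \<circ> \<wp>\<close> and \<wp> by
  multiplicativity.\<close>

definition germ_degree :: "(complex \<Rightarrow> csphere) \<Rightarrow> complex \<Rightarrow> int" where
  "germ_degree F a = zorder (\<lambda>t. local_coord (F a) (F t)) a"

lemma local_degree_eq_germ_degree: "local_degree R x = germ_degree (\<lambda>t. R (local_param x t)) 0"
  by (simp add: local_degree_def germ_degree_def)

lemma germ_degree_eq_zorder:
  assumes "\<forall>\<^sub>F t in nhds a. F t = local_param (F a) (h t)"
  shows "germ_degree F a = zorder h a"
  unfolding germ_degree_def
proof (rule zorder_cong)
  show "\<forall>\<^sub>F t in at a. local_coord (F a) (F t) = h t"
    using eventually_at_of_nhds[OF assms]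
  proof eventually_elim
    case (elim t)
    then show ?case by (metis local_coord_param)
  qed
qed simp

lemma germ_nonzero:
  assumes "nonconst_at F a" "\<forall>\<^sub>F t in nhds a. F t = local_param (F a) (h t)"
  shows "\<forall>\<^sub>F t in at a. h t \<noteq> 0"
proof -
  have "\<forall>\<^sub>F t in at a. F t \<noteq> F a" using assms(1) unfolding nonconst_at_def by blast
  with eventually_at_of_nhds[OF assms(2)] show ?thesis
  proof eventually_elim
    case (elim t)
    then show ?case by (metis local_param_0)
  qed
qed

lemma germ_degree_pos:
  assumes "hol_at F a" "nonconst_at F a"
  shows "germ_degree F a > 0"
proof -
  obtain h where h: "h analytic_on {a}" "h a = 0" "\<forall>\<^sub>F t in nhds a. F t = local_param (F a) (h t)"
    using hol_at_germ[OF assms(1)] .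
  have "\<exists>\<^sub>F t in at a. h t \<noteq> 0"
    using germ_nonzero[OF assms(2) h(3)] by (rule eventually_frequently[rotated]) simp
  then show ?thesis
    unfolding germ_degree_eq_zorder[OF h(3)] using zorder_pos_iff'[OF h(1)] h(2) by simp
qed

lemma injective_nonconst:
  assumes "inj F"
  shows "nonconst_at F a"
  unfolding nonconst_at_def
proof
  fix x
  show "\<forall>\<^sub>F t in at a. F t \<noteq> x"
  proof (cases "\<exists>t0. F t0 = x \<and> t0 \<noteq> a")
    case True
    then obtain t0 where t0: "F t0 = x" "t0 \<noteq> a" by blast
    have "\<forall>\<^sub>F t in at a. t \<noteq> t0"
      using t0(2) by (metis eventually_neq_at_within)
    then show ?thesis by eventually_elim (use assms t0 in \<open>auto dest: injD\<close>)
  next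
    case False
    then have "F t \<noteq> x" if "t \<noteq> a" for t using that by blast
    then show ?thesis by (simp add: eventually_at_filter)
  qed
qed

lemma nonconst_local_param: "nonconst_at (local_param x) a"
  by (rule injective_nonconst) (simp add: inj_def local_param_inj)

section \<open>Local degrees of rational maps\<close>

text \<open>Unlike \<open>rational_of_degree\<close> this excludes constants, so that fibres are
  finite and local degrees are positive.\<close>

definition rational :: "(csphere \<Rightarrow> csphere) \<Rightarrow> bool" where
  "rational R \<longleftrightarrow> (\<exists>p q. coprime p q \<and> max (degree p) (degree q) > 0 \<and> R = rat_map p q)"

lemma coprime_nonconst_comb:
  fixes p q :: "complex poly"
  assumes "coprime p q" "max (degree p) (degree q) > 0"
  shows "q \<noteq> 0" "p - smult y q \<noteq> 0"
proof -
  show "q \<noteq> 0"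
  proof
    assume q: "q = 0"
    then have "is_unit p" using assms(1) by simp
    then show False using assms(2) q by (auto simp: is_unit_poly_iff)
  qed
  show "p - smult y q \<noteq> 0"
  proof
    assume "p - smult y q = 0"
    then have p: "p = smult y q" by simp
    then have "q dvd p" by (simp add: dvd_smult)
    then have "is_unit q" by (rule coprime_common_divisor[OF assms(1)]) simp
    then have "degree q = 0" by (auto simp: is_unit_poly_iff)
    then show False using assms(2) p by (simp add: degree_smult_eq split: if_splits)
  qed
qed

lemma rational_fiber_finite:
  assumes "rational R"
  shows "finite {x. R x = y}"
proof -
  obtain p q where pq: "coprime p q" "max (degree p) (degree q) > 0" "R = rat_map p q"
    using assms unfolding rational_def by blast
  note nz = coprime_nonconst_comb[OF pq(1,2)]
  have "{x. R x = y} \<subseteq> insert Infty (Pt ` ({z. poly q z = 0} \<union> {z. poly (p - smult (fin y) q) z = 0}))"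
  proof
    fix x assume x: "x \<in> {x. R x = y}"
    then show "x \<in> insert Infty (Pt ` ({z. poly q z = 0} \<union> {z. poly (p - smult (fin y) q) z = 0}))"
      by (cases x; cases y) (auto simp: pq(3) split: if_splits)
  qed
  moreover have "finite \<dots>"
    using poly_roots_finite[OF nz(1)] poly_roots_finite[OF nz(2)[of "fin y"]] by blast
  ultimately show ?thesis by (rule finite_subset)
qed

lemma rational_comp:
  assumes "rational R" "hol_at F a" "nonconst_at F a"
  shows "hol_at (\<lambda>t. R (F t)) a" "nonconst_at (\<lambda>t. R (F t)) a"
proof -
  show "hol_at (\<lambda>t. R (F t)) a"
    using assms(1) hol_at_rat_map[OF assms(2)] unfolding rational_def by auto
  show "nonconst_at (\<lambda>t. R (F t)) a"
    unfolding nonconst_at_def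
    using nonconst_avoid_finite[OF assms(3) rational_fiber_finite[OF assms(1)]] by simp
qed

lemma germ_degree_comp:
  assumes R: "rational R" and F: "hol_at F a" "nonconst_at F a"
  shows "germ_degree (\<lambda>t. R (F t)) a = local_degree R (F a) * germ_degree F a"
proof -
  obtain h where h: "h analytic_on {a}" "h a = 0" "\<forall>\<^sub>F t in nhds a. F t = local_param (F a) (h t)"
    using hol_at_germ[OF F(1)] .
  note RL = rational_comp[OF R hol_at_local_param nonconst_local_param, of "F a" 0]
  obtain k where k: "k analytic_on {0}" "k 0 = 0"
      "\<forall>\<^sub>F s in nhds 0. R (local_param (F a) s) = local_param (R (F a)) (k s)"
    using hol_at_germ[OF RL(1)] by auto
  have hnz: "\<forall>\<^sub>F t in at a. h t \<noteq> 0" by (rule germ_nonzero[OF F(2) h(3)])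
  have knz: "\<forall>\<^sub>F s in at 0. k s \<noteq> 0" using germ_nonzero[OF RL(2), of k] k(3) by simp
  have lim: "filterlim h (nhds 0) (nhds a)" using analytic_tendsto[OF h(1)] by (simp add: h(2))
  have "\<forall>\<^sub>F t in nhds a. R (local_param (F a) (h t)) = local_param (R (F a)) (k (h t))"
    using lim k(3) unfolding filterlim_iff by blast
  with h(3) have ev: "\<forall>\<^sub>F t in nhds a. R (F t) = local_param (R (F a)) ((k \<circ> h) t)"
    by eventually_elim simp
  have "germ_degree (\<lambda>t. R (F t)) a = zorder (k \<circ> h) a" by (rule germ_degree_eq_zorder) (rule ev)
  also have "\<dots> = zorder k (h a) * zorder (\<lambda>x. h x - h a) a"
    using h k hnz knz
    by (intro zorder_compose') (auto simp: isolated_singularity_at_analytic not_essential_analytic)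
  also have "zorder k (h a) = local_degree R (F a)"
    unfolding local_degree_eq_germ_degree using germ_degree_eq_zorder[of "\<lambda>t. R (local_param (F a) t)" 0 k] k(3) h(2) by simp
  also have "zorder (\<lambda>x. h x - h a) a = germ_degree F a" using germ_degree_eq_zorder[OF h(3)] h(2) by simp
  finally show ?thesis .
qed

lemma local_degree_comp:
  assumes "rational R" "rational S"
  shows "local_degree (R \<circ> S) x = local_degree R (S x) * local_degree S x"
  using germ_degree_comp[OF assms(1) rational_comp[OF assms(2) hol_at_local_param nonconst_local_param], of x 0]
  by (simp add: local_degree_eq_germ_degree)

lemma local_degree_pos:
  assumes "rational R"
  shows "local_degree R x > 0"
  unfolding local_degree_eq_germ_degree
  by (rule germ_degree_pos[OF rational_comp[OF assms hol_at_local_param nonconst_local_param]])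

text \<open>In the local equation h'^2 = g(h) with h(a) = 0, off the branch points h'(a)^2 = g(0) is
  nonzero. At a branch point h'(a) = 0, but h''(a) = g'(0)/2 is nonzero because the root is
  simple.\<close>

lemma sol_germ_degree:
  assumes f: "cubic f" and sol: "sol_at f F a"
  shows "germ_degree F a = (if F a \<in> branch f then 2 else 1)"
proof -
  have d3: "degree f = 3" using f by (simp add: cubic_def)
  obtain h where h: "h analytic_on {a}" "h a = 0" "\<forall>\<^sub>F t in nhds a. F t = local_param (F a) (h t)"
    "\<forall>\<^sub>F t in nhds a. (deriv h t) ^ 2 = poly (loc f (F a)) (h t)" "\<forall>\<^sub>F t in at a. deriv h t \<noteq> 0"
    using sol_germ[OF d3 sol] .
  have d1: "(deriv h a) ^ 2 = poly (loc f (F a)) 0"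
    using eventually_nhds_at_point[OF h(4)] h(2) by simp
  have d2: "deriv (deriv h) a = poly (pderiv (loc f (F a))) 0 / 2"
    using eventually_nhds_at_point[OF first_order_imp_second_order[OF h(1,4,5)]] h(2) by simp
  show ?thesis
  proof (cases "F a \<in> branch f")
    case True
    have "zorder h a = 2"
    proof (rule zorder_zero_eqI'[OF h(1)])
      show "(deriv ^^ i) h a = 0" if "i < nat 2" for i
      proof -
        have "i = 0 \<or> i = 1" using that by auto
        then show ?thesis using h(2) d1 True by (auto simp: branch_iff)
      qed
      show "(deriv ^^ nat 2) h a \<noteq> 0"
        using cubic_loc_simple[OF f True] d2 by (auto simp: numeral_2_eq_2)
    qed simp
    then show ?thesis using germ_degree_eq_zorder[OF h(3)] True by simp
  next
    case False
    have "zorder h a = 1"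
      by (rule zorder_zero_eqI'[OF h(1)]) (use h(2) d1 False in \<open>auto simp: branch_iff\<close>)
    then show ?thesis using germ_degree_eq_zorder[OF h(3)] False by simp
  qed
qed

section \<open>Global solutions\<close>

definition gsol :: "complex poly \<Rightarrow> (complex \<Rightarrow> csphere) \<Rightarrow> bool" where
  "gsol f F \<longleftrightarrow> cubic f \<and> (\<forall>a. sol_at f F a)"

lemma gsolD:
  assumes "gsol f F"
  shows "cubic f" "degree f = 3" "sol_at f F a" "hol_at F a" "nonconst_at F a"
  using assms by (auto simp: gsol_def cubic_def intro: sol_at_hol sol_at_nonconst)

lemma gsol_affine:
  assumes "gsol f F" "k ^ 2 = 1"
  shows "gsol f (\<lambda>t. F (k * t + c))"
  using assms gsolD(2)[OF assms(1)] unfolding gsol_def by (auto intro: sol_affine)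

lemma gsol_shift: "gsol f F \<Longrightarrow> gsol f (\<lambda>t. F (c + t))"
  using gsol_affine[of f F 1 c] by (simp add: add.commute)

lemma gsol_reflect: "gsol f F \<Longrightarrow> gsol f (\<lambda>t. F (c - t))"
  using gsol_affine[of f F "-1" c] by simp

lemma gsol_eqI:
  assumes "gsol f F" "gsol g G" "\<forall>\<^sub>F t in nhds a. F t = G t"
  shows "F t = G t"
  by (rule hol_eq_UNIV[OF _ _ assms(3)]) (use gsolD(4)[OF assms(1)] gsolD(4)[OF assms(2)] in auto)

lemma gsol_unique:
  assumes "gsol f F" "gsol f G" "F a = G b"
  shows "(\<forall>t. F (a + t) = G (b + t)) \<or> (\<forall>t. F (a + t) = G (b - t))"
proof -
  have "(\<forall>\<^sub>F t in nhds 0. F (a + t) = G (b + t)) \<or> (\<forall>\<^sub>F t in nhds 0. F (a + t) = G (b - t))"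
    by (rule sol_unique[of f]) (use assms gsolD in blast)+
  then show ?thesis
  proof
    assume e: "\<forall>\<^sub>F t in nhds 0. F (a + t) = G (b + t)"
    have "\<forall>t. F (a + t) = G (b + t)"
      by (intro allI gsol_eqI[OF gsol_shift[OF assms(1)] gsol_shift[OF assms(2)] e])
    then show ?thesis ..
  next
    assume e: "\<forall>\<^sub>F t in nhds 0. F (a + t) = G (b - t)"
    have "\<forall>t. F (a + t) = G (b - t)"
      by (intro allI gsol_eqI[OF gsol_shift[OF assms(1)] gsol_reflect[OF assms(2)] e])
    then show ?thesis ..
  qed
qed

lemma gsol_unique_branch:
  assumes "gsol f F" "gsol f G" "F a = G b" "F a \<in> branch f"
  shows "F (a + t) = G (b + t)" "F (a + t) = G (b - t)"
proof -
  have "\<forall>\<^sub>F t in nhds 0. F (a + t) = G (b + t)"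
    by (rule sol_unique_branch[OF gsolD(2)[OF assms(1)] gsolD(3)[OF gsol_shift[OF assms(1)]]
          gsolD(3)[OF gsol_shift[OF assms(2)]]]) (use assms(3,4) in auto)
  then show "F (a + t) = G (b + t)"
    by (rule gsol_eqI[OF gsol_shift[OF assms(1)] gsol_shift[OF assms(2)]])
  have "\<forall>\<^sub>F t in nhds 0. F (a + t) = G (b - t)"
    by (rule sol_unique_branch[OF gsolD(2)[OF assms(1)] gsolD(3)[OF gsol_shift[OF assms(1)]]
          gsolD(3)[OF gsol_reflect[OF assms(2)]]]) (use assms(3,4) in auto)
  then show "F (a + t) = G (b - t)"
    by (rule gsol_eqI[OF gsol_shift[OF assms(1)] gsol_reflect[OF assms(2)]])
qed

lemma gsol_even:
  assumes "gsol f F" "F 0 = Infty"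
  shows "F (- t) = F t"
  using gsol_unique_branch(2)[OF assms(1,1), of 0 0 t] assms(2) by simp

lemma gsol_period:
  assumes "gsol f F" "F 0 = Infty" "F w = Infty"
  shows "F (t + w) = F t"
  using gsol_unique_branch(1)[OF assms(1,1), of w 0 t] assms by (simp add: add.commute)

text \<open>At a branch value the solution is symmetric about u, so F(2u) = F(0). Conversely, a pole
  2u is a period, which together with evenness makes \<open>F\<close> symmetric about u; the local
  coordinate is then even, its derivative vanishes, and the local equation has a root at 0.\<close>

lemma gsol_branch_iff:
  assumes "gsol f F" "F 0 = Infty"
  shows "F u \<in> branch f \<longleftrightarrow> F (2 * u) = Infty"
proof
  assume "F u \<in> branch f"
  from gsol_unique_branch(2)[OF assms(1,1) refl this, of u] show "F (2 * u) = Infty"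
    using assms(2) unfolding mult_2 by simp
next
  assume w: "F (2 * u) = Infty"
  have refl_sym: "F (u + t) = F (u - t)" for t
  proof -
    have "F (- (u + t) + 2 * u) = F (- (u + t))" by (rule gsol_period[OF assms w])
    also have "\<dots> = F (u + t)" by (rule gsol_even[OF assms])
    also have "- (u + t) + 2 * u = u - t" by simp
    finally show ?thesis by (rule sym)
  qed
  show "F u \<in> branch f"
  proof (rule ccontr)
    assume nb: "F u \<notin> branch f"
    define G where "G = (\<lambda>t. F (u + t))"
    have G: "gsol f G" unfolding G_def by (rule gsol_shift[OF assms(1)])
    obtain h where h: "h analytic_on {0}" "h 0 = 0" "\<forall>\<^sub>F t in nhds 0. G t = local_param (G 0) (h t)"
      "\<forall>\<^sub>F t in nhds 0. (deriv h t) ^ 2 = poly (loc f (G 0)) (h t)" "\<forall>\<^sub>F t in at 0. deriv h t \<noteq> 0"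
      using sol_germ[OF gsolD(2,3)[OF G]] .
    have lim: "filterlim uminus (nhds 0) (nhds (0 :: complex))"
      using analytic_tendsto[OF analytic_affine[of "-1" 0 "{0}"]] by simp
    have "\<forall>\<^sub>F t in nhds 0. G (- t) = local_param (G 0) (h (- t))"
      using filterlim_iff[THEN iffD1, OF lim, rule_format, OF h(3)] by simp
    then have "\<forall>\<^sub>F t in nhds 0. h t = h (- t)"
      using h(3)
    proof eventually_elim
      case (elim t)
      then have "local_param (G 0) (h t) = local_param (G 0) (h (- t))"
        using refl_sym[of t] by (simp add: G_def)
      then show ?case by (simp only: local_param_inj)
    qed
    then have "deriv h 0 = deriv (\<lambda>t. h (- t)) 0" by (rule deriv_cong_ev) simp
    also have "\<dots> = - deriv h 0" by (rule deriv_reflect[OF h(1)])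
    finally have "deriv h 0 = 0" by simp
    then have "poly (loc f (G 0)) 0 = 0"
      using eventually_nhds_at_point[OF h(4)] h(2) by simp
    then show False using nb by (simp add: branch_iff G_def)
  qed
qed

text \<open>Equal values at u and v mean, by \<open>gsol_unique\<close>, that \<open>F\<close>
  agrees with itself after the translation by u - v or the reflection t -> u + v - t. Evaluation at
  0 turns this into a pole at u - v or u + v.\<close>

lemma gsol_eq_iff:
  assumes "gsol f F" "F 0 = Infty"
  shows "F u = F v \<longleftrightarrow> F (u - v) = Infty \<or> F (u + v) = Infty"
proof
  assume "F u = F v"
  from gsol_unique[OF assms(1,1) this] show "F (u - v) = Infty \<or> F (u + v) = Infty"
  proof
    assume "\<forall>t. F (u + t) = F (v + t)"
    from this[rule_format, of "- v"] show ?thesis using assms(2) by simp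
  next
    assume "\<forall>t. F (u + t) = F (v - t)"
    from this[rule_format, of v] show ?thesis using assms(2) by simp
  qed
next
  assume "F (u - v) = Infty \<or> F (u + v) = Infty"
  then show "F u = F v"
  proof
    assume "F (u - v) = Infty"
    from gsol_period[OF assms this, of v] show ?thesis by simp
  next
    assume "F (u + v) = Infty"
    from gsol_period[OF assms this, of "- v"] show ?thesis using gsol_even[OF assms] by simp
  qed
qed

lemma gsol_poles_group:
  assumes "gsol f F" "F 0 = Infty"
  shows "F a = Infty \<Longrightarrow> F b = Infty \<Longrightarrow> F (a - b) = Infty"
  using gsol_eq_iff[OF assms, of a b] gsol_period[OF assms, of b "a - b"] by simp

section \<open>Lattices\<close>

definition lat :: "complex \<Rightarrow> complex \<Rightarrow> complex set" where
  "lat w1 w2 = {of_int m * w1 + of_int n * w2 | m n. True}"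

lemma real_multiple_of_Im_eq_0:
  assumes "Im (cnj w1 * w2) = 0" "w1 \<noteq> 0"
  shows "w2 = of_real (Re (cnj w1 * w2) / (cmod w1)\<^sup>2) * w1"
proof -
  have "cnj w1 * w2 = of_real (Re (cnj w1 * w2))"
    using assms(1) by (simp add: complex_eq_iff)
  then have "w1 * cnj w1 * w2 = w1 * of_real (Re (cnj w1 * w2))" by (metis mult.assoc)
  then have "of_real ((cmod w1)\<^sup>2) * w2 = w1 * of_real (Re (cnj w1 * w2))"
    by (simp only: complex_norm_square)
  then show ?thesis using assms(2) by (simp add: field_simps)
qed

text \<open>\<open>Im (cnj w1 * w2)\<close> is the real determinant of the pair, the oriented area
  of the period parallelogram. From here on it stands for linear independence.\<close>

lemma independent_pair_iff:
  fixes w1 w2 :: complex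
  shows "w1 \<noteq> w2 \<and> independent {w1, w2} \<longleftrightarrow> Im (cnj w1 * w2) \<noteq> 0"
proof
  assume ind: "w1 \<noteq> w2 \<and> independent {w1, w2}"
  show "Im (cnj w1 * w2) \<noteq> 0"
  proof
    assume D: "Im (cnj w1 * w2) = 0"
    have nz: "w1 \<noteq> 0" using ind dependent_zero by blast
    have "w2 = (Re (cnj w1 * w2) / (cmod w1)\<^sup>2) *\<^sub>R w1"
      unfolding scaleR_conv_of_real by (rule real_multiple_of_Im_eq_0[OF D nz])
    then have "w2 \<in> span {w1}" unfolding span_singleton by blast
    moreover have "{w1, w2} - {w2} = {w1}" using ind by auto
    ultimately have "dependent {w1, w2}" unfolding dependent_def by auto
    then show False using ind by blast
  qed
next
  assume D: "Im (cnj w1 * w2) \<noteq> 0"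
  then have "w1 \<noteq> 0" "w2 \<noteq> 0" by auto
  have "w1 \<noteq> k *\<^sub>R w2" for k using D by auto
  then have s: "w1 \<notin> span {w2}" unfolding span_singleton by auto
  have "independent {w2}" using \<open>w2 \<noteq> 0\<close> by (simp add: dependent_single)
  with s have "independent {w1, w2}" by (rule independent_insertI)
  moreover have "w1 \<noteq> w2" using s span_superset by blast
  ultimately show "w1 \<noteq> w2 \<and> independent {w1, w2}" by simp
qed

lemma rank_two_lattice_iff:
  "rank_two_lattice L \<longleftrightarrow> (\<exists>w1 w2. Im (cnj w1 * w2) \<noteq> 0 \<and> L = lat w1 w2)"
  unfolding rank_two_lattice_def lat_def independent_pair_iff[symmetric] by blast

lemma lat_group:
  "0 \<in> lat w1 w2" "w1 \<in> lat w1 w2" "w2 \<in> lat w1 w2"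
  "a \<in> lat w1 w2 \<Longrightarrow> b \<in> lat w1 w2 \<Longrightarrow> a + b \<in> lat w1 w2"
  "a \<in> lat w1 w2 \<Longrightarrow> b \<in> lat w1 w2 \<Longrightarrow> a - b \<in> lat w1 w2"
proof -
  show "0 \<in> lat w1 w2" unfolding lat_def by (auto intro!: exI[of _ 0])
  show "w1 \<in> lat w1 w2" unfolding lat_def by (intro CollectI exI[of _ 1] exI[of _ 0]) auto
  show "w2 \<in> lat w1 w2" unfolding lat_def by (intro CollectI exI[of _ 0] exI[of _ 1]) auto
  assume "a \<in> lat w1 w2" "b \<in> lat w1 w2"
  then obtain m n m' n' where ab: "a = of_int m * w1 + of_int n * w2" "b = of_int m' * w1 + of_int n' * w2"
    unfolding lat_def by blast
  show "a + b \<in> lat w1 w2" unfolding lat_def ab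
    by (intro CollectI exI[of _ "m + m'"] exI[of _ "n + n'"]) (simp add: algebra_simps)
  show "a - b \<in> lat w1 w2" unfolding lat_def ab
    by (intro CollectI exI[of _ "m - m'"] exI[of _ "n - n'"]) (simp add: algebra_simps)
qed

lemma lattice_group:
  assumes "rank_two_lattice L"
  shows "0 \<in> L" "a \<in> L \<Longrightarrow> b \<in> L \<Longrightarrow> a + b \<in> L" "a \<in> L \<Longrightarrow> b \<in> L \<Longrightarrow> a - b \<in> L"
    "a \<in> L \<Longrightarrow> - a \<in> L" "b \<in> L \<Longrightarrow> a + b \<in> L \<longleftrightarrow> a \<in> L" "b \<in> L \<Longrightarrow> a - b \<in> L \<longleftrightarrow> a \<in> L"
    "- a \<in> L \<longleftrightarrow> a \<in> L"
proof -
  obtain w1 w2 where L: "L = lat w1 w2" using assms rank_two_lattice_iff by blast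
  note G = lat_group[where ?w1.0 = w1 and ?w2.0 = w2, folded L]
  show z: "0 \<in> L" by (rule G)
  show ad: "a \<in> L \<Longrightarrow> b \<in> L \<Longrightarrow> a + b \<in> L" for a b by (rule G)
  show di: "a \<in> L \<Longrightarrow> b \<in> L \<Longrightarrow> a - b \<in> L" for a b by (rule G)
  show ne: "a \<in> L \<Longrightarrow> - a \<in> L" for a using di[OF z, of a] by simp
  show "b \<in> L \<Longrightarrow> a + b \<in> L \<longleftrightarrow> a \<in> L" using ad[of a b] di[of "a + b" b] by auto
  show "b \<in> L \<Longrightarrow> a - b \<in> L \<longleftrightarrow> a \<in> L" using di[of a b] ad[of "a - b" b] by auto
  show "- a \<in> L \<longleftrightarrow> a \<in> L" using ne[of a] ne[of "- a"] by auto
qed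

lemma lat_coords:
  assumes "Im (cnj w1 * w2) \<noteq> 0"
  obtains a b where "z = of_real a * w1 + of_real b * w2"
proof -
  define D where "D = Im (cnj w1 * w2)"
  have D: "D \<noteq> 0" "Re w1 * Im w2 - Im w1 * Re w2 = D" using assms by (auto simp: D_def)
  have "z = of_real (Im (cnj z * w2) / D) * w1 + of_real (Im (cnj w1 * z) / D) * w2"
  proof (rule complex_eqI)
    have "Re z * D = Im (cnj z * w2) * Re w1 + Im (cnj w1 * z) * Re w2"
      unfolding D(2)[symmetric] by (simp add: algebra_simps)
    then have "Re z = (Im (cnj z * w2) * Re w1 + Im (cnj w1 * z) * Re w2) / D"
      using D(1) by (metis nonzero_mult_div_cancel_right)
    then show "Re z = Re (of_real (Im (cnj z * w2) / D) * w1 + of_real (Im (cnj w1 * z) / D) * w2)"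
      by (simp add: add_divide_distrib)
    have "Im z * D = Im (cnj z * w2) * Im w1 + Im (cnj w1 * z) * Im w2"
      unfolding D(2)[symmetric] by (simp add: algebra_simps)
    then have "Im z = (Im (cnj z * w2) * Im w1 + Im (cnj w1 * z) * Im w2) / D"
      using D(1) by (metis nonzero_mult_div_cancel_right)
    then show "Im z = Im (of_real (Im (cnj z * w2) / D) * w1 + of_real (Im (cnj w1 * z) / D) * w2)"
      by (simp add: add_divide_distrib)
  qed
  then show ?thesis by (rule that)
qed

text \<open>Cramer's rule: for v = m w1 + n w2 the numbers \<open>Im (cnj w1 * v)\<close> and
  \<open>Im (cnj w2 * v)\<close> are n and -m times the determinant, and their size is at most |v|
  times the length of a generator. The case v = 0 contains the uniqueness of coordinates.\<close>

lemma lat_bound: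
  fixes m n :: int
  assumes "Im (cnj w1 * w2) \<noteq> 0"
  shows "\<exists>C>0. \<forall>m n :: int. \<bar>real_of_int m\<bar> \<le> C * cmod (of_int m * w1 + of_int n * w2) \<and>
      \<bar>real_of_int n\<bar> \<le> C * cmod (of_int m * w1 + of_int n * w2)"
proof -
  define D where "D = \<bar>Im (cnj w1 * w2)\<bar>"
  have D: "D > 0" using assms by (simp add: D_def)
  define C where "C = (cmod w1 + cmod w2 + 1) / D"
  have C: "C > 0" unfolding C_def using D by (intro divide_pos_pos add_nonneg_pos) auto
  have "\<bar>real_of_int m\<bar> \<le> C * cmod v \<and> \<bar>real_of_int n\<bar> \<le> C * cmod v"
    if v: "v = of_int m * w1 + of_int n * w2" for m n v
  proof -
    have le: "\<bar>x\<bar> \<le> C * cmod v" if "\<bar>x\<bar> * D \<le> cmod w * cmod v" "w = w1 \<or> w = w2" for x w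
    proof -
      have "\<bar>x\<bar> * D \<le> (cmod w1 + cmod w2 + 1) * cmod v"
        using that(1) by (rule order_trans) (use that(2) in \<open>auto intro!: mult_right_mono\<close>)
      then show ?thesis unfolding C_def using D by (simp add: field_simps)
    qed
    have "Im (cnj w1 * v) = n * Im (cnj w1 * w2)" "Im (cnj w2 * v) = - (m * Im (cnj w1 * w2))"
      unfolding v by (simp_all add: algebra_simps)
    then have "\<bar>real_of_int n\<bar> * D = \<bar>Im (cnj w1 * v)\<bar>" "\<bar>real_of_int m\<bar> * D = \<bar>Im (cnj w2 * v)\<bar>"
      by (simp_all add: D_def abs_mult)
    moreover have "\<bar>Im (cnj w * v)\<bar> \<le> cmod w * cmod v" for w
      using abs_Im_le_cmod[of "cnj w * v"] by (simp add: norm_mult)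
    ultimately show ?thesis using le[of m w2] le[of n w1] by simp
  qed
  with C show ?thesis by blast
qed

lemma lattice_finite_ball:
  assumes "rank_two_lattice L"
  shows "finite (L \<inter> cball 0 r)"
proof -
  obtain w1 w2 where w: "Im (cnj w1 * w2) \<noteq> 0" "L = lat w1 w2"
    using assms rank_two_lattice_iff by blast
  obtain C where C: "C > 0" "\<And>m n :: int. \<bar>real_of_int m\<bar> \<le> C * cmod (of_int m * w1 + of_int n * w2) \<and>
      \<bar>real_of_int n\<bar> \<le> C * cmod (of_int m * w1 + of_int n * w2)"
    using lat_bound[OF w(1)] by blast
  define N where "N = \<lceil>C * r\<rceil>"
  have "L \<inter> cball 0 r \<subseteq> (\<lambda>(m, n). of_int m * w1 + of_int n * w2) ` ({-N..N} \<times> {-N..N})"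
  proof
    fix v assume v: "v \<in> L \<inter> cball 0 r"
    then obtain m n where mn: "v = of_int m * w1 + of_int n * w2" unfolding w(2) lat_def by blast
    have "C * cmod v \<le> C * r" using v C(1) by (intro mult_left_mono) auto
    then have "\<bar>real_of_int m\<bar> \<le> of_int N" "\<bar>real_of_int n\<bar> \<le> of_int N"
      using C(2)[of m n] unfolding mn[symmetric] N_def by linarith+
    then have "\<bar>m\<bar> \<le> N" "\<bar>n\<bar> \<le> N" by linarith+
    then show "v \<in> (\<lambda>(m, n). of_int m * w1 + of_int n * w2) ` ({-N..N} \<times> {-N..N})"
      unfolding mn by (intro image_eqI[of _ _ "(m, n)"]) auto
  qed
  then show ?thesis by (rule finite_subset) auto
qed

text \<open>Subtracting the integer parts of the coordinates moves \<open>z\<close> into the period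
  parallelogram.\<close>

lemma lattice_reduce:
  assumes "rank_two_lattice L"
  shows "\<exists>r. \<forall>z. \<exists>v\<in>L. z - v \<in> cball 0 r"
proof -
  obtain w1 w2 where w: "Im (cnj w1 * w2) \<noteq> 0" "L = lat w1 w2"
    using assms rank_two_lattice_iff by blast
  have "\<exists>v\<in>L. z - v \<in> cball 0 (cmod w1 + cmod w2)" for z
  proof -
    obtain a b where z: "z = of_real a * w1 + of_real b * w2" using lat_coords[OF w(1)] .
    define v where "v = of_int \<lfloor>a\<rfloor> * w1 + of_int \<lfloor>b\<rfloor> * w2"
    have "v \<in> L" unfolding v_def w(2) lat_def by blast
    have "z - v = of_real (a - of_int \<lfloor>a\<rfloor>) * w1 + of_real (b - of_int \<lfloor>b\<rfloor>) * w2"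
      unfolding z v_def by (simp add: algebra_simps)
    then have "cmod (z - v) \<le> \<bar>a - of_int \<lfloor>a\<rfloor>\<bar> * cmod w1 + \<bar>b - of_int \<lfloor>b\<rfloor>\<bar> * cmod w2"
      by (metis norm_mult norm_of_real norm_triangle_ineq)
    also have "\<dots> \<le> 1 * cmod w1 + 1 * cmod w2"
      by (intro add_mono mult_right_mono) (auto, linarith+)
    finally show ?thesis using \<open>v \<in> L\<close> by (intro bexI[of _ v]) auto
  qed
  then show ?thesis by blast
qed

lemma lattice_discrete:
  assumes "rank_two_lattice L"
  obtains d where "d > 0" "\<And>v. v \<in> L \<Longrightarrow> v \<noteq> 0 \<Longrightarrow> d \<le> cmod v"
proof -
  have fin: "finite (L \<inter> cball 0 1)" by (rule lattice_finite_ball[OF assms])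
  define d where "d = Min (insert 1 (cmod ` (L \<inter> cball 0 1 - {0})))"
  have "d > 0" unfolding d_def using fin by (subst Min_gr_iff) auto
  moreover have "d \<le> cmod v" if "v \<in> L" "v \<noteq> 0" for v
  proof (cases "cmod v \<le> 1")
    case True
    then have "cmod v \<in> insert 1 (cmod ` (L \<inter> cball 0 1 - {0}))" using that by simp
    then show ?thesis unfolding d_def using fin by (intro Min_le) simp_all
  next
    case False
    have "d \<le> 1" unfolding d_def using fin by (intro Min_le) simp_all
    with False show ?thesis by simp
  qed
  ultimately show thesis by (rule that)
qed

lemma lattice_countable:
  assumes "rank_two_lattice L"
  shows "countable L"
proof -
  obtain w1 w2 where w: "L = lat w1 w2" using assms rank_two_lattice_iff by blast
  have "L = range (\<lambda>(m, n). of_int m * w1 + of_int n * w2)" unfolding w lat_def by auto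
  then show ?thesis by simp
qed

lemma lattice_closed:
  assumes "rank_two_lattice L"
  shows "closed L"
proof -
  obtain d where d: "d > 0" "\<And>v. v \<in> L \<Longrightarrow> v \<noteq> 0 \<Longrightarrow> d \<le> cmod v"
    by (rule lattice_discrete[OF assms]) blast
  show ?thesis
  proof (rule discrete_imp_closed[OF d(1)], intro ballI impI)
    fix x y assume xy: "x \<in> L" "y \<in> L" "dist y x < d"
    show "y = x"
      using d(2)[OF lattice_group(3)[OF assms xy(2,1)]] xy(3) by (auto simp: dist_norm)
  qed
qed

lemma lattice_complement:
  assumes "rank_two_lattice L"
  shows "open (- L)" "connected (- L)"
proof -
  show "open (- L)" using lattice_closed[OF assms] by (rule open_Compl)
  show "connected (- L)"
    by (rule path_connected_imp_connected, rule path_connected_complement_countable)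
       (use lattice_countable[OF assms] in auto)
qed

section \<open>Convergence of the lattice sum\<close>

lemma int_powr_summable: "(\<lambda>m :: int. (1 + \<bar>real_of_int m\<bar>) powr (-3/2)) summable_on UNIV"
proof -
  have "summable (\<lambda>n. real n powr (-3/2))" by (simp add: summable_real_powr_iff)
  then have "summable (\<lambda>n. real (Suc n) powr (-3/2))" by (subst summable_Suc_iff)
  then have nat: "(\<lambda>n. (1 + real n) powr (-3/2)) summable_on UNIV"
    by (subst summable_on_UNIV_nonneg_real_iff) (auto simp: add.commute)
  have "(\<lambda>m :: int. (1 + \<bar>real_of_int m\<bar>) powr (-3/2)) summable_on range int"
    by (subst summable_on_reindex) (use nat in \<open>auto simp: o_def\<close>)
  moreover have "(\<lambda>m :: int. (1 + \<bar>real_of_int m\<bar>) powr (-3/2)) summable_on range (\<lambda>n. - int n)"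
    by (subst summable_on_reindex) (use nat in \<open>auto simp: o_def inj_def\<close>)
  then have "(\<lambda>m :: int. (1 + \<bar>real_of_int m\<bar>) powr (-3/2)) summable_on (range (\<lambda>n. - int n) - range int)"
    by (rule summable_on_subset) auto
  ultimately have "(\<lambda>m :: int. (1 + \<bar>real_of_int m\<bar>) powr (-3/2)) summable_on
      (range int \<union> (range (\<lambda>n. - int n) - range int))"
    by (rule summable_on_Un_disjoint) auto
  moreover have "m \<in> range int \<union> (range (\<lambda>n. - int n) - range int)" for m
    by (cases m rule: int_cases2) auto
  then have "range int \<union> (range (\<lambda>n. - int n) - range int) = UNIV" by blast
  ultimately show ?thesis by simp
qed

text \<open>The exponent 3 is split evenly: 1 + |m| and 1 + |n| are both at most a constant times
  |v|, so |v|^(-3) is bounded by a multiple of (1 + |m|)^(-3/2) (1 + |n|)^(-3/2), a product of two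
  convergent series.\<close>

lemma lattice_summable:
  assumes "rank_two_lattice L"
  shows "(\<lambda>v. 1 / cmod v ^ 3) summable_on (L - {0})"
proof -
  obtain w1 w2 where w: "Im (cnj w1 * w2) \<noteq> 0" "L = lat w1 w2"
    using assms rank_two_lattice_iff by blast
  obtain C where C: "C > 0" "\<And>m n :: int. \<bar>real_of_int m\<bar> \<le> C * cmod (of_int m * w1 + of_int n * w2) \<and>
      \<bar>real_of_int n\<bar> \<le> C * cmod (of_int m * w1 + of_int n * w2)"
    using lat_bound[OF w(1)] by blast
  define P where "P = (\<lambda>(m, n). of_int m * w1 + of_int n * w2)"
  define a where "a = (\<lambda>m :: int. (1 + \<bar>real_of_int m\<bar>) powr (-3/2))"
  have inj: "inj P"
  proof (rule injI)
    fix x y assume xy: "P x = P y"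
    obtain m n m' n' where xy': "x = (m, n)" "y = (m', n')" by (cases x; cases y)
    have "of_int (m - m') * w1 + of_int (n - n') * w2 = 0"
      using xy unfolding P_def xy' by (simp add: algebra_simps)
    then have "m - m' = 0 \<and> n - n' = 0" using C(2)[of "m - m'" "n - n'"] by simp
    then show "x = y" by (simp add: xy')
  qed
  have sum: "(\<lambda>(m, n). a m * a n) summable_on (UNIV \<times> UNIV)"
  proof (rule summable_on_SigmaI)
    show "((\<lambda>n. case (m, n) of (m, n) \<Rightarrow> a m * a n) has_sum a m * infsum a UNIV) UNIV" for m
      using int_powr_summable by (auto simp: a_def intro!: has_sum_cmult_right has_sum_infsum)
    show "(\<lambda>m. a m * infsum a UNIV) summable_on UNIV"
      using int_powr_summable unfolding a_def by (rule summable_on_cmult_left)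
  qed (auto simp: a_def)
  have "(\<lambda>x. 1 / cmod (P x) ^ 3) summable_on (UNIV - {(0, 0)})"
  proof (rule summable_on_comparison_test)
    show "(\<lambda>x. (2 * C + 1) ^ 3 * (case x of (m, n) \<Rightarrow> a m * a n)) summable_on (UNIV - {(0, 0)})"
      by (rule summable_on_cmult_right, rule summable_on_subset[OF sum]) auto
    show "1 / cmod (P x) ^ 3 \<le> (2 * C + 1) ^ 3 * (case x of (m, n) \<Rightarrow> a m * a n)"
      if x: "x \<in> UNIV - {(0, 0)}" for x
    proof -
      obtain m n where mn: "x = (m, n)" by (cases x)
      define v where "v = P x"
      have v: "v = of_int m * w1 + of_int n * w2" by (simp add: v_def P_def mn)
      have mb: "\<bar>real_of_int m\<bar> \<le> C * cmod v" "\<bar>real_of_int n\<bar> \<le> C * cmod v"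
        using C(2)[of m n] unfolding v by auto
      have "1 \<le> \<bar>real_of_int m\<bar> \<or> 1 \<le> \<bar>real_of_int n\<bar>" using x mn by auto
      then have one: "1 \<le> C * cmod v" using mb by linarith
      have vpos: "cmod v > 0"
      proof (rule ccontr)
        assume "\<not> cmod v > 0"
        then have "cmod v = 0" by simp
        with one show False by simp
      qed
      \<comment> \<open>Since C |v| is at least 1, it absorbs the summand 1 in 1 + |m| and 1 +
        |n|.\<close>
      define B where "B = (2 * C + 1) * cmod v"
      have Bpos: "B > 0" unfolding B_def using C(1) vpos by simp
      have le: "1 + \<bar>real_of_int m\<bar> \<le> B" "1 + \<bar>real_of_int n\<bar> \<le> B"
      proof -
        have "B = cmod v + 2 * (C * cmod v)" unfolding B_def by (simp add: algebra_simps)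
        then show "1 + \<bar>real_of_int m\<bar> \<le> B" "1 + \<bar>real_of_int n\<bar> \<le> B"
          using mb one vpos by linarith+
      qed
      have am: "B powr (-3/2) \<le> a m" "B powr (-3/2) \<le> a n"
        unfolding a_def by (rule powr_mono2'; use le in simp)+
      have "1 / B ^ 3 = B powr (-3/2) * B powr (-3/2)"
      proof -
        have "B powr (-3/2) * B powr (-3/2) = B powr (- 3)" by (simp flip: powr_add)
        also have "\<dots> = 1 / B ^ 3" using powr_realpow[OF Bpos, of 3] by (simp add: powr_minus_divide)
        finally show ?thesis by simp
      qed
      also have "\<dots> \<le> a m * a n" by (intro mult_mono am) (auto simp: a_def)
      finally have "1 / B ^ 3 \<le> a m * a n" .
      then have "(2 * C + 1) ^ 3 * (1 / B ^ 3) \<le> (2 * C + 1) ^ 3 * (a m * a n)"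
        using C(1) by (intro mult_left_mono) auto
      moreover have "(2 * C + 1) ^ 3 * (1 / B ^ 3) = 1 / cmod v ^ 3"
        using C(1) unfolding B_def by (simp add: power_mult_distrib)
      ultimately show ?thesis by (simp add: mn v_def)
    qed
  qed auto
  moreover have "P ` (UNIV - {(0, 0)}) = L - {0}"
  proof -
    have "P ` UNIV = L" unfolding P_def w(2) lat_def by auto
    moreover have "P (0, 0) = 0" by (simp add: P_def)
    ultimately show ?thesis using inj by (metis image_insert image_set_diff image_empty)
  qed
  moreover have "inj_on P (UNIV - {(0, 0)})" using inj inj_on_subset by blast
  ultimately show ?thesis
    using summable_on_reindex[of P "UNIV - {(0, 0)}" "\<lambda>v. 1 / cmod v ^ 3"] by (simp add: o_def)
qed

section \<open>The Weierstrass function\<close>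

definition pf :: "complex set \<Rightarrow> complex \<Rightarrow> complex" where
  "pf L u = fin (weierstrass_p L u)"

lemma weierstrass_p_pf: "weierstrass_p L u = (if u \<in> L then Infty else Pt (pf L u))"
  by (simp add: pf_def weierstrass_p_def)

lemma pf_eq: "u \<notin> L \<Longrightarrow> pf L u = 1 / u ^ 2 + (\<Sum>\<^sub>\<infinity>v\<in>L - {0}. 1 / (u - v) ^ 2 - 1 / v ^ 2)"
  by (simp add: pf_def weierstrass_p_def)

lemma weierstrass_p_Infty_iff [simp]: "weierstrass_p L u = Infty \<longleftrightarrow> u \<in> L"
  by (simp add: weierstrass_p_def)

text \<open>The difference equals u (2v - u) / (v^2 (u - v)^2): subtracting 1/v^2 gains one power of
  v. The constant 10 is the factor 5/2 from |2v - u| \<le> 5/2 |v| times the factor 4 from |u - v|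
  \<ge> |v|/2.\<close>

lemma wp_term_bound:
  fixes u v :: complex
  assumes r: "r > 0" "cmod u \<le> r" "2 * r \<le> cmod v"
  shows "cmod (1 / (u - v) ^ 2 - 1 / v ^ 2) \<le> 10 * r * (1 / cmod v ^ 3)"
proof -
  have v: "cmod v > 0" using r by linarith
  have uv: "cmod (u - v) \<ge> cmod v / 2"
    using norm_triangle_ineq2[of v u] r by (simp add: norm_minus_commute)
  then have "u - v \<noteq> 0" "v \<noteq> 0" using v by auto
  moreover have "1 / x ^ 2 - 1 / v ^ 2 = (v ^ 2 - x ^ 2) / (v ^ 2 * x ^ 2)" if "x \<noteq> 0" "v \<noteq> 0" for x :: complex
    using that by (simp add: field_simps)
  moreover have "v ^ 2 - (u - v) ^ 2 = u * (2 * v - u)" by (simp add: power2_eq_square algebra_simps)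
  ultimately have "1 / (u - v) ^ 2 - 1 / v ^ 2 = u * (2 * v - u) / (v ^ 2 * (u - v) ^ 2)" by metis
  then have "cmod (1 / (u - v) ^ 2 - 1 / v ^ 2) = cmod u * cmod (2 * v - u) / (cmod v ^ 2 * cmod (u - v) ^ 2)"
    by (simp add: norm_divide norm_mult norm_power)
  also have "\<dots> \<le> r * (5 / 2 * cmod v) / (cmod v ^ 2 * (cmod v / 2) ^ 2)"
  proof (rule frac_le)
    have "cmod (2 * v - u) \<le> 2 * cmod v + cmod u"
      using norm_triangle_ineq4[of "2 * v" u] by (simp add: norm_mult)
    then show "cmod u * cmod (2 * v - u) \<le> r * (5 / 2 * cmod v)"
      using r by (intro mult_mono) auto
    show "cmod v ^ 2 * (cmod v / 2) ^ 2 \<le> cmod v ^ 2 * cmod (u - v) ^ 2"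
      using uv by (intro mult_left_mono power_mono) auto
  qed (use r v in auto)
  also have "\<dots> = 10 * r * (1 / cmod v ^ 3)"
    using v by (simp add: field_simps power2_eq_square power3_eq_cube)
  finally show ?thesis .
qed

text \<open>On the disc of radius \<open>r\<close> the terms with |v| \<ge> 2r have a common
  summable majorant and no poles; the remaining ones, collected in \<open>near\<close>, are finitely
  many.\<close>

definition far :: "complex set \<Rightarrow> real \<Rightarrow> complex set" where
  "far L r = {v \<in> L. 2 * r \<le> cmod v}"

definition near :: "complex set \<Rightarrow> real \<Rightarrow> complex set" where
  "near L r = {v \<in> L - {0}. cmod v < 2 * r}"

definition far_sum :: "complex set \<Rightarrow> real \<Rightarrow> complex \<Rightarrow> complex" where
  "far_sum L r u = (\<Sum>\<^sub>\<infinity>v\<in>far L r. 1 / (u - v) ^ 2 - 1 / v ^ 2)"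

lemma far_bound_summable:
  assumes "rank_two_lattice L" "r > 0"
  shows "(\<lambda>v. 10 * r * (1 / cmod v ^ 3)) summable_on far L r"
  by (rule summable_on_cmult_right, rule summable_on_subset[OF lattice_summable[OF assms(1)]])
     (use assms(2) in \<open>auto simp: far_def\<close>)

lemma far_summable:
  assumes "rank_two_lattice L" "r > 0" "cmod u \<le> r"
  shows "(\<lambda>v. 1 / (u - v) ^ 2 - 1 / v ^ 2) summable_on far L r"
  by (rule abs_summable_summable, rule Infinite_Sum.abs_summable_on_comparison_test'[OF far_bound_summable[OF assms(1,2)]],
      rule wp_term_bound) (use assms in \<open>auto simp: far_def\<close>)

lemma wp_term_deriv:
  fixes w v :: complex
  assumes "w \<noteq> v"
  shows "((\<lambda>u. 1 / (u - v) ^ 2 - 1 / v ^ 2) has_field_derivative - 2 / (w - v) ^ 3) (at w)"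
proof -
  have "((\<lambda>u. 1 / (u - v) ^ 2 - 1 / v ^ 2) has_field_derivative
      (0 * (w - v) ^ 2 - 1 * (2 * (w - v))) / ((w - v) ^ 2 * (w - v) ^ 2) - 0) (at w)"
    using assms by (intro derivative_intros DERIV_divide) (auto intro!: derivative_eq_intros)
  moreover have "(0 * x ^ 2 - 1 * (2 * x)) / (x ^ 2 * x ^ 2) - 0 = - 2 / x ^ 3" if "x \<noteq> 0" for x :: complex
    using that by (simp add: field_simps power2_eq_square power3_eq_cube)
  from this[of "w - v"] have "(0 * (w - v) ^ 2 - 1 * (2 * (w - v))) / ((w - v) ^ 2 * (w - v) ^ 2) - 0 = - 2 / (w - v) ^ 3"
    using assms by simp
  ultimately show ?thesis by simp
qed

text \<open>Termwise differentiation of a uniform limit over finite subsets. The derivative is kept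
  as an unconditional sum because the proof of periodicity reindexes it.\<close>

lemma far_sum_deriv:
  assumes L: "rank_two_lattice L" and r: "r > 0" and w: "w \<in> ball 0 r"
  shows "\<exists>d. (far_sum L r has_field_derivative d) (at w) \<and> ((\<lambda>v. - 2 / (w - v) ^ 3) has_sum d) (far L r)"
proof -
  let ?F = "finite_subsets_at_top (far L r)"
  have ne: "w' \<noteq> v" if "v \<in> far L r" "w' \<in> cball 0 r" for w' v
    using that r by (auto simp: far_def)
  obtain g' where g': "\<And>w. w \<in> ball 0 r \<Longrightarrow> (far_sum L r has_field_derivative g' w) (at w) \<and>
      ((\<lambda>X. \<Sum>v\<in>X. - 2 / (w - v) ^ 3) \<longlongrightarrow> g' w) ?F"
  proof (rule has_complex_derivative_uniform_limit[where F = ?F and z = 0 and r = r and g = "far_sum L r"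
        and f = "\<lambda>X u. \<Sum>v\<in>X. 1 / (u - v) ^ 2 - 1 / v ^ 2" and f' = "\<lambda>X w. \<Sum>v\<in>X. - 2 / (w - v) ^ 3"])
    show "\<forall>\<^sub>F X in ?F. continuous_on (cball 0 r) (\<lambda>u. \<Sum>v\<in>X. 1 / (u - v) ^ 2 - 1 / v ^ 2) \<and>
        (\<forall>w\<in>ball 0 r. ((\<lambda>u. \<Sum>v\<in>X. 1 / (u - v) ^ 2 - 1 / v ^ 2) has_field_derivative
           (\<Sum>v\<in>X. - 2 / (w - v) ^ 3)) (at w))"
    proof (rule eventually_finite_subsets_at_top_weakI)
      fix X assume X: "finite X" "X \<subseteq> far L r"
      have D: "((\<lambda>u. \<Sum>v\<in>X. 1 / (u - v) ^ 2 - 1 / v ^ 2) has_field_derivative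
           (\<Sum>v\<in>X. - 2 / (w - v) ^ 3)) (at w)" if "w \<in> cball 0 r" for w
        by (rule DERIV_sum, rule wp_term_deriv) (use ne[OF _ that] X in blast)
      have "continuous_on (cball 0 r) (\<lambda>u. \<Sum>v\<in>X. 1 / (u - v) ^ 2 - 1 / v ^ 2)"
        by (rule DERIV_continuous_on) (rule has_field_derivative_at_within[OF D])
      with D show "continuous_on (cball 0 r) (\<lambda>u. \<Sum>v\<in>X. 1 / (u - v) ^ 2 - 1 / v ^ 2) \<and>
        (\<forall>w\<in>ball 0 r. ((\<lambda>u. \<Sum>v\<in>X. 1 / (u - v) ^ 2 - 1 / v ^ 2) has_field_derivative
           (\<Sum>v\<in>X. - 2 / (w - v) ^ 3)) (at w))"
        by auto
    qed
    show "uniform_limit (cball 0 r) (\<lambda>X u. \<Sum>v\<in>X. 1 / (u - v) ^ 2 - 1 / v ^ 2) (far_sum L r) ?F"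
      unfolding far_sum_def
      by (rule Weierstrass_m_test_general[OF _ far_bound_summable[OF L r]], rule wp_term_bound)
         (use r in \<open>auto simp: far_def\<close>)
  qed (use r in auto)
  show ?thesis
    by (rule exI[of _ "g' w"]) (use g'[OF w] in \<open>auto simp: has_sum_def\<close>)
qed

lemma near_finite: "rank_two_lattice L \<Longrightarrow> finite (near L r)"
  by (rule finite_subset[OF _ lattice_finite_ball[of L "2 * r"]]) (auto simp: near_def)

lemma near_far:
  assumes "r > 0"
  shows "L - {0} = near L r \<union> far L r" "near L r \<inter> far L r = {}"
  using assms by (auto simp: near_def far_def)

lemma pf_split:
  assumes L: "rank_two_lattice L" and r: "cmod u < r" and u: "u \<notin> L"
  shows "pf L u = 1 / u ^ 2 + (\<Sum>v\<in>near L r. 1 / (u - v) ^ 2 - 1 / v ^ 2) + far_sum L r u"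
proof -
  have r0: "r > 0" using r norm_ge_zero[of u] by linarith
  show ?thesis
    unfolding pf_eq[OF u] near_far(1)[OF r0] far_sum_def
    by (subst infsum_Un_disjoint)
       (use near_finite[OF L] far_summable[OF L r0] r near_far(2)[OF r0] in \<open>auto\<close>)
qed

lemma pf_deriv:
  assumes L: "rank_two_lattice L" and u: "u \<notin> L"
  shows "\<exists>d. (pf L has_field_derivative d) (at u) \<and> ((\<lambda>v. - 2 / (u - v) ^ 3) has_sum d) L"
proof -
  define r where "r = cmod u + 1"
  have r0: "r > 0" "u \<in> ball 0 r" unfolding r_def by (auto simp: add_nonneg_pos)
  obtain d where d: "(far_sum L r has_field_derivative d) (at u)"
      "((\<lambda>v. - 2 / (u - v) ^ 3) has_sum d) (far L r)"
    using far_sum_deriv[OF L r0] by blast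
  define N where "N = insert 0 (near L r)"
  have N: "finite N" "0 \<notin> near L r" unfolding N_def using near_finite[OF L] by (auto simp: near_def)
  define e where "e = (\<Sum>v\<in>N. - 2 / (u - v) ^ 3) + d"
  have LN: "L = N \<union> far L r" "N \<inter> far L r = {}"
    using near_far[OF r0(1), of L] lattice_group(1)[OF L] r0(1) unfolding N_def by (auto simp: far_def)
  have une: "u \<noteq> v" if "v \<in> N" for v using u LN that by auto
  have "((\<lambda>v. - 2 / (u - v) ^ 3) has_sum e) L"
    unfolding e_def by (subst LN(1), rule has_sum_Un_disjoint[OF has_sum_finite[OF N(1)] d(2) LN(2)])
  moreover have "(pf L has_field_derivative e) (at u)"
  proof (rule has_field_derivative_transform_within_open)
    show "((\<lambda>u. (\<Sum>v\<in>N. 1 / (u - v) ^ 2 - 1 / v ^ 2) + far_sum L r u) has_field_derivative e) (at u)"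
      unfolding e_def by (intro DERIV_add DERIV_sum wp_term_deriv d(1) une)
    show "open (ball 0 r - L)" using lattice_closed[OF L] by (intro open_Diff) auto
    show "u \<in> ball 0 r - L" using r0 u by simp
    show "(\<Sum>v\<in>N. 1 / (w - v) ^ 2 - 1 / v ^ 2) + far_sum L r w = pf L w" if "w \<in> ball 0 r - L" for w
      using pf_split[OF L, of w r] that near_finite[OF L, of r] N(2) by (simp add: N_def)
  qed
  ultimately show ?thesis by blast
qed

section \<open>Evenness and periodicity\<close>

lemma pf_even:
  assumes L: "rank_two_lattice L"
  shows "pf L (- u) = pf L u"
proof (cases "u \<in> L")
  case True
  then show ?thesis by (simp add: pf_def weierstrass_p_def lattice_group(7)[OF L])
next
  case False
  have "(\<Sum>\<^sub>\<infinity>v\<in>L - {0}. 1 / (- u - v) ^ 2 - 1 / v ^ 2) = (\<Sum>\<^sub>\<infinity>v\<in>L - {0}. 1 / (u - v) ^ 2 - 1 / v ^ 2)"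
  proof (rule infsum_reindex_bij_witness[where i = uminus and j = uminus])
    show "1 / (u - - v) ^ 2 - 1 / (- v) ^ 2 = 1 / (- u - v) ^ 2 - 1 / v ^ 2" for v
      using power2_minus[of "u + v"] by simp
  qed (use lattice_group[OF L] in auto)
  then show ?thesis using False lattice_group(7)[OF L] by (simp add: pf_eq)
qed

lemma pf_holomorphic: "rank_two_lattice L \<Longrightarrow> pf L holomorphic_on - L"
  using pf_deriv lattice_complement(1) by (subst holomorphic_on_open) blast+

text \<open>The derivative is the sum of -2/(u - v)^3 over the whole lattice, which the translation
  by \<open>w\<close> merely reindexes. As the complement of \<open>L\<close> is connected, the
  difference is a single constant.\<close>

lemma pf_shift_const:
  assumes L: "rank_two_lattice L" and w: "w \<in> L"
  shows "\<exists>c. \<forall>u. u \<notin> L \<longrightarrow> pf L (u + w) = pf L u + c"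
proof -
  have D: "((\<lambda>u. pf L (u + w) - pf L u) has_field_derivative 0) (at u)" if u: "u \<in> - L" for u
  proof -
    have uw: "u + w \<notin> L" using u lattice_group(5)[OF L w] by simp
    obtain d where d: "(pf L has_field_derivative d) (at u)" "((\<lambda>v. - 2 / (u - v) ^ 3) has_sum d) L"
      using pf_deriv[OF L, of u] u by auto
    obtain e where e: "(pf L has_field_derivative e) (at (u + w))" "((\<lambda>v. - 2 / (u + w - v) ^ 3) has_sum e) L"
      using pf_deriv[OF L uw] by blast
    have "((\<lambda>v. - 2 / (u - v) ^ 3) has_sum e) L"
      by (subst has_sum_reindex_bij_witness[where i = "\<lambda>v. v - w" and j = "\<lambda>v. v + w" and T = L
              and h = "\<lambda>v. - 2 / (u + w - v) ^ 3" and s' = e])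
         (use e(2) lattice_group[OF L] w in auto)
    then have "d = e" using d(2) has_sum_unique by blast
    moreover have "((\<lambda>u. pf L (u + w)) has_field_derivative e) (at u)"
      using e(1) by (simp add: DERIV_shift)
    ultimately show ?thesis using DERIV_diff[OF _ d(1)] by fastforce
  qed
  have "\<exists>c. \<forall>u\<in>- L. pf L (u + w) - pf L u = c"
    using has_field_derivative_0_imp_constant_on[OF _ lattice_complement(2)[OF L] lattice_complement(1)[OF L]] D
    unfolding constant_on_def by blast
  then obtain c where "\<forall>u\<in>- L. pf L (u + w) - pf L u = c" by blast
  then show ?thesis by (intro exI[of _ c]) (auto simp: algebra_simps)
qed

text \<open>Evaluation at u = -w/2 together with evenness makes the constant vanish. The point w/2
  must not be a pole, which holds for generators but not for every period.\<close>

lemma pf_shift_generator: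
  assumes L: "rank_two_lattice L" and w: "w \<in> L" "w / 2 \<notin> L" and u: "u \<notin> L"
  shows "pf L (u + w) = pf L u"
proof -
  obtain c where c: "\<And>u. u \<notin> L \<Longrightarrow> pf L (u + w) = pf L u + c" using pf_shift_const[OF L w(1)] by blast
  have "- (w / 2) \<notin> L" using w(2) lattice_group(7)[OF L] by simp
  from c[OF this] have "pf L (w / 2) = pf L (- (w / 2)) + c" by simp
  then have "c = 0" using pf_even[OF L, of "w / 2"] by simp
  then show ?thesis using c[OF u] by simp
qed

lemma pf_periodic:
  assumes L: "rank_two_lattice L" and w: "w \<in> L"
  shows "pf L (u + w) = pf L u"
proof -
  obtain w1 w2 where W: "Im (cnj w1 * w2) \<noteq> 0" "L = lat w1 w2"
    using L rank_two_lattice_iff by blast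
  have wL: "w1 \<in> L" "w2 \<in> L" unfolding W(2) by (rule lat_group)+
  obtain C where C: "C > 0" "\<And>m n :: int. \<bar>real_of_int m\<bar> \<le> C * cmod (of_int m * w1 + of_int n * w2) \<and>
      \<bar>real_of_int n\<bar> \<le> C * cmod (of_int m * w1 + of_int n * w2)"
    using lat_bound[OF W(1)] by blast
  have half: "w1 / 2 \<notin> L" "w2 / 2 \<notin> L"
  proof -
    show "w1 / 2 \<notin> L"
    proof
      assume "w1 / 2 \<in> L"
      then obtain m n where "w1 / 2 = of_int m * w1 + of_int n * w2" unfolding W(2) lat_def by blast
      then have "of_int (2 * m - 1) * w1 + of_int (2 * n) * w2 = 0" by (simp add: algebra_simps)
      then have "2 * m - 1 = 0" using C(2)[of "2 * m - 1" "2 * n"] by simp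
      then show False by presburger
    qed
    show "w2 / 2 \<notin> L"
    proof
      assume "w2 / 2 \<in> L"
      then obtain m n where "w2 / 2 = of_int m * w1 + of_int n * w2" unfolding W(2) lat_def by blast
      then have "of_int (2 * m) * w1 + of_int (2 * n - 1) * w2 = 0" by (simp add: algebra_simps)
      then have "2 * n - 1 = 0" using C(2)[of "2 * m" "2 * n - 1"] by simp
      then show False by presburger
    qed
  qed
  have shift: "pf L (u + w') = pf L u" if "w' \<in> L" "w' / 2 \<notin> L" for u w'
  proof (cases "u \<in> L")
    case True
    then show ?thesis using lattice_group(2)[OF L True that(1)] by (simp add: pf_def weierstrass_p_def)
  qed (rule pf_shift_generator[OF L that])
  have int_shift: "pf L (u + of_int m * w') = pf L u" if "w' \<in> L" "w' / 2 \<notin> L" for u m w'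
  proof (induction m arbitrary: u rule: int_induct[of _ 0])
    case (step1 i)
    then show ?case using shift[OF that, of "u + of_int i * w'"] by (simp add: algebra_simps)
  next
    case (step2 i)
    then show ?case using shift[OF that, of "u + of_int (i - 1) * w'"] by (simp add: algebra_simps)
  qed simp
  obtain m n where mn: "w = of_int m * w1 + of_int n * w2" using w unfolding W(2) lat_def by blast
  have "pf L (u + w) = pf L ((u + of_int m * w1) + of_int n * w2)" by (simp add: mn add.assoc)
  then show ?thesis using int_shift[OF wL(2) half(2)] int_shift[OF wL(1) half(1)] by simp
qed

lemma weierstrass_p_periodic:
  assumes L: "rank_two_lattice L" and w: "w \<in> L"
  shows "weierstrass_p L (u + w) = weierstrass_p L u"
  using pf_periodic[OF assms] lattice_group(5)[OF L w] by (simp add: weierstrass_p_pf)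

section \<open>Behaviour at the lattice points\<close>

lemma pf_at_0:
  assumes L: "rank_two_lattice L"
  obtains S where "S analytic_on {0}" "S 0 = 0" "\<forall>\<^sub>F u in at 0. pf L u = 1 / u ^ 2 + S u"
proof -
  obtain d where d: "d > 0" "\<And>v. v \<in> L \<Longrightarrow> v \<noteq> 0 \<Longrightarrow> d \<le> cmod v"
    by (rule lattice_discrete[OF L]) blast
  \<comment> \<open>With half the minimal length no nonzero lattice point is near, so the whole sum
    is analytic on the disc.\<close>
  define r where "r = d / 2"
  have r: "r > 0" using d by (simp add: r_def)
  have near: "near L r = {}" unfolding near_def r_def using d(2) by force
  have "far_sum L r holomorphic_on ball 0 r"
    using far_sum_deriv[OF L r] by (subst holomorphic_on_open) blast+
  then have "far_sum L r analytic_on {0}" using r by (meson analytic_at centre_in_ball open_ball)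
  moreover have "far_sum L r 0 = 0" by (simp add: far_sum_def)
  moreover have "pf L u = 1 / u ^ 2 + far_sum L r u" if "u \<in> ball 0 r - {0}" for u
  proof -
    have "u \<notin> L" using that d(2)[of u] d(1) by (auto simp: r_def)
    then show ?thesis using pf_split[OF L, of u r] that near by simp
  qed
  then have "\<forall>\<^sub>F u in at 0. pf L u = 1 / u ^ 2 + far_sum L r u"
    unfolding eventually_at using r by (intro exI[of _ r]) auto
  ultimately show thesis by (rule that)
qed

lemma lattice_not_in_near_0:
  assumes "rank_two_lattice L"
  shows "\<forall>\<^sub>F u in at 0. u \<notin> L"
proof -
  obtain d where d: "d > 0" "\<And>v. v \<in> L \<Longrightarrow> v \<noteq> 0 \<Longrightarrow> d \<le> cmod v"
    by (rule lattice_discrete[OF assms]) blast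
  show ?thesis
    unfolding eventually_at using d by (intro exI[of _ d]) force
qed

lemma weierstrass_p_hol:
  assumes L: "rank_two_lattice L"
  shows "hol_at (weierstrass_p L) a"
proof (cases "a \<in> L")
  case False
  have "pf L analytic_on {a}"
    using pf_holomorphic[OF L] lattice_complement(1)[OF L] False
    by (meson ComplI analytic_at)
  moreover have "\<forall>\<^sub>F t in nhds a. t \<in> - L"
    using lattice_complement(1)[OF L] False by (intro eventually_nhds_in_open) auto
  then have "\<forall>\<^sub>F t in nhds a. weierstrass_p L t = Pt (pf L t)"
    by eventually_elim (simp add: weierstrass_p_pf)
  ultimately show ?thesis by (rule hol_at_Pt)
next
  case True
  obtain S where S: "S analytic_on {0}" "S 0 = 0" "\<forall>\<^sub>F u in at 0. pf L u = 1 / u ^ 2 + S u"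
    using pf_at_0[OF L] .
  \<comment> \<open>Cleared of its pole, 1/u^2 + S is \<open>[1 + u^2 S : u^2]\<close>; other
    lattice points follow by periodicity.\<close>
  have "hol_at (weierstrass_p L) 0"
  proof (rule hol_atI[of "\<lambda>u. 1 + u ^ 2 * S u" _ "\<lambda>u. u ^ 2"])
    show "(\<lambda>u. 1 + u ^ 2 * S u) analytic_on {0}"
      by (intro analytic_on_add analytic_on_mult analytic_on_power analytic_on_ident analytic_on_const S(1))
    show "(\<lambda>u :: complex. u ^ 2) analytic_on {0}" by (intro analytic_on_power analytic_on_ident)
    have "\<forall>\<^sub>F t in at 0. t \<noteq> (0 :: complex)" by (simp add: eventually_at_filter)
    with S(3) lattice_not_in_near_0[OF L]
    have "\<forall>\<^sub>F t in at 0. weierstrass_p L t = mk (1 + t ^ 2 * S t) (t ^ 2)"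
      by eventually_elim (auto simp: weierstrass_p_pf mk_def field_simps)
    then show "\<forall>\<^sub>F t in nhds 0. weierstrass_p L t = mk (1 + t ^ 2 * S t) (t ^ 2)"
      using lattice_group(1)[OF L] by (simp add: eventually_nhds_conv_at mk_def weierstrass_p_pf)
  qed auto
  then have "hol_at (\<lambda>t. weierstrass_p L (1 * t + (- a))) a"
    by (intro hol_at_affine) simp
  moreover have "weierstrass_p L (1 * t + (- a)) = weierstrass_p L t" for t
    using weierstrass_p_periodic[OF L lattice_group(4)[OF L True]] by simp
  ultimately show ?thesis by simp
qed

section \<open>Elliptic functions\<close>

text \<open>Nothing is assumed at the lattice points themselves; the behaviour there is prescribed
  in each lemma by a limit at 0.\<close>

definition elliptic :: "complex set \<Rightarrow> (complex \<Rightarrow> complex) \<Rightarrow> bool" where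
  "elliptic L f \<longleftrightarrow> f holomorphic_on - L \<and> (\<forall>u w. u \<notin> L \<longrightarrow> w \<in> L \<longrightarrow> f (u + w) = f u)"

lemma ellipticD:
  assumes "elliptic L f"
  shows "f holomorphic_on - L" "u \<notin> L \<Longrightarrow> w \<in> L \<Longrightarrow> f (u + w) = f u"
  using assms unfolding elliptic_def by auto

lemma elliptic_pf: "rank_two_lattice L \<Longrightarrow> elliptic L (pf L)"
  unfolding elliptic_def using pf_holomorphic pf_periodic by blast

lemma elliptic_analytic:
  assumes "rank_two_lattice L" "elliptic L f" "u \<notin> L"
  shows "f analytic_on {u}"
  using ellipticD(1)[OF assms(2)] lattice_complement(1)[OF assms(1)] assms(3)
  by (meson ComplI analytic_at)

lemma periodic_eventually_at:
  fixes P :: "complex \<Rightarrow> bool"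
  assumes "\<forall>\<^sub>F t in at 0. P t" "\<And>t. P (t - a) \<Longrightarrow> Q t"
  shows "\<forall>\<^sub>F t in at a. Q t"
proof -
  have "\<forall>\<^sub>F t in at a. P (1 * t + (- a))"
    by (rule eventually_at_affine) (use assms(1) in auto)
  then show ?thesis by eventually_elim (use assms(2) in auto)
qed

text \<open>By periodicity the limit at 0 removes the singularities at all lattice points. The
  resulting entire function is bounded, since every point reduces to a fixed disc.\<close>

lemma elliptic_liouville:
  assumes L: "rank_two_lattice L" and f: "elliptic L f" and lim: "(f \<longlongrightarrow> c) (at 0)" and u: "u \<notin> L"
  shows "f u = c"
proof -
  define g where "g u = (if u \<in> L then c else f u)" for u
  obtain d where d: "d > 0" "\<And>v. v \<in> L \<Longrightarrow> v \<noteq> 0 \<Longrightarrow> d \<le> cmod v"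
    by (rule lattice_discrete[OF L]) blast
  have g_per: "g (u + w) = g u" if "w \<in> L" for u w
    using that ellipticD(2)[OF f] lattice_group(5)[OF L] by (simp add: g_def)
  have gf: "g field_differentiable at v" for v
  proof (cases "v \<in> L")
    case False
    have "f analytic_on {v}" by (rule elliptic_analytic[OF L f False])
    moreover have "\<forall>\<^sub>F t in nhds v. t \<in> - L"
      using lattice_complement(1)[OF L] False by (intro eventually_nhds_in_open) auto
    then have "\<forall>\<^sub>F t in nhds v. f t = g t" by eventually_elim (simp add: g_def)
    ultimately have "g analytic_on {v}" by (rule analytic_cong_nhds)
    then show ?thesis by (rule analytic_on_imp_differentiable_at) simp
  next
    case True
    have sub: "ball v d - {v} \<subseteq> - L"
    proof
      fix t assume t: "t \<in> ball v d - {v}"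
      show "t \<in> - L"
      proof
        assume "t \<in> L"
        then have "t - v \<in> L" using True lattice_group(3)[OF L] by blast
        from d(2)[OF this] t show False by (auto simp: dist_norm norm_minus_commute)
      qed
    qed
    have "g holomorphic_on ball v d"
    proof (rule no_isolated_singularity'[of "{v}"])
      have "f holomorphic_on ball v d - {v}"
        using ellipticD(1)[OF f] sub holomorphic_on_subset by blast
      then show "g holomorphic_on ball v d - {v}"
        by (rule holomorphic_transform) (use sub in \<open>auto simp: g_def\<close>)
      have "((\<lambda>t. f (t - v)) \<longlongrightarrow> c) (at v)"
        using LIM_offset[OF lim, of "- v"] by simp
      then have "((\<lambda>t. f (t - v)) \<longlongrightarrow> c) (at v within ball v d)" by (rule tendsto_within_subset) simp
      moreover have "\<forall>\<^sub>F t in at v within ball v d. f (t - v) = g t"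
      proof -
        have "f (t - v) = g t" if "t \<in> ball v d - {v}" for t
        proof -
          have "t \<notin> L" using that sub by auto
          then have "t - v \<notin> L" using lattice_group(6)[OF L True] by simp
          from ellipticD(2)[OF f this True] show ?thesis using \<open>t \<notin> L\<close> by (simp add: g_def)
        qed
        then show ?thesis unfolding eventually_at_filter by (auto intro: always_eventually)
      qed
      ultimately have "(g \<longlongrightarrow> c) (at v within ball v d)" by (simp cong: tendsto_cong)
      then show "(g \<longlongrightarrow> g z) (at z within ball v d)" if "z \<in> {v}" for z
        using that True by (simp add: g_def)
    qed auto
    then show ?thesis using d(1) by (simp add: holomorphic_on_imp_differentiable_at)
  qed
  have "g holomorphic_on UNIV"
    unfolding holomorphic_on_def using gf by (auto intro: field_differentiable_at_within)
  moreover have "bounded (range g)"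
  proof -
    obtain r where r: "\<And>z. \<exists>v\<in>L. z - v \<in> cball 0 r" using lattice_reduce[OF L] by blast
    have "range g \<subseteq> g ` cball 0 r"
    proof
      fix y assume "y \<in> range g"
      then obtain z where z: "y = g z" by blast
      obtain v where v: "v \<in> L" "z - v \<in> cball 0 r" using r by blast
      have "g z = g (z - v)" using g_per[OF v(1), of "z - v"] by simp
      then show "y \<in> g ` cball 0 r" using v z by blast
    qed
    moreover have "continuous_on (cball 0 r) g"
      using \<open>g holomorphic_on UNIV\<close> holomorphic_on_imp_continuous_on continuous_on_subset by blast
    then have "bounded (g ` cball 0 r)" by (intro compact_imp_bounded compact_continuous_image) auto
    ultimately show ?thesis using bounded_subset by blast
  qed
  ultimately have "g constant_on UNIV" by (rule Liouville_theorem)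
  then have "g u = g 0" unfolding constant_on_def by (metis UNIV_I)
  then show ?thesis using u lattice_group(1)[OF L] by (simp add: g_def)
qed

lemma pf_tendsto:
  assumes "rank_two_lattice L"
  shows "((\<lambda>u. u ^ 2 * pf L u) \<longlongrightarrow> 1) (at 0)"
proof -
  obtain S where S: "S analytic_on {0}" "S 0 = 0" "\<forall>\<^sub>F u in at 0. pf L u = 1 / u ^ 2 + S u"
    using pf_at_0[OF assms] .
  have "(S \<longlongrightarrow> 0) (at 0)" using analytic_at_imp_isCont[OF S(1)] S(2) by (simp add: isCont_def)
  then have "((\<lambda>u. 1 + u ^ 2 * S u) \<longlongrightarrow> 1 + 0 ^ 2 * 0) (at 0)" by (intro tendsto_intros)
  then have "((\<lambda>u. 1 + u ^ 2 * S u) \<longlongrightarrow> 1) (at 0)" by simp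
  moreover have "\<forall>\<^sub>F t in at 0. t \<noteq> (0 :: complex)" by (simp add: eventually_at_filter)
  with S(3) have "\<forall>\<^sub>F u in at 0. 1 + u ^ 2 * S u = u ^ 2 * pf L u"
    by eventually_elim (simp add: field_simps)
  ultimately show ?thesis by (simp cong: tendsto_cong)
qed

text \<open>An even function has no linear term, so vanishing at 0 means vanishing to second
  order.\<close>

lemma even_removable:
  fixes G :: "complex \<Rightarrow> complex"
  assumes d: "d > 0" and G: "G holomorphic_on ball 0 d - {0}" and lim: "(G \<longlongrightarrow> 0) (at 0)"
    and even: "\<And>u. u \<in> ball 0 d - {0} \<Longrightarrow> G (- u) = G u"
  shows "\<exists>c. ((\<lambda>u. G u / u ^ 2) \<longlongrightarrow> c) (at 0)"
proof -
  define G0 where "G0 u = (if u = 0 then 0 else G u)" for u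
  have G0: "G0 holomorphic_on ball 0 d"
  proof (rule no_isolated_singularity'[of "{0}"])
    show "G0 holomorphic_on ball 0 d - {0}"
      by (rule holomorphic_transform[OF G]) (auto simp: G0_def)
    have "\<forall>\<^sub>F u in at 0. G u = G0 u" by (auto simp: eventually_at_filter G0_def)
    then have "(G0 \<longlongrightarrow> 0) (at 0)" using lim by (simp cong: tendsto_cong)
    then show "(G0 \<longlongrightarrow> G0 z) (at z within ball 0 d)" if "z \<in> {0}" for z
      using that by (auto simp: G0_def intro: tendsto_within_subset)
  qed auto
  have an: "G0 analytic_on {0}" using G0 d by (meson analytic_at centre_in_ball open_ball)
  have "deriv G0 0 = deriv (\<lambda>u. G0 (- u)) 0"
  proof (rule deriv_cong_ev)
    have "\<forall>\<^sub>F u in nhds 0. u \<in> ball 0 d" using d by (intro eventually_nhds_in_open) auto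
    then show "\<forall>\<^sub>F u in nhds 0. G0 u = G0 (- u)"
      by eventually_elim (use even in \<open>auto simp: G0_def\<close>)
  qed simp
  also have "\<dots> = - deriv G0 0" by (rule deriv_reflect[OF an])
  finally have z: "deriv G0 0 = 0" by simp
  define G1 where "G1 z = (if z = 0 then deriv G0 0 else (G0 z - G0 0) / (z - 0))" for z
  have G1: "G1 holomorphic_on ball 0 d"
    using pole_lemma[OF G0, of 0] d unfolding G1_def by simp
  define G2 where "G2 z = (if z = 0 then deriv G1 0 else (G1 z - G1 0) / (z - 0))" for z
  have G2: "G2 holomorphic_on ball 0 d"
    using pole_lemma[OF G1, of 0] d unfolding G2_def by simp
  have "isCont G2 0"
    using holomorphic_on_imp_continuous_on[OF G2] d by (simp add: continuous_on_eq_continuous_at)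
  then have "(G2 \<longlongrightarrow> G2 0) (at 0)" by (simp add: isCont_def)
  moreover have "\<forall>\<^sub>F u in at 0. G2 u = G u / u ^ 2"
    by (auto simp: eventually_at_filter G2_def G1_def G0_def z power2_eq_square)
  ultimately have "((\<lambda>u. G u / u ^ 2) \<longlongrightarrow> G2 0) (at 0)" by (simp cong: tendsto_cong)
  then show ?thesis by blast
qed

text \<open>Subtracting c \<wp>^(n+1) cancels the leading polar term, and evenness then lowers the
  order of the pole by two. The lemma yields the differential equation of \<wp>, the numerators of
  lattice fractions and the shape of global solutions.\<close>

lemma elliptic_poly:
  assumes L: "rank_two_lattice L"
  shows "elliptic L f \<Longrightarrow> (\<And>u. u \<notin> L \<Longrightarrow> f (- u) = f u) \<Longrightarrow> ((\<lambda>u. u ^ (2 * n) * f u) \<longlongrightarrow> c) (at 0) \<Longrightarrow>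
    \<exists>p. degree p \<le> n \<and> coeff p n = c \<and> (\<forall>u. u \<notin> L \<longrightarrow> f u = poly p (pf L u))"
proof (induction n arbitrary: f c)
  case 0
  have "f u = c" if "u \<notin> L" for u
    by (rule elliptic_liouville[OF L 0(1) _ that]) (use 0(3) in simp)
  then show ?case by (intro exI[of _ "[:c:]"]) auto
next
  case (Suc n)
  define g where "g u = f u - c * pf L u ^ Suc n" for u
  have gell: "elliptic L g"
    unfolding elliptic_def g_def
    using ellipticD[OF Suc(2)] ellipticD[OF elliptic_pf[OF L]] by (auto intro!: holomorphic_intros)
  have geven: "g (- u) = g u" if "u \<notin> L" for u
    using Suc(3)[OF that] pf_even[OF L] by (simp add: g_def)
  obtain d where d: "d > 0" "\<And>v. v \<in> L \<Longrightarrow> v \<noteq> 0 \<Longrightarrow> d \<le> cmod v"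
    by (rule lattice_discrete[OF L]) blast
  have dL: "u \<notin> L" if "u \<in> ball 0 d - {0}" for u using d(2)[of u] that by auto
  have lim0: "((\<lambda>u. u ^ (2 * Suc n) * g u) \<longlongrightarrow> 0) (at 0)"
  proof -
    have "((\<lambda>u. u ^ (2 * Suc n) * f u - c * (u ^ 2 * pf L u) ^ Suc n) \<longlongrightarrow> c - c * 1 ^ Suc n) (at 0)"
      by (intro tendsto_intros Suc(4) pf_tendsto[OF L])
    moreover have "u ^ (2 * Suc n) * f u - c * (u ^ 2 * pf L u) ^ Suc n = u ^ (2 * Suc n) * g u" for u
    proof -
      have e: "(u ^ 2 * pf L u) ^ Suc n = u ^ (2 * Suc n) * pf L u ^ Suc n"
        by (simp only: power_mult_distrib power_mult)
      show ?thesis unfolding e g_def by (simp only: right_diff_distrib mult.left_commute)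
    qed
    ultimately show ?thesis by simp
  qed
  have "\<exists>c. ((\<lambda>u. u ^ (2 * Suc n) * g u / u ^ 2) \<longlongrightarrow> c) (at 0)"
  proof (rule even_removable[OF d(1) _ lim0])
    have "g holomorphic_on ball 0 d - {0}"
      using ellipticD(1)[OF gell] by (rule holomorphic_on_subset) (use dL in auto)
    then show "(\<lambda>u. u ^ (2 * Suc n) * g u) holomorphic_on ball 0 d - {0}"
      by (intro holomorphic_intros)
    show "(- u) ^ (2 * Suc n) * g (- u) = u ^ (2 * Suc n) * g u" if "u \<in> ball 0 d - {0}" for u
      using geven[OF dL[OF that]] by (simp add: power_mult)
  qed
  then obtain c' where c': "((\<lambda>u. u ^ (2 * Suc n) * g u / u ^ 2) \<longlongrightarrow> c') (at 0)" by blast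
  have "\<forall>\<^sub>F u in at 0. u ^ (2 * Suc n) * g u / u ^ 2 = u ^ (2 * n) * g u"
    by (auto simp: eventually_at_filter power2_eq_square intro!: always_eventually)
  with c' have "((\<lambda>u. u ^ (2 * n) * g u) \<longlongrightarrow> c') (at 0)" by (simp cong: tendsto_cong)
  from Suc.IH[OF gell geven this] obtain p where p: "degree p \<le> n" "\<And>u. u \<notin> L \<Longrightarrow> g u = poly p (pf L u)"
    by blast
  show ?case
  proof (intro exI[of _ "p + monom c (Suc n)"] conjI allI impI)
    show "degree (p + monom c (Suc n)) \<le> Suc n"
      using p(1) by (intro degree_add_le degree_monom_le) auto
    show "coeff (p + monom c (Suc n)) (Suc n) = c"
      using p(1) by (simp add: coeff_eq_0)
    show "f u = poly (p + monom c (Suc n)) (pf L u)" if "u \<notin> L" for u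
      using p(2)[OF that] by (simp add: g_def poly_monom algebra_simps)
  qed
qed

text \<open>If the value c were omitted, 1/(\<wp> - c) would be elliptic with limit 0 at the lattice
  points, hence zero.\<close>

lemma weierstrass_p_surj:
  assumes L: "rank_two_lattice L"
  shows "\<exists>u. weierstrass_p L u = x"
proof (cases x)
  case Infty
  then show ?thesis using lattice_group(1)[OF L] by (intro exI[of _ 0]) simp
next
  case (Pt c)
  show ?thesis
  proof (rule ccontr)
    assume no: "\<nexists>u. weierstrass_p L u = x"
    have ne: "pf L u - c \<noteq> 0" if "u \<notin> L" for u
    proof
      assume "pf L u - c = 0"
      then have "weierstrass_p L u = x" using that by (simp add: weierstrass_p_pf Pt)
      with no show False by blast
    qed
    have ell: "elliptic L (\<lambda>u. 1 / (pf L u - c))"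
      unfolding elliptic_def using ellipticD[OF elliptic_pf[OF L]] ne by (auto intro!: holomorphic_intros)
    have "((\<lambda>u. u ^ 2 / (u ^ 2 * pf L u - c * u ^ 2)) \<longlongrightarrow> 0 ^ 2 / (1 - c * 0 ^ 2)) (at 0)"
      by (intro tendsto_intros pf_tendsto[OF L]) auto
    then have "((\<lambda>u. u ^ 2 / (u ^ 2 * pf L u - c * u ^ 2)) \<longlongrightarrow> 0) (at 0)" by simp
    moreover have "\<forall>\<^sub>F u in at 0. u ^ 2 / (u ^ 2 * pf L u - c * u ^ 2) = 1 / (pf L u - c)"
    proof -
      have "u ^ 2 / (u ^ 2 * pf L u - c * u ^ 2) = 1 / (pf L u - c)" if "u \<noteq> 0" for u
      proof -
        have "u ^ 2 * pf L u - c * u ^ 2 = u ^ 2 * (pf L u - c)" by (simp add: algebra_simps)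
        then show ?thesis using that by simp
      qed
      then show ?thesis by (auto simp: eventually_at_filter)
    qed
    ultimately have lim: "((\<lambda>u. 1 / (pf L u - c)) \<longlongrightarrow> 0) (at 0)" by (simp cong: tendsto_cong)
    have "\<exists>u. u \<notin> L" using eventually_happens[OF lattice_not_in_near_0[OF L]] by auto
    then obtain u where u: "u \<notin> L" by blast
    from elliptic_liouville[OF L ell lim u] ne[OF u] show False by simp
  qed
qed

section \<open>The differential equation of the Weierstrass function\<close>

lemma pf_deriv_at_0:
  assumes L: "rank_two_lattice L"
  shows "((\<lambda>u. u ^ 3 * deriv (pf L) u) \<longlongrightarrow> - 2) (at 0)"
proof -
  obtain S where S: "S analytic_on {0}" "S 0 = 0" "\<forall>\<^sub>F u in at 0. pf L u = 1 / u ^ 2 + S u"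
    using pf_at_0[OF L] .
  have "\<forall>\<^sub>F t in at 0. t \<noteq> (0 :: complex)" by (simp add: eventually_at_filter)
  with eventually_at_nested[OF S(3)] eventually_at_of_nhds[OF analytic_eventually[OF S(1)]]
  have "\<forall>\<^sub>F u in at 0. - 2 + u ^ 3 * deriv S u = u ^ 3 * deriv (pf L) u"
  proof eventually_elim
    case (elim u)
    have "deriv (pf L) u = deriv (\<lambda>u. 1 / u ^ 2 + S u) u" by (rule deriv_cong_ev[OF elim(1) refl])
    also have "\<dots> = - 2 / u ^ 3 + deriv S u"
    proof (rule DERIV_imp_deriv)
      have "((\<lambda>u. 1 / u ^ 2) has_field_derivative - 2 / u ^ 3) (at u)"
        using wp_term_deriv[of u 0] elim(3) by simp
      moreover have "(S has_field_derivative deriv S u) (at u)"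
        by (rule analytic_DERIV[OF elim(2)])
      ultimately show "((\<lambda>u. 1 / u ^ 2 + S u) has_field_derivative - 2 / u ^ 3 + deriv S u) (at u)"
        by (rule DERIV_add)
    qed
    finally show ?case using elim(3) by (simp add: field_simps)
  qed
  moreover have "((\<lambda>u. - 2 + u ^ 3 * deriv S u) \<longlongrightarrow> - 2 + 0 ^ 3 * deriv S 0) (at 0)"
    using analytic_at_imp_isCont[OF analytic_deriv[OF S(1)]] unfolding isCont_def by (intro tendsto_intros)
  then have "((\<lambda>u. - 2 + u ^ 3 * deriv S u) \<longlongrightarrow> - 2) (at 0)" by simp
  ultimately show ?thesis by (simp cong: tendsto_cong)
qed

lemma elliptic_deriv:
  assumes L: "rank_two_lattice L" and f: "elliptic L f"
  shows "elliptic L (deriv f)"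
  unfolding elliptic_def
proof (intro conjI allI impI)
  show "deriv f holomorphic_on - L"
    by (rule holomorphic_deriv[OF ellipticD(1)[OF f] lattice_complement(1)[OF L]])
  fix u w assume u: "u \<notin> L" and w: "w \<in> L"
  have "\<forall>\<^sub>F t in nhds u. t \<in> - L"
    using lattice_complement(1)[OF L] u by (intro eventually_nhds_in_open) auto
  then have "\<forall>\<^sub>F t in nhds u. f t = f (t + w)"
    by eventually_elim (use ellipticD(2)[OF f] w in auto)
  then have "deriv f u = deriv (\<lambda>t. f (t + w)) u" by (rule deriv_cong_ev) simp
  also have "\<dots> = deriv f (u + w)"
  proof (rule DERIV_imp_deriv)
    have "f analytic_on {u + w}" by (rule elliptic_analytic[OF L f]) (use u lattice_group(5)[OF L w] in auto)
    then have "(f has_field_derivative deriv f (u + w)) (at (u + w))"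
      by (rule analytic_DERIV)
    then show "((\<lambda>t. f (t + w)) has_field_derivative deriv f (u + w)) (at u)"
      by (simp add: DERIV_shift)
  qed
  finally show "deriv f (u + w) = deriv f u" ..
qed

lemma pf_deriv_odd:
  assumes L: "rank_two_lattice L" and u: "u \<notin> L"
  shows "deriv (pf L) (- u) = - deriv (pf L) u"
proof -
  have "(pf L has_field_derivative deriv (pf L) (- u)) (at (- u))"
    by (rule analytic_DERIV[OF elliptic_analytic[OF L elliptic_pf[OF L]]]) (use u lattice_group(7)[OF L] in simp)
  then have "((\<lambda>t. pf L (- t)) has_field_derivative deriv (pf L) (- u) * (- 1)) (at u)"
    by (rule DERIV_chain2[where f = "pf L" and g = uminus]) (auto intro!: derivative_eq_intros)
  then have "deriv (pf L) u = deriv (pf L) (- u) * (- 1)"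
    using pf_even[OF L] by (auto dest: DERIV_imp_deriv)
  then show ?thesis by simp
qed

text \<open>The square of the odd function \<wp>' is even, and u^6 \<wp>'^2 tends to (-2)^2 = 4, so
  it is a polynomial in \<wp> of degree 3.\<close>

lemma pf_differential_equation:
  assumes L: "rank_two_lattice L"
  shows "\<exists>f. degree f = 3 \<and> (\<forall>u. u \<notin> L \<longrightarrow> (deriv (pf L) u) ^ 2 = poly f (pf L u))"
proof -
  have "\<exists>p. degree p \<le> 3 \<and> coeff p 3 = 4 \<and> (\<forall>u. u \<notin> L \<longrightarrow> (deriv (pf L) u) ^ 2 = poly p (pf L u))"
  proof (rule elliptic_poly[OF L])
    show "elliptic L (\<lambda>u. (deriv (pf L) u) ^ 2)"
      using ellipticD[OF elliptic_deriv[OF L elliptic_pf[OF L]]] unfolding elliptic_def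
      by (auto intro!: holomorphic_intros)
    show "(deriv (pf L) (- u)) ^ 2 = (deriv (pf L) u) ^ 2" if "u \<notin> L" for u
      by (simp add: pf_deriv_odd[OF L that])
    have "((\<lambda>u. (u ^ 3 * deriv (pf L) u) ^ 2) \<longlongrightarrow> (- 2) ^ 2) (at 0)"
      by (intro tendsto_intros pf_deriv_at_0[OF L])
    then show "((\<lambda>u. u ^ (2 * 3) * (deriv (pf L) u) ^ 2) \<longlongrightarrow> 4) (at 0)"
      by (simp add: power_mult_distrib flip: power_mult)
  qed
  then obtain p where p: "degree p \<le> 3" "coeff p 3 = 4"
    "\<forall>u. u \<notin> L \<longrightarrow> (deriv (pf L) u) ^ 2 = poly p (pf L u)" by blast
  have "degree p = 3" using p(1,2) le_degree[of p 3] by simp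
  with p(3) show ?thesis by blast
qed

text \<open>Near a pole the leading term decides. Elsewhere a zero of \<wp>' that is not isolated
  would make \<wp>' vanish on the connected complement of \<open>L\<close>, hence also near the
  poles.\<close>

lemma pf_deriv_nonzero:
  assumes L: "rank_two_lattice L"
  shows "\<forall>\<^sub>F t in at a. t \<notin> L \<and> deriv (pf L) t \<noteq> 0"
proof -
  have "\<forall>\<^sub>F u in at 0. u ^ 3 * deriv (pf L) u \<noteq> 0"
    by (rule tendsto_imp_eventually_ne[OF pf_deriv_at_0[OF L]]) simp
  with lattice_not_in_near_0[OF L] have at0: "\<forall>\<^sub>F u in at 0. u \<notin> L \<and> deriv (pf L) u \<noteq> 0"
    by eventually_elim auto
  note ell = elliptic_deriv[OF L elliptic_pf[OF L]]
  show ?thesis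
  proof (cases "a \<in> L")
    case True
    show ?thesis
    proof (rule periodic_eventually_at[OF at0])
      fix t assume t: "t - a \<notin> L \<and> deriv (pf L) (t - a) \<noteq> 0"
      then show "t \<notin> L \<and> deriv (pf L) t \<noteq> 0"
        using ellipticD(2)[OF ell, of "t - a" a] True lattice_group(6)[OF L True] by auto
    qed
  next
    case False
    have aL: "\<forall>\<^sub>F t in nhds a. t \<in> - L"
      using lattice_complement(1)[OF L] False by (intro eventually_nhds_in_open) auto
    from analytic_zero_cases[OF elliptic_analytic[OF L ell False]] show ?thesis
    proof
      assume "\<forall>\<^sub>F t in at a. deriv (pf L) t \<noteq> 0"
      with eventually_at_of_nhds[OF aL] show ?thesis by eventually_elim simp
    next
      assume "\<forall>\<^sub>F t in nhds a. deriv (pf L) t = 0"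
      with aL have "\<forall>\<^sub>F t in nhds a. t \<in> - L \<and> deriv (pf L) t = 0" by eventually_elim simp
      then obtain S where S: "open S" "a \<in> S" "\<forall>t\<in>S. t \<in> - L \<and> deriv (pf L) t = 0"
        unfolding eventually_nhds by blast
      obtain u where u: "u \<notin> L" "deriv (pf L) u \<noteq> 0" using eventually_happens[OF at0] by auto
      have "deriv (pf L) u = 0"
      proof (rule analytic_continuation_open[of S "- L" "deriv (pf L)" "\<lambda>_. 0"])
        show "open S" "S \<noteq> {}" "S \<subseteq> - L" using S by auto
        show "deriv (pf L) holomorphic_on - L" by (rule ellipticD(1)[OF ell])
      qed (use S u lattice_complement[OF L] in auto)
      with u show ?thesis by simp
    qed
  qed
qed

lemma weierstrass_p_gsol:
  assumes L: "rank_two_lattice L"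
  shows "\<exists>f. gsol f (weierstrass_p L)"
proof -
  obtain f where f: "degree f = 3" "\<And>u. u \<notin> L \<Longrightarrow> (deriv (pf L) u) ^ 2 = poly f (pf L u)"
    using pf_differential_equation[OF L] by blast
  have sol: "sol_at f (weierstrass_p L) a" for a
    unfolding sol_at_def
  proof
    show "hol_at (weierstrass_p L) a" by (rule weierstrass_p_hol[OF L])
    show "\<forall>\<^sub>F t in at a. weierstrass_p L t \<noteq> Infty \<and> deriv (\<lambda>s. fin (weierstrass_p L s)) t \<noteq> 0 \<and>
        (deriv (\<lambda>s. fin (weierstrass_p L s)) t) ^ 2 = poly f (fin (weierstrass_p L t))"
      using pf_deriv_nonzero[OF L] by eventually_elim (auto simp flip: pf_def simp: f(2))
  qed
  \<comment> \<open>A double root e is a value of \<wp> by surjectivity. There the local coordinate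
    of \<wp> and the constant 0 solve the same second order equation with zero initial data, so
    \<wp> would be constant.\<close>
  have "poly (pderiv f) e \<noteq> 0" if e: "poly f e = 0" for e
  proof
    assume e': "poly (pderiv f) e = 0"
    obtain a where a: "weierstrass_p L a = Pt e" using weierstrass_p_surj[OF L] by blast
    obtain h where h: "h analytic_on {a}" "h a = 0"
      "\<forall>\<^sub>F t in nhds a. weierstrass_p L t = local_param (weierstrass_p L a) (h t)"
      "\<forall>\<^sub>F t in nhds a. (deriv h t) ^ 2 = poly (loc f (weierstrass_p L a)) (h t)"
      "\<forall>\<^sub>F t in at a. deriv h t \<noteq> 0"
      using sol_germ[OF f(1) sol] .
    have "deriv h a = 0"
      using eventually_nhds_at_point[OF h(4)] h(2) e by (simp add: a loc_def poly_pcompose)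
    then have "\<forall>\<^sub>F t in nhds a. h t = (\<lambda>_. 0) t"
    proof (intro ode_unique[OF h(1) _ first_order_imp_second_order[OF h(1,4,5)]])
      show "\<forall>\<^sub>F t in nhds a. deriv (deriv (\<lambda>_. 0)) t =
          poly (smult (1 / 2) (pderiv (loc f (weierstrass_p L a)))) 0"
        by (simp add: a loc_def pderiv_pcompose poly_pcompose e' deriv_const)
    qed (auto simp: h(2))
    then have "\<forall>\<^sub>F t in at a. h t = 0" by (rule eventually_at_of_nhds)
    with germ_nonzero[OF sol_at_nonconst[OF sol] h(3)]
    have "\<forall>\<^sub>F t in at a. False" by eventually_elim simp
    then show False by simp
  qed
  then have "cubic f" using f(1) by (simp add: cubic_def)
  with sol show ?thesis unfolding gsol_def by blast
qed

text \<open>This is 4 y^3 - g2 y - g3 with the invariants of \<open>L\<close>; it enters only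
  through the equation that characterises it.\<close>

definition wcubic :: "complex set \<Rightarrow> complex poly" where
  "wcubic L = (SOME f. gsol f (weierstrass_p L))"

lemma wcubic: "rank_two_lattice L \<Longrightarrow> gsol (wcubic L) (weierstrass_p L)"
  unfolding wcubic_def using weierstrass_p_gsol by (rule someI_ex)

lemma weierstrass_p_0: "rank_two_lattice L \<Longrightarrow> weierstrass_p L 0 = Infty"
  by (simp add: lattice_group(1))

lemma weierstrass_p_eq_iff:
  assumes "rank_two_lattice L"
  shows "weierstrass_p L u = weierstrass_p L v \<longleftrightarrow> u - v \<in> L \<or> u + v \<in> L"
  using gsol_eq_iff[OF wcubic[OF assms] weierstrass_p_0[OF assms]] by simp

lemma weierstrass_p_branch_iff:
  assumes "rank_two_lattice L"
  shows "weierstrass_p L u \<in> branch (wcubic L) \<longleftrightarrow> 2 * u \<in> L"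
  using gsol_branch_iff[OF wcubic[OF assms] weierstrass_p_0[OF assms]] by simp

lemma weierstrass_p_germ_degree:
  assumes "rank_two_lattice L"
  shows "germ_degree (weierstrass_p L) u = (if 2 * u \<in> L then 2 else 1)"
  using sol_germ_degree[OF gsolD(1,3)[OF wcubic[OF assms]]] weierstrass_p_branch_iff[OF assms] by simp

section \<open>Lattice fractions\<close>

abbreviation cosets :: "complex set \<Rightarrow> complex set \<Rightarrow> complex set set" where
  "cosets L M \<equiv> (\<lambda>v. (+) v ` M) ` L"

lemma coset_eq_iff:
  assumes "rank_two_lattice M"
  shows "(+) v ` M = (+) w ` M \<longleftrightarrow> v - w \<in> M"
proof
  assume "(+) v ` M = (+) w ` M"
  moreover have "v \<in> (+) v ` M" using lattice_group(1)[OF assms] by force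
  ultimately obtain m where "m \<in> M" "v = w + m" by auto
  then show "v - w \<in> M" by simp
next
  assume vw: "v - w \<in> M"
  show "(+) v ` M = (+) w ` M"
  proof
    show "(+) v ` M \<subseteq> (+) w ` M"
    proof
      fix x assume "x \<in> (+) v ` M"
      then obtain m where m: "m \<in> M" "x = w + (v - w + m)" by auto
      then show "x \<in> (+) w ` M" using lattice_group(2)[OF assms vw m(1)] by blast
    qed
    show "(+) w ` M \<subseteq> (+) v ` M"
    proof
      fix x assume "x \<in> (+) w ` M"
      then obtain m where m: "m \<in> M" "x = v + (m - (v - w))" by auto
      then show "x \<in> (+) v ` M" using lattice_group(3)[OF assms m(1) vw] by blast
    qed
  qed
qed

lemma coset_mem_iff:
  assumes "rank_two_lattice M"
  shows "w \<in> (+) v ` M \<longleftrightarrow> w - v \<in> M"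
proof
  assume "w - v \<in> M"
  moreover have "w = v + (w - v)" by simp
  ultimately show "w \<in> (+) v ` M" by blast
qed auto

text \<open>Every coset has a representative in a fixed disc, and the disc contains finitely many
  points of \<open>L\<close>.\<close>

lemma cosets_finite:
  assumes L: "rank_two_lattice L" and M: "rank_two_lattice M" and sub: "M \<subseteq> L"
  shows "finite (cosets L M)"
proof -
  obtain r where r: "\<And>z. \<exists>v\<in>M. z - v \<in> cball 0 r" using lattice_reduce[OF M] by blast
  have "cosets L M \<subseteq> (\<lambda>v. (+) v ` M) ` (L \<inter> cball 0 r)"
  proof
    fix C assume "C \<in> cosets L M"
    then obtain z where z: "z \<in> L" "C = (+) z ` M" by blast
    obtain v where v: "v \<in> M" "z - v \<in> cball 0 r" using r by blast
    have "C = (+) (z - v) ` M" using v coset_eq_iff[OF M, of z "z - v"] z(2) by simp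
    moreover have "z - v \<in> L" using v sub z lattice_group(3)[OF L] by blast
    ultimately show "C \<in> (\<lambda>v. (+) v ` M) ` (L \<inter> cball 0 r)" using v by blast
  qed
  then show ?thesis by (rule finite_subset) (use lattice_finite_ball[OF L] in auto)
qed

lemma lattice_index_pos:
  assumes L: "rank_two_lattice L" and M: "rank_two_lattice M" and sub: "M \<subseteq> L"
  shows "lattice_index L M > 0"
  using cosets_finite[OF assms] lattice_group(1)[OF L] unfolding lattice_index_def card_gt_0_iff by blast

lemma zero_order_limit:
  assumes f: "f analytic_on {a}" "\<forall>\<^sub>F t in at a. f t \<noteq> 0" and n: "zorder f a = int n"
  shows "\<exists>c. c \<noteq> 0 \<and> ((\<lambda>t. f t / (t - a) ^ n) \<longlongrightarrow> c) (at a)"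
proof -
  have "\<exists>\<^sub>F t in at a. f t \<noteq> 0" using f(2) by (rule eventually_frequently[rotated]) simp
  from zorder_exist[OF isolated_singularity_at_analytic[OF f(1)] not_essential_analytic[OF f(1)] this]
  obtain r where nz: "zor_poly f a a \<noteq> 0" and r: "r > 0" "zor_poly f a holomorphic_on cball a r"
    "\<And>w. w \<in> cball a r - {a} \<Longrightarrow> f w = zor_poly f a w * (w - a) powi n"
    unfolding n by blast
  have "isCont (zor_poly f a) a"
    using continuous_on_interior[OF holomorphic_on_imp_continuous_on[OF r(2)]] r(1) by simp
  then have "(zor_poly f a \<longlongrightarrow> zor_poly f a a) (at a)" by (simp add: isCont_def)
  moreover have "\<forall>\<^sub>F t in at a. zor_poly f a t = f t / (t - a) ^ n"
    unfolding eventually_at using r by (intro exI[of _ r]) (auto simp: dist_commute)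
  ultimately have "((\<lambda>t. f t / (t - a) ^ n) \<longlongrightarrow> zor_poly f a a) (at a)" by (simp cong: tendsto_cong)
  with nz show ?thesis by blast
qed

text \<open>The nonzero limit measures the zero of \<wp>(t|M) - \<wp>(a|M) exactly, so that it can
  be weighed against a double pole of \<wp>(t|L).\<close>

lemma pf_zero_limit:
  assumes M: "rank_two_lattice M" and a: "a \<notin> M"
  shows "\<exists>c. c \<noteq> 0 \<and> ((\<lambda>t. (pf M t - pf M a) / (t - a) ^ (if 2 * a \<in> M then 2 else 1)) \<longlongrightarrow> c) (at a)"
proof -
  have an: "(\<lambda>t. pf M t - pf M a) analytic_on {a}"
    using elliptic_analytic[OF M elliptic_pf[OF M] a] by (intro analytic_on_diff) auto
  have "\<forall>\<^sub>F t in nhds a. t \<in> - M"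
    using lattice_complement(1)[OF M] a by (intro eventually_nhds_in_open) auto
  then have ev: "\<forall>\<^sub>F t in nhds a. weierstrass_p M t = local_param (weierstrass_p M a) (pf M t - pf M a)"
    by eventually_elim (use a in \<open>simp add: weierstrass_p_pf\<close>)
  have "zorder (\<lambda>t. pf M t - pf M a) a = int (if 2 * a \<in> M then 2 else 1)"
    using germ_degree_eq_zorder[OF ev] weierstrass_p_germ_degree[OF M, of a] by (simp split: if_splits)
  then show ?thesis
    by (rule zero_order_limit[OF an germ_nonzero[OF gsolD(5)[OF wcubic[OF M]] ev]])
qed

lemma coprimeI_no_common_root:
  fixes p q :: "complex poly"
  assumes "\<And>z. poly q z = 0 \<Longrightarrow> poly p z \<noteq> 0"
  shows "coprime p q"
proof (rule coprimeI)
  fix c assume c: "c dvd p" "c dvd q"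
  have "\<not> (\<exists>z. poly c z = 0)"
    using c assms by (metis dvdE poly_mult mult_zero_left)
  then have "degree c = 0"
    using fundamental_theorem_of_algebra[of c] constant_degree[of c] by auto
  moreover have "c \<noteq> 0" using \<open>\<not> (\<exists>z. poly c z = 0)\<close> by auto
  ultimately show "is_unit c" by (simp add: is_unit_iff_degree)
qed

lemma weierstrass_p_shifted_tendsto:
  assumes L: "rank_two_lattice L" and a: "a \<in> L"
  shows "((\<lambda>u. (u - a) ^ 2 * pf L u) \<longlongrightarrow> 1) (at a)"
proof -
  have "((\<lambda>u. (u - a) ^ 2 * pf L (u - a)) \<longlongrightarrow> 1) (at a)"
    using LIM_offset[OF pf_tendsto[OF L], of "- a"] by simp
  moreover have "pf L (u - a) = pf L u" for u
    using pf_periodic[OF L lattice_group(4)[OF L a], of u] by simp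
  ultimately show ?thesis by simp
qed

text \<open>The denominator \<open>q\<close> has one linear factor for every nontrivial coset of \<open>M\<close> in \<open>L\<close>, and
  \<open>q(\<wp>(u|M))\<close> cancels the double poles of \<open>\<wp>(u|L)\<close> at \<open>L - M\<close> exactly: at \<open>v\<close> the simple zeros of
  the equal factors of \<open>v\<close> and \<open>-v\<close> combine, while for a half period \<open>v\<close> the only factor
  has a double zero.\<close>

lemma lattice_fraction_exists:
  assumes L: "rank_two_lattice L" and M: "rank_two_lattice M" and sub: "M \<subseteq> L"
  shows "\<exists>R. is_lattice_fraction L M R"
proof -
  define n where "n = lattice_index L M"
  define Q where "Q = cosets L M - {M}"
  \<comment> \<open>By periodicity the value does not depend on the representative chosen in the
    coset.\<close>
  define e where "e C = pf M (SOME v. v \<in> C)" for C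
  define q where "q = (\<Prod>C\<in>Q. [:- e C, 1:])"
  have M0: "M = (+) 0 ` M" by simp
  have fQ: "finite Q" unfolding Q_def using cosets_finite[OF L M sub] by simp
  have cardQ: "card Q + 1 = n"
  proof -
    have "M \<in> cosets L M" using M0 lattice_group(1)[OF L] by blast
    then show ?thesis
      unfolding Q_def n_def lattice_index_def using cosets_finite[OF L M sub]
      by (simp add: card_Diff_singleton card_gt_0_iff Suc_diff_1 card_0_eq)
         (metis card_gt_0_iff empty_iff Suc_diff_1 Suc_pred)
  qed
  have eC: "e ((+) v ` M) = pf M v" for v
  proof -
    have "(SOME w. w \<in> (+) v ` M) \<in> (+) v ` M"
      by (rule someI[of _ v]) (use coset_mem_iff[OF M] lattice_group(1)[OF M] in simp)
    then have "(SOME w. w \<in> (+) v ` M) - v \<in> M" using coset_mem_iff[OF M] by simp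
    from pf_periodic[OF M this, of v] show ?thesis by (simp add: e_def)
  qed
  have Qmem: "C \<in> Q \<longleftrightarrow> (\<exists>v. v \<in> L \<and> v \<notin> M \<and> C = (+) v ` M)" for C
    unfolding Q_def using coset_eq_iff[OF M, of _ 0] by auto
  have q_eval: "poly q z = (\<Prod>C\<in>Q. z - e C)" for z
    unfolding q_def poly_prod by (intro prod.cong) auto
  have q_deg: "degree q = n - 1"
  proof -
    have "degree q = (\<Sum>C\<in>Q. degree [:- e C, 1:])"
      unfolding q_def by (rule degree_prod_eq_sum_degree) auto
    then show ?thesis using cardQ by simp
  qed
  define g where "g u = pf L u * poly q (pf M u)" for u
  have g_per: "g (u + w) = g u" if "w \<in> M" for u w
    using pf_periodic[OF M that] pf_periodic[OF L, of w] that sub by (auto simp: g_def)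
  have g_even: "g (- u) = g u" for u
    using pf_even[OF M] pf_even[OF L] by (simp add: g_def)
  have lim: "\<exists>c. c \<noteq> 0 \<and> (g \<longlongrightarrow> c) (at a)" if a: "a \<in> L" "a \<notin> M" for a
  proof -
    define b where "b = - a"
    \<comment> \<open>The cosets whose factors vanish at a: those of a and -a, which coincide
      exactly if 2a lies in \<open>M\<close>.\<close>
    define Q0 where "Q0 = {(+) a ` M, (+) b ` M}"
    have na: "b \<in> L" "b \<notin> M" using a lattice_group(7)[OF L] lattice_group(7)[OF M] by (auto simp: b_def)
    have ab: "v - b = v + a" "a - b = 2 * a" "pf M b = pf M a" for v
      using pf_even[OF M] by (auto simp: b_def)
    have Q0: "Q0 \<subseteq> Q" unfolding Q0_def using a na by (auto simp: Qmem)
    have rest: "pf M a - e C \<noteq> 0" if CQ: "C \<in> Q - Q0" for C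
    proof
      assume eq: "pf M a - e C = 0"
      obtain v where v: "v \<in> L" "v \<notin> M" "C = (+) v ` M" using CQ unfolding Diff_iff Qmem by blast
      have "weierstrass_p M v = weierstrass_p M a"
        using eq eC v a by (simp add: weierstrass_p_pf)
      then have "v - a \<in> M \<or> v + a \<in> M" using weierstrass_p_eq_iff[OF M] by blast
      then have "C \<in> Q0"
        using coset_eq_iff[OF M, of v a] coset_eq_iff[OF M, of v b] v(3) ab unfolding Q0_def by auto
      with that show False by blast
    qed
    have conta: "(pf M \<longlongrightarrow> pf M a) (at a)"
      using analytic_at_imp_isCont[OF elliptic_analytic[OF M elliptic_pf[OF M] a(2)]] by (simp add: isCont_def)
    have lim1: "((\<lambda>u. \<Prod>C\<in>Q - Q0. pf M u - e C) \<longlongrightarrow> (\<Prod>C\<in>Q - Q0. pf M a - e C)) (at a)"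
      by (intro tendsto_intros conta)
    have nz1: "(\<Prod>C\<in>Q - Q0. pf M a - e C) \<noteq> 0" using rest fQ by auto
    obtain c where c: "c \<noteq> 0"
      "((\<lambda>t. (pf M t - pf M a) / (t - a) ^ (if 2 * a \<in> M then 2 else 1)) \<longlongrightarrow> c) (at a)"
      using pf_zero_limit[OF M a(2)] by blast
    have eq0: "(\<Prod>C\<in>Q0. z - e C) = (z - pf M a) ^ (if 2 * a \<in> M then 1 else 2)" for z
    proof -
      have em: "e ((+) b ` M) = pf M a" "e ((+) a ` M) = pf M a" using eC[of b] eC[of a] ab by simp_all
      show ?thesis
      proof (cases "2 * a \<in> M")
        case True
        then have "(+) a ` M = (+) b ` M" using coset_eq_iff[OF M, of a b] ab by simp
        then show ?thesis using True em by (simp add: Q0_def)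
      next
        case False
        then have "(+) a ` M \<noteq> (+) b ` M" using coset_eq_iff[OF M, of a b] ab by simp
        then show ?thesis using False em by (simp add: Q0_def power2_eq_square)
      qed
    qed
    have "\<exists>c'. c' \<noteq> 0 \<and> ((\<lambda>t. (\<Prod>C\<in>Q0. pf M t - e C) / (t - a) ^ 2) \<longlongrightarrow> c') (at a)"
    proof (cases "2 * a \<in> M")
      case True
      then show ?thesis using c by (intro exI[of _ c]) (simp add: eq0)
    next
      case False
      have "((\<lambda>t. ((pf M t - pf M a) / (t - a) ^ 1) ^ 2) \<longlongrightarrow> c ^ 2) (at a)"
        using c(2) False by (intro tendsto_intros) auto
      then show ?thesis using c(1) False by (intro exI[of _ "c ^ 2"]) (simp add: eq0 power_divide)
    qed
    then obtain c' where c': "c' \<noteq> 0" "((\<lambda>t. (\<Prod>C\<in>Q0. pf M t - e C) / (t - a) ^ 2) \<longlongrightarrow> c') (at a)" by blast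
    have "((\<lambda>t. ((t - a) ^ 2 * pf L t) * (((\<Prod>C\<in>Q0. pf M t - e C) / (t - a) ^ 2) * (\<Prod>C\<in>Q - Q0. pf M t - e C)))
        \<longlongrightarrow> 1 * (c' * (\<Prod>C\<in>Q - Q0. pf M a - e C))) (at a)"
      by (intro tendsto_mult weierstrass_p_shifted_tendsto[OF L a(1)] c'(2) lim1)
    moreover have "((t - a) ^ 2 * pf L t) * (((\<Prod>C\<in>Q0. pf M t - e C) / (t - a) ^ 2) * (\<Prod>C\<in>Q - Q0. pf M t - e C)) = g t"
      if "t \<noteq> a" for t
    proof -
      have "(\<Prod>C\<in>Q. pf M t - e C) = (\<Prod>C\<in>Q - Q0. pf M t - e C) * (\<Prod>C\<in>Q0. pf M t - e C)"
        by (rule prod.subset_diff[OF Q0 fQ])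
      then show ?thesis using that by (simp add: g_def q_eval)
    qed
    then have "\<forall>\<^sub>F t in at a. ((t - a) ^ 2 * pf L t) * (((\<Prod>C\<in>Q0. pf M t - e C) / (t - a) ^ 2) * (\<Prod>C\<in>Q - Q0. pf M t - e C)) = g t"
      by (simp add: eventually_at_filter)
    ultimately have "(g \<longlongrightarrow> 1 * (c' * (\<Prod>C\<in>Q - Q0. pf M a - e C))) (at a)" by (simp cong: tendsto_cong)
    then show ?thesis using c'(1) nz1 by (intro exI[of _ "1 * (c' * (\<Prod>C\<in>Q - Q0. pf M a - e C))"]) auto
  qed
  \<comment> \<open>The singularities of g at \<open>L - M\<close> are removable and are filled by
    the limits. At points of \<open>M\<close> there is a genuine pole, and the value of f there is
    junk.\<close>
  define f where "f u = (if u \<in> L then Lim (at u) g else g u)" for u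
  have flim: "(g \<longlongrightarrow> f a) (at a) \<and> f a \<noteq> 0" if aL: "a \<in> L" "a \<notin> M" for a
  proof -
    obtain c where c: "c \<noteq> 0" "(g \<longlongrightarrow> c) (at a)" using lim[OF aL] by blast
    then have "Lim (at a) g = c" by (intro tendsto_Lim) auto
    then show ?thesis using c aL by (simp add: f_def)
  qed
  have f_per: "f (u + w) = f u" if w: "w \<in> M" and u: "u \<notin> M" for u w
  proof (cases "u \<in> L")
    case False
    then show ?thesis using g_per[OF w] lattice_group(5)[OF L, of w u] w sub by (auto simp: f_def)
  next
    case True
    have uw: "u + w \<in> L" "u + w \<notin> M" using True w sub u lattice_group(2)[OF L] lattice_group(5)[OF M w] by auto
    have "((\<lambda>t. g (t + w)) \<longlongrightarrow> f (u + w)) (at (u + w - w))"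
      by (rule LIM_offset) (use flim[OF uw] in simp)
    then have "(g \<longlongrightarrow> f (u + w)) (at u)" using g_per[OF w] by simp
    then show ?thesis using flim[OF True u] LIM_unique by blast
  qed
  have f_even: "f (- u) = f u" if u: "u \<notin> M" for u
  proof (cases "u \<in> L")
    case False
    then show ?thesis using g_even lattice_group(7)[OF L] by (simp add: f_def)
  next
    case True
    have nu: "- u \<in> L" "- u \<notin> M" using True u lattice_group(7)[OF L] lattice_group(7)[OF M] by auto
    have "((\<lambda>t. g (- t)) \<longlongrightarrow> f (- u)) (at u)"
      by (rule filterlim_compose[OF conjunct1[OF flim[OF nu]]]) (auto simp: filterlim_at eventually_at_filter intro!: tendsto_intros)
    then have "(g \<longlongrightarrow> f (- u)) (at u)" by (simp add: g_even)
    then show ?thesis using flim[OF True u] LIM_unique by blast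
  qed
  obtain d where d: "d > 0" "\<And>v. v \<in> L \<Longrightarrow> v \<noteq> 0 \<Longrightarrow> d \<le> cmod v"
    by (rule lattice_discrete[OF L]) blast
  have g_hol: "g holomorphic_on - L"
    unfolding g_def q_eval using pf_holomorphic[OF L] pf_holomorphic[OF M] sub
    by (intro holomorphic_intros) (auto intro: holomorphic_on_subset)
  have f_fd: "f field_differentiable at v" if vM: "v \<notin> M" for v
  proof (cases "v \<in> L")
    case False
    have "g analytic_on {v}" using g_hol lattice_complement(1)[OF L] False by (meson ComplI analytic_at)
    moreover have "\<forall>\<^sub>F t in nhds v. t \<in> - L"
      using lattice_complement(1)[OF L] False by (intro eventually_nhds_in_open) auto
    then have "\<forall>\<^sub>F t in nhds v. g t = f t" by eventually_elim (simp add: f_def)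
    ultimately have "f analytic_on {v}" by (rule analytic_cong_nhds)
    then show ?thesis by (rule analytic_on_imp_differentiable_at) simp
  next
    case True
    have sub': "t \<notin> L" if "t \<in> ball v d - {v}" for t
    proof
      assume "t \<in> L"
      then have "t - v \<in> L" using True lattice_group(3)[OF L] by blast
      from d(2)[OF this] that show False by (auto simp: dist_norm norm_minus_commute)
    qed
    have "f holomorphic_on ball v d"
    proof (rule no_isolated_singularity'[of "{v}"])
      have "g holomorphic_on ball v d - {v}"
        using g_hol by (rule holomorphic_on_subset) (use sub' in auto)
      then show "f holomorphic_on ball v d - {v}"
        by (rule holomorphic_transform) (use sub' in \<open>auto simp: f_def\<close>)
      have "(g \<longlongrightarrow> f v) (at v within ball v d)"
        using flim[OF True vM] by (auto intro: tendsto_within_subset)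
      moreover have "\<forall>\<^sub>F t in at v within ball v d. g t = f t"
        unfolding eventually_at_filter using sub' by (auto simp: f_def intro: always_eventually)
      ultimately have "(f \<longlongrightarrow> f v) (at v within ball v d)" by (simp cong: tendsto_cong)
      then show "(f \<longlongrightarrow> f z) (at z within ball v d)" if "z \<in> {v}" for z
        using that by simp
    qed auto
    then show ?thesis using d(1) by (simp add: holomorphic_on_imp_differentiable_at)
  qed
  have f_ell: "elliptic M f"
    unfolding elliptic_def
  proof
    show "f holomorphic_on - M"
      unfolding holomorphic_on_def using f_fd by (auto intro: field_differentiable_at_within)
  qed (use f_per in auto)
  \<comment> \<open>The pole of f at 0 has order 2n and leading coefficient 1: two orders come from
    \<wp>(u|L) and two from each of the n - 1 factors of q. Hence p is monic of degree n.\<close>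
  have f_lim: "((\<lambda>u. u ^ (2 * n) * f u) \<longlongrightarrow> 1) (at 0)"
  proof -
    have "((\<lambda>u. (u ^ 2 * pf L u) * (\<Prod>C\<in>Q. u ^ 2 * pf M u - u ^ 2 * e C)) \<longlongrightarrow> 1 * (\<Prod>C\<in>Q. 1 - 0 ^ 2 * e C)) (at 0)"
      by (intro tendsto_intros pf_tendsto L M)
    then have "((\<lambda>u. (u ^ 2 * pf L u) * (\<Prod>C\<in>Q. u ^ 2 * pf M u - u ^ 2 * e C)) \<longlongrightarrow> 1) (at 0)" by simp
    moreover have "(u ^ 2 * pf L u) * (\<Prod>C\<in>Q. u ^ 2 * pf M u - u ^ 2 * e C) = u ^ (2 * n) * g u" for u
    proof -
      have "(\<Prod>C\<in>Q. u ^ 2 * pf M u - u ^ 2 * e C) = (\<Prod>C\<in>Q. u ^ 2 * (pf M u - e C))"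
        by (simp add: right_diff_distrib)
      also have "\<dots> = (u ^ 2) ^ card Q * poly q (pf M u)"
        by (simp add: prod.distrib q_eval)
      finally show ?thesis
        by (simp add: g_def power_mult power2_eq_square flip: cardQ)
    qed
    ultimately have "((\<lambda>u. u ^ (2 * n) * g u) \<longlongrightarrow> 1) (at 0)" by simp
    moreover have "\<forall>\<^sub>F u in at 0. u ^ (2 * n) * g u = u ^ (2 * n) * f u"
      using lattice_not_in_near_0[OF L] by eventually_elim (simp add: f_def)
    ultimately show ?thesis by (simp cong: tendsto_cong)
  qed
  obtain p where p: "degree p \<le> n" "coeff p n = 1" "\<And>u. u \<notin> M \<Longrightarrow> f u = poly p (pf M u)"
    using elliptic_poly[OF M f_ell f_even f_lim] by blast
  have p_deg: "degree p = n" using p(1,2) le_degree[of p n] by simp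
  \<comment> \<open>A root of q is \<wp>(v|M) for some v in \<open>L - M\<close>, and there p takes
    the value f(v), the nonzero limit found above.\<close>
  have cop: "coprime p q"
  proof (rule coprimeI_no_common_root)
    fix z assume "poly q z = 0"
    then obtain C where C: "C \<in> Q" "z = e C" using fQ by (auto simp: q_eval)
    then obtain v where v: "v \<in> L" "v \<notin> M" "C = (+) v ` M" unfolding Qmem by blast
    have "z = pf M v" using C v eC by simp
    then show "poly p z \<noteq> 0" using p(3)[OF v(2)] flim[OF v(1,2)] by simp
  qed
  have n0: "n > 0" using cardQ by simp
  have "rat_map p q (weierstrass_p M u) = weierstrass_p L u" for u
  proof -
    consider "u \<in> M" | "u \<in> L" "u \<notin> M" | "u \<notin> L" "u \<notin> M" using sub by blast
    then show ?thesis
    proof cases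
      case 1
      have "coeff q n = 0" using q_deg n0 by (intro coeff_eq_0) simp
      moreover have "max (degree p) (degree q) = n" using p_deg q_deg by simp
      moreover have wp: "weierstrass_p M u = Infty" "weierstrass_p L u = Infty" using 1 sub by auto
      ultimately show ?thesis unfolding wp by simp
    next
      case 2
      then have "(+) u ` M \<in> Q" unfolding Qmem by blast
      moreover have "pf M u - e ((+) u ` M) = 0" by (simp add: eC)
      ultimately have "\<exists>C\<in>Q. pf M u - e C = 0" by blast
      then have "poly q (pf M u) = 0" unfolding q_eval by (rule prod_zero[OF fQ])
      then show ?thesis using 2 by (simp add: weierstrass_p_pf)
    next
      case 3
      have "poly q (pf M u) \<noteq> 0"
      proof
        assume "poly q (pf M u) = 0"
        then obtain C where C: "C \<in> Q" "pf M u = e C" using fQ by (auto simp: q_eval)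
        then obtain v where v: "v \<in> L" "v \<notin> M" "C = (+) v ` M" unfolding Qmem by blast
        have "weierstrass_p M u = weierstrass_p M v" using C v eC 3 by (simp add: weierstrass_p_pf)
        then have "u - v \<in> L \<or> u + v \<in> L" using weierstrass_p_eq_iff[OF M] sub by blast
        then show False using 3 v lattice_group(5,6)[OF L, of v u] by auto
      qed
      moreover have "poly p (pf M u) = pf L u * poly q (pf M u)"
        using p(3)[OF 3(2)] 3 by (simp add: f_def g_def)
      ultimately show ?thesis using 3 by (simp add: weierstrass_p_pf)
    qed
  qed
  moreover have "rational_of_degree n (rat_map p q)"
    unfolding rational_of_degree_def using cop p_deg q_deg by (intro exI[of _ p] exI[of _ q]) auto
  ultimately show ?thesis unfolding is_lattice_fraction_def n_def by blast
qed

lemma lattice_fraction_ex1: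
  assumes L: "rank_two_lattice L" and M: "rank_two_lattice M" and sub: "M \<subseteq> L"
  shows "\<exists>!R. is_lattice_fraction L M R"
proof (rule ex_ex1I)
  show "\<exists>R. is_lattice_fraction L M R" by (rule lattice_fraction_exists[OF assms])
  fix R R' assume "is_lattice_fraction L M R" "is_lattice_fraction L M R'"
  then have eq: "R (weierstrass_p M u) = R' (weierstrass_p M u)" for u
    by (simp add: is_lattice_fraction_def)
  show "R = R'"
  proof
    fix x
    obtain u where "weierstrass_p M u = x" using weierstrass_p_surj[OF M] by blast
    then show "R x = R' x" using eq[of u] by simp
  qed
qed

lemma lattice_fraction:
  assumes "rank_two_lattice L" "rank_two_lattice M" "M \<subseteq> L"
  shows "rational (lattice_fraction L M)" "lattice_fraction L M (weierstrass_p M u) = weierstrass_p L u"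
    "rational_of_degree (lattice_index L M) (lattice_fraction L M)"
proof -
  have "is_lattice_fraction L M (lattice_fraction L M)"
    unfolding lattice_fraction_def by (rule theI'[OF lattice_fraction_ex1[OF assms]])
  then show "lattice_fraction L M (weierstrass_p M u) = weierstrass_p L u"
    and r: "rational_of_degree (lattice_index L M) (lattice_fraction L M)"
    by (auto simp: is_lattice_fraction_def)
  show "rational (lattice_fraction L M)"
    using r lattice_index_pos[OF assms] unfolding rational_of_degree_def rational_def by metis
qed

text \<open>As \<wp>(u|M) takes every value, the functional equation alone determines a map of the
  sphere.\<close>

lemma lattice_fraction_eqI:
  assumes "rank_two_lattice L" "rank_two_lattice M" "M \<subseteq> L"
    and eq: "\<And>u. R (weierstrass_p M u) = weierstrass_p L u"
  shows "lattice_fraction L M = R"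
proof
  fix x
  obtain u where "weierstrass_p M u = x" using weierstrass_p_surj[OF assms(2)] by blast
  then show "lattice_fraction L M x = R x" using eq[of u] lattice_fraction(2)[OF assms(1-3), of u] by simp
qed

lemma lattice_fraction_local_degree:
  assumes L: "rank_two_lattice L" and M: "rank_two_lattice M" and sub: "M \<subseteq> L"
  shows "local_degree (lattice_fraction L M) (weierstrass_p M u) = (if 2 * u \<in> L \<and> 2 * u \<notin> M then 2 else 1)"
proof -
  have "germ_degree (weierstrass_p L) u = local_degree (lattice_fraction L M) (weierstrass_p M u) * germ_degree (weierstrass_p M) u"
    using germ_degree_comp[OF lattice_fraction(1)[OF assms] gsolD(4,5)[OF wcubic[OF M]], of u]
    by (simp add: lattice_fraction(2)[OF assms])
  then show ?thesis
    using sub by (auto simp: weierstrass_p_germ_degree[OF L] weierstrass_p_germ_degree[OF M] split: if_splits)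
qed

section \<open>Critical values of lattice fractions\<close>

lemma cubic_branch_card:
  assumes "cubic f"
  shows "finite (branch f)" "card (branch f) = 4"
proof -
  have f0: "f \<noteq> 0" using assms by (auto simp: cubic_def)
  have ord: "order z f = 1" if "poly f z = 0" for z
  proof -
    have "order z f > 0" using that f0 by (simp add: order_gt_0_iff)
    moreover have "pderiv f \<noteq> 0" using that assms by (auto simp: cubic_def)
    ultimately have "order z f = Suc (order z (pderiv f))" by (intro order_pderiv) (use that in auto)
    moreover have "order z (pderiv f) = 0" using that assms by (auto simp: cubic_def order_root)
    ultimately show ?thesis by simp
  qed
  have "size (proots f) = 3" using assms by (simp add: cubic_def size_proots_complex)
  moreover have "size (proots f) = (\<Sum>z\<in>{z. poly f z = 0}. order z f)"
    using f0 by (simp add: size_multiset_overloaded_eq)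
  ultimately have "card {z. poly f z = 0} = 3" using ord by simp
  moreover have "finite {z. poly f z = 0}" using poly_roots_finite[OF f0] .
  ultimately show "finite (branch f)" "card (branch f) = 4"
    unfolding branch_def by (auto simp: card_insert_if card_image inj_on_def)
qed

lemma lattice_fraction_critical_values:
  assumes "rank_two_lattice L" "rank_two_lattice M" "M \<subseteq> L"
  shows "lattice_fraction L M ` critical_points (lattice_fraction L M) = {weierstrass_p L u | u. 2 * u \<in> L \<and> 2 * u \<notin> M}"
    (is "?l = ?r")
proof
  show "?l \<subseteq> ?r"
  proof
    fix y assume "y \<in> ?l"
    then obtain x where x: "local_degree (lattice_fraction L M) x > 1" "y = lattice_fraction L M x"
      by (auto simp: critical_points_def)
    obtain u where u: "weierstrass_p M u = x" using weierstrass_p_surj[OF assms(2)] by blast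
    then show "y \<in> ?r"
      using x lattice_fraction_local_degree[OF assms, of u] lattice_fraction(2)[OF assms, of u]
      by (auto split: if_splits)
  qed
  show "?r \<subseteq> ?l"
  proof
    fix y assume "y \<in> ?r"
    then obtain u where u: "y = weierstrass_p L u" "2 * u \<in> L" "2 * u \<notin> M" by blast
    have "weierstrass_p M u \<in> critical_points (lattice_fraction L M)"
      using lattice_fraction_local_degree[OF assms, of u] u by (simp add: critical_points_def)
    moreover have "y = lattice_fraction L M (weierstrass_p M u)" using lattice_fraction(2)[OF assms] u by simp
    ultimately show "y \<in> ?l" by blast
  qed
qed

text \<open>A half period u of \<open>L\<close> with 2u in \<open>M\<close> is not critical itself,
  but for v in \<open>L\<close> with 2v outside \<open>M\<close> the point u + v has the same value
  \<wp>(u|L) and 2(u + v) lies outside \<open>M\<close>. Conversely, if all four branch points are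
  critical values, so is infinity, and it comes from a point of \<open>L\<close>.\<close>

lemma lattice_fraction_twisted_iff:
  assumes L: "rank_two_lattice L" and M: "rank_two_lattice M" and sub: "M \<subseteq> L"
  shows "twisted_zolotarev (lattice_fraction L M) \<longleftrightarrow> (\<exists>v\<in>L. 2 * v \<notin> M)"
    and "(\<exists>v\<in>L. 2 * v \<notin> M) \<Longrightarrow>
      lattice_fraction L M ` critical_points (lattice_fraction L M) = branch (wcubic L)"
proof -
  let ?R = "lattice_fraction L M"
  note cv = lattice_fraction_critical_values[OF assms]
  note cb = cubic_branch_card[OF gsolD(1)[OF wcubic[OF L]]]
  have subset: "?R ` critical_points ?R \<subseteq> branch (wcubic L)"
    unfolding cv using weierstrass_p_branch_iff[OF L] by auto
  show eq: "?R ` critical_points ?R = branch (wcubic L)" if ex: "\<exists>v\<in>L. 2 * v \<notin> M"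
  proof (rule subset_antisym[OF subset])
    obtain v where v: "v \<in> L" "2 * v \<notin> M" using ex by blast
    show "branch (wcubic L) \<subseteq> ?R ` critical_points ?R"
    proof
      fix x assume x: "x \<in> branch (wcubic L)"
      obtain u where u: "weierstrass_p L u = x" using weierstrass_p_surj[OF L] by blast
      have u2: "2 * u \<in> L" using weierstrass_p_branch_iff[OF L, of u] x u by simp
      show "x \<in> ?R ` critical_points ?R"
      proof (cases "2 * u \<in> M")
        case False
        then show ?thesis unfolding cv using u u2 by blast
      next
        case True
        have "2 * (u + v) = 2 * v + 2 * u" by simp
        then have "2 * (u + v) \<notin> M" using v(2) lattice_group(5)[OF M True, of "2 * v"] by (simp only:) simp
        moreover have "2 * (u + v) = 2 * u + (v + v)" by simp
        then have "2 * (u + v) \<in> L" using u2 v(1) lattice_group(2)[OF L] by metis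
        moreover have "weierstrass_p L (u + v) = x" using weierstrass_p_periodic[OF L v(1)] u by simp
        ultimately show ?thesis unfolding cv by blast
      qed
    qed
  qed
  have deg: "\<forall>x\<in>critical_points ?R. local_degree ?R x = 2"
  proof
    fix x assume "x \<in> critical_points ?R"
    moreover obtain u where "weierstrass_p M u = x" using weierstrass_p_surj[OF M] by blast
    ultimately show "local_degree ?R x = 2"
      using lattice_fraction_local_degree[OF assms, of u] by (auto simp: critical_points_def split: if_splits)
  qed
  show "twisted_zolotarev ?R \<longleftrightarrow> (\<exists>v\<in>L. 2 * v \<notin> M)"
  proof
    assume "\<exists>v\<in>L. 2 * v \<notin> M"
    then show "twisted_zolotarev ?R"
      unfolding twisted_zolotarev_def using eq cb deg lattice_fraction(3)[OF assms] by auto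
  next
    assume "twisted_zolotarev ?R"
    then have "card (?R ` critical_points ?R) = card (branch (wcubic L))"
      using cb by (simp add: twisted_zolotarev_def)
    then have "?R ` critical_points ?R = branch (wcubic L)"
      using card_subset_eq[OF cb(1) subset] by simp
    then have "Infty \<in> ?R ` critical_points ?R" by simp
    then obtain u where u: "Infty = weierstrass_p L u" "2 * u \<notin> M" unfolding cv by blast
    then have "u \<in> L" using weierstrass_p_Infty_iff[of L u] by simp
    with u show "\<exists>v\<in>L. 2 * v \<notin> M" by blast
  qed
qed

section \<open>Sublattices between 2L and L\<close>

text \<open>Sublattices containing 2L correspond to subgroups of L/2L, a group with the four
  representatives 0, w1, w2 and w1 + w2. Their index is 1, 2 or 4, and index 4 means that no nonzero
  representative lies in \<open>M\<close>, that is, M = 2L.\<close>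

lemma double_sublattice_iff:
  assumes L: "rank_two_lattice L" and M: "rank_two_lattice M" and sub: "M \<subseteq> L"
  shows "(\<forall>v\<in>L. 2 * v \<in> M) \<longleftrightarrow> lattice_index L M = 1 \<or> lattice_index L M = 2 \<or> M = (*) 2 ` L"
proof
  assume "lattice_index L M = 1 \<or> lattice_index L M = 2 \<or> M = (*) 2 ` L"
  then show "\<forall>v\<in>L. 2 * v \<in> M"
  proof (elim disjE)
    assume "M = (*) 2 ` L"
    then show ?thesis by blast
  next
    assume "lattice_index L M = 1"
    then have "card (cosets L M) = 1" by (simp add: lattice_index_def)
    then obtain C where C: "cosets L M = {C}" by (rule card_1_singletonE)
    show ?thesis
    proof
      fix v assume "v \<in> L"
      then have "(+) v ` M = (+) 0 ` M" using C lattice_group(1)[OF L] by (metis imageI singletonD)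
      then have "v \<in> M" using coset_eq_iff[OF M, of v 0] by simp
      then show "2 * v \<in> M" using lattice_group(2)[OF M, of v v] by simp
    qed
  next
    assume "lattice_index L M = 2"
    then obtain C D where CD: "cosets L M = {C, D}" unfolding lattice_index_def card_2_iff by auto
    show ?thesis
    proof
      fix v assume v: "v \<in> L"
      \<comment> \<open>There are only two cosets, so two of those of 0, v and 2v coincide, and each
        coincidence puts v or 2v into \<open>M\<close>.\<close>
      have v2: "2 * v \<in> L" using lattice_group(2)[OF L v v] by simp
      have "(+) v ` M \<in> {C, D}" "(+) 0 ` M \<in> {C, D}" "(+) (2 * v) ` M \<in> {C, D}"
        using v v2 lattice_group(1)[OF L] by (auto simp only: CD[symmetric])
      then have "(+) v ` M = (+) 0 ` M \<or> (+) (2 * v) ` M = (+) 0 ` M \<or> (+) (2 * v) ` M = (+) v ` M" by auto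
      then have "v \<in> M \<or> 2 * v \<in> M"
        using coset_eq_iff[OF M, of v 0] coset_eq_iff[OF M, of "2 * v" 0] coset_eq_iff[OF M, of "2 * v" v] by auto
      then show "2 * v \<in> M" using lattice_group(2)[OF M, of v v] by auto
    qed
  qed
next
  assume dbl: "\<forall>v\<in>L. 2 * v \<in> M"
  obtain w1 w2 where W: "L = lat w1 w2" using L rank_two_lattice_iff by blast
  have w: "w1 \<in> L" "w2 \<in> L" unfolding W by (rule lat_group)+
  have decomp: "\<exists>a b. a \<in> {0, 1 :: int} \<and> b \<in> {0, 1 :: int} \<and> (\<exists>z\<in>L. v = of_int a * w1 + of_int b * w2 + 2 * z)"
    if v: "v \<in> L" for v
  proof -
    obtain m n where mn: "v = of_int m * w1 + of_int n * w2" using v unfolding W lat_def by blast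
    have m: "(of_int m :: complex) = of_int (m mod 2) + 2 * of_int (m div 2)" for m :: int
      by (metis mod_mult_div_eq of_int_add of_int_mult of_int_numeral)
    have "v = of_int (m mod 2) * w1 + of_int (n mod 2) * w2 + 2 * (of_int (m div 2) * w1 + of_int (n div 2) * w2)"
      unfolding mn by (subst m[of m], subst m[of n]) (simp add: algebra_simps)
    moreover have "of_int (m div 2) * w1 + of_int (n div 2) * w2 \<in> L" unfolding W lat_def by blast
    moreover have "m mod 2 \<in> {0, 1}" "n mod 2 \<in> {0, 1}" by auto
    ultimately show ?thesis
      by (intro exI[of _ "m mod 2"] exI[of _ "n mod 2"] conjI bexI[of _ "of_int (m div 2) * w1 + of_int (n div 2) * w2"])
  qed
  have two_cosets: "lattice_index L M \<in> {1, 2}"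
    if c: "\<And>v. v \<in> L \<Longrightarrow> v \<in> M \<or> v - c \<in> M" and cL: "c \<in> L" for c
  proof -
    have "cosets L M = {(+) 0 ` M, (+) c ` M}"
    proof
      show "cosets L M \<subseteq> {(+) 0 ` M, (+) c ` M}"
      proof
        fix C assume "C \<in> cosets L M"
        then obtain v where "v \<in> L" "C = (+) v ` M" by blast
        then show "C \<in> {(+) 0 ` M, (+) c ` M}"
          using c[of v] coset_eq_iff[OF M, of v 0] coset_eq_iff[OF M, of v c] by auto
      qed
      show "{(+) 0 ` M, (+) c ` M} \<subseteq> cosets L M" using cL lattice_group(1)[OF L] by blast
    qed
    then show ?thesis unfolding lattice_index_def by (simp add: card_insert_if)
  qed
  have reduce: "of_int a * w1 + of_int b * w2 + 2 * z - c \<in> M \<longleftrightarrow> of_int a * w1 + of_int b * w2 - c \<in> M"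
    if "z \<in> L" for a b z c
  proof -
    have "of_int a * w1 + of_int b * w2 + 2 * z - c = (of_int a * w1 + of_int b * w2 - c) + 2 * z" by simp
    then show ?thesis using lattice_group(5)[OF M, of "2 * z"] dbl that by metis
  qed
  show "lattice_index L M = 1 \<or> lattice_index L M = 2 \<or> M = (*) 2 ` L"
  proof (cases "w1 \<in> M \<or> w2 \<in> M \<or> w1 + w2 \<in> M")
    case True
    have "\<exists>c\<in>L. \<forall>v\<in>L. v \<in> M \<or> v - c \<in> M"
    proof -
      have M0: "0 \<in> M" by (rule lattice_group(1)[OF M])
      have *: "\<forall>v\<in>L. v \<in> M \<or> v - c \<in> M"
        if H: "\<And>a b. a \<in> {0, 1 :: int} \<Longrightarrow> b \<in> {0, 1 :: int} \<Longrightarrow>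
          of_int a * w1 + of_int b * w2 \<in> M \<or> of_int a * w1 + of_int b * w2 - c \<in> M" for c
      proof
        fix v assume "v \<in> L"
        then obtain a b z where "a \<in> {0, 1 :: int}" "b \<in> {0, 1 :: int}" "z \<in> L"
          "v = of_int a * w1 + of_int b * w2 + 2 * z" using decomp by blast
        then show "v \<in> M \<or> v - c \<in> M" using H[of a b] reduce[of z a b c] reduce[of z a b 0] by auto
      qed
      show ?thesis
      proof (cases "w1 \<in> M")
        case True
        have "\<forall>v\<in>L. v \<in> M \<or> v - w2 \<in> M" by (rule *) (use True M0 in auto)
        then show ?thesis using w by blast
      next
        case False
        show ?thesis
        proof (cases "w2 \<in> M")
          case True
          have "\<forall>v\<in>L. v \<in> M \<or> v - w1 \<in> M" by (rule *) (use True M0 in auto)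
          then show ?thesis using w by blast
        next
          case F2: False
          then have s: "w1 + w2 \<in> M" using \<open>w1 \<notin> M\<close> \<open>w1 \<in> M \<or> w2 \<in> M \<or> w1 + w2 \<in> M\<close> by blast
          have "w2 - w1 = (w1 + w2) - 2 * w1" by simp
          then have "w2 - w1 \<in> M" using lattice_group(3)[OF M s, of "2 * w1"] dbl w by metis
          then have "\<forall>v\<in>L. v \<in> M \<or> v - w1 \<in> M" by (intro *) (use s M0 in auto)
          then show ?thesis using w by blast
        qed
      qed
    qed
    then show ?thesis using two_cosets by blast
  next
    case False
    have "v \<in> (*) 2 ` L" if v: "v \<in> M" for v
    proof -
      have "v \<in> L" using v sub by blast
      then obtain a b z where abz: "a \<in> {0, 1 :: int}" "b \<in> {0, 1 :: int}" "z \<in> L"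
          "v = of_int a * w1 + of_int b * w2 + 2 * z" using decomp by blast
      then have "of_int a * w1 + of_int b * w2 \<in> M" using v reduce[of z a b 0] by simp
      then have "a = 0 \<and> b = 0" using abz(1,2) False by auto
      then show ?thesis using abz by auto
    qed
    then have "M = (*) 2 ` L" using dbl by blast
    then show ?thesis by blast
  qed
qed

lemma lattice_pairs_iff:
  "(L, M) \<in> lattice_pairs \<longleftrightarrow> rank_two_lattice L \<and> rank_two_lattice M \<and> M \<subseteq> L \<and> (\<exists>v\<in>L. 2 * v \<notin> M)"
  using double_sublattice_iff[of L M] unfolding lattice_pairs_def by auto

section \<open>The poles of a global solution form a lattice\<close>

lemma discrete_minimal:
  fixes S :: "complex set"
  assumes d: "d > 0" "\<And>x y. x \<in> S \<Longrightarrow> y \<in> S \<Longrightarrow> x \<noteq> y \<Longrightarrow> d \<le> cmod (x - y)" and ne: "S \<noteq> {}"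
  obtains w where "w \<in> S" "\<And>v. v \<in> S \<Longrightarrow> cmod w \<le> cmod v"
proof -
  obtain v0 where v0: "v0 \<in> S" using ne by blast
  define T where "T = S \<inter> cball 0 (cmod v0)"
  have "uniform_discrete T"
    unfolding uniform_discrete_def T_def using d by (intro exI[of _ d]) (force simp: dist_norm)
  moreover have "bounded T" unfolding T_def by (rule bounded_subset[of "cball 0 (cmod v0)"]) auto
  ultimately have fin: "finite T" using uniform_discrete_finite_iff by blast
  have neT: "T \<noteq> {}" using v0 unfolding T_def by auto
  obtain w where w: "w \<in> T" "\<And>v. v \<in> T \<Longrightarrow> cmod w \<le> cmod v"
    using ex_is_arg_min_if_finite[OF fin neT, of cmod] unfolding is_arg_min_linorder by blast
  have "cmod w \<le> cmod v" if "v \<in> S" for v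
  proof (cases "cmod v \<le> cmod v0")
    case True
    then show ?thesis using w(2)[of v] that by (auto simp: T_def)
  next
    case False
    then show ?thesis using w(2)[of v0] v0 by (auto simp: T_def)
  qed
  then show thesis using that w(1) unfolding T_def by blast
qed

lemma round_diff_le: "\<bar>x - of_int (round x)\<bar> \<le> 1 / (2 :: real)"
  using of_int_round_abs_le[of x] by (simp add: abs_minus_commute)

lemma group_int_mult:
  assumes "0 \<in> L" "\<And>a b. a \<in> L \<Longrightarrow> b \<in> L \<Longrightarrow> a - b \<in> L" "w \<in> L"
  shows "of_int m * w \<in> (L :: complex set)"
proof (induction m rule: int_induct[of _ 0])
  case (step1 i)
  have "0 - w \<in> L" using assms by blast
  then have "of_int i * w - (0 - w) \<in> L" using step1 assms by blast
  then show ?case by (simp add: algebra_simps)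
next
  case (step2 i)
  then have "of_int i * w - w \<in> L" using assms by blast
  then show ?case by (simp add: algebra_simps)
qed (use assms in simp)

text \<open>Let w1 be a shortest nonzero vector and w2 a shortest one outside the multiples of w1.
  Rounding the two coordinates of any vector of the group leaves a remainder shorter than w2, which
  must therefore be a multiple of w1. The case w = 0 of \<open>ncyc\<close> excludes the trivial
  group.\<close>

lemma discrete_subgroup_lattice:
  assumes grp: "0 \<in> L" "\<And>a b. a \<in> L \<Longrightarrow> b \<in> L \<Longrightarrow> a - b \<in> L"
    and d: "d > 0" "\<And>v. v \<in> L \<Longrightarrow> v \<noteq> 0 \<Longrightarrow> d \<le> cmod v"
    and ncyc: "\<And>w. L \<noteq> range (\<lambda>m. of_int m * w)"
  shows "rank_two_lattice L"
proof -
  have sep: "d \<le> cmod (x - y)" if "x \<in> L" "y \<in> L" "x \<noteq> y" for x y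
    using d(2)[OF grp(2)[OF that(1,2)]] that(3) by simp
  have add: "a + b \<in> L" if "a \<in> L" "b \<in> L" for a b
    using grp(2)[OF that(1) grp(2)[OF grp(1) that(2)]] by simp
  note im = group_int_mult[OF grp]
  have "L - {0} \<noteq> {}"
  proof
    assume "L - {0} = {}"
    then have "L = range (\<lambda>m. of_int m * 0)" using grp(1) by auto
    with ncyc show False by blast
  qed
  then obtain w1 where w1: "w1 \<in> L - {0}" "\<And>v. v \<in> L - {0} \<Longrightarrow> cmod w1 \<le> cmod v"
    using discrete_minimal[OF d(1), of "L - {0}"] sep by (metis DiffD1)
  define Z where "Z = range (\<lambda>m. of_int m * w1)"
  have ZL: "Z \<subseteq> L" unfolding Z_def using im w1 by blast
  have "L - Z \<noteq> {}" using ncyc[of w1] ZL unfolding Z_def by blast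
  then obtain w2 where w2: "w2 \<in> L - Z" "\<And>v. v \<in> L - Z \<Longrightarrow> cmod w2 \<le> cmod v"
    using discrete_minimal[OF d(1), of "L - Z"] sep by (metis DiffD1)
  define D where "D = Im (cnj w1 * w2)"
  \<comment> \<open>If w2 were a real multiple of w1, its remainder modulo w1 would be a nonzero
    vector shorter than w1.\<close>
  have D: "D \<noteq> 0"
  proof
    assume D0: "D = 0"
    define t where "t = Re (cnj w1 * w2) / (cmod w1)\<^sup>2"
    have w2t: "w2 = of_real t * w1"
      unfolding t_def by (rule real_multiple_of_Im_eq_0) (use D0 w1(1) in \<open>auto simp: D_def\<close>)
    define v where "v = w2 - of_int \<lfloor>t\<rfloor> * w1"
    have vL: "v \<in> L" unfolding v_def using w2(1) w1(1) by (intro grp(2) im) auto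
    have "v = of_real (t - of_int \<lfloor>t\<rfloor>) * w1" unfolding v_def w2t by (simp add: algebra_simps)
    then have "cmod v = \<bar>t - of_int \<lfloor>t\<rfloor>\<bar> * cmod w1" by (metis norm_mult norm_of_real)
    also have "\<dots> < 1 * cmod w1"
      using w1(1) by (intro mult_strict_right_mono) (auto, linarith)
    finally have "cmod v < cmod w1" by simp
    then have "v = 0" using w1(2)[of v] vL by force
    then have "w2 \<in> Z" unfolding Z_def v_def by auto
    with w2(1) show False by blast
  qed
  have "L = lat w1 w2"
  proof
    show "lat w1 w2 \<subseteq> L"
      unfolding lat_def using im w1(1) w2(1) add by blast
    show "L \<subseteq> lat w1 w2"
    proof
      fix v assume v: "v \<in> L"
      obtain a b where ab: "v = of_real a * w1 + of_real b * w2"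
        using lat_coords[of w1 w2 v] D unfolding D_def by blast
      define a' where "a' = a - of_int (round a)"
      define b' where "b' = b - of_int (round b)"
      define v' where "v' = v - (of_int (round a) * w1 + of_int (round b) * w2)"
      have "of_int (round a) * w1 \<in> L" "of_int (round b) * w2 \<in> L"
        using im w1(1) w2(1) by auto
      then have v'L: "v' \<in> L" unfolding v'_def by (intro grp(2) add v)
      have v': "v' = of_real a' * w1 + of_real b' * w2"
        unfolding v'_def ab a'_def b'_def by (simp add: algebra_simps)
      have bd: "\<bar>a'\<bar> \<le> 1 / 2" "\<bar>b'\<bar> \<le> 1 / 2" unfolding a'_def b'_def by (rule round_diff_le)+
      define R where "R = Re (cnj w1 * w2)"
      have "0 \<in> Z" unfolding Z_def by (rule range_eqI[of _ _ 0]) simp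
      then have le: "cmod w1 \<le> cmod w2" using w2(1) by (intro w1(2)) auto
      have sq: "R\<^sup>2 + D\<^sup>2 = (cmod w1)\<^sup>2 * (cmod w2)\<^sup>2"
        using cmod_power2[of "cnj w1 * w2"] by (simp add: R_def D_def norm_mult power_mult_distrib)
      have N: "(cmod w1)\<^sup>2 \<le> (cmod w2)\<^sup>2" using le by (intro power_mono) auto
      have "R\<^sup>2 < ((cmod w2)\<^sup>2)\<^sup>2"
      proof -
        have "R\<^sup>2 < (cmod w1)\<^sup>2 * (cmod w2)\<^sup>2" using sq D by (simp flip: sq)
        also have "\<dots> \<le> (cmod w2)\<^sup>2 * (cmod w2)\<^sup>2" using N by (intro mult_right_mono) auto
        finally show ?thesis by (simp add: power2_eq_square)
      qed
      then have Rlt: "\<bar>R\<bar> < (cmod w2)\<^sup>2"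
        by (metis abs_ge_zero power2_abs power2_less_imp_less zero_le_power2)
      \<comment> \<open>The squares contribute at most a quarter of |w2|^2 each and the mixed term
        strictly less than a half, because |R| < |w2|^2.\<close>
      have "(cmod v')\<^sup>2 = a'\<^sup>2 * (cmod w1)\<^sup>2 + b'\<^sup>2 * (cmod w2)\<^sup>2 + 2 * (a' * b' * R)"
        unfolding v' cmod_power2 R_def by (simp add: power2_eq_square algebra_simps)
      also have "\<dots> < (cmod w2)\<^sup>2"
      proof -
        have "a'\<^sup>2 \<le> 1 / 4" "b'\<^sup>2 \<le> 1 / 4"
          using power_mono[OF bd(1), of 2] power_mono[OF bd(2), of 2] by (auto simp: power_divide)
        then have 1: "a'\<^sup>2 * (cmod w1)\<^sup>2 \<le> 1 / 4 * (cmod w2)\<^sup>2" "b'\<^sup>2 * (cmod w2)\<^sup>2 \<le> 1 / 4 * (cmod w2)\<^sup>2"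
          using N by (intro mult_mono; simp)+
        have "\<bar>a' * b'\<bar> \<le> 1 / 2 * (1 / 2)" unfolding abs_mult using bd by (intro mult_mono) auto
        then have "\<bar>a' * b' * R\<bar> \<le> 1 / 4 * \<bar>R\<bar>"
          unfolding abs_mult[of _ R] by (intro mult_right_mono) auto
        with 1 Rlt show ?thesis by linarith
      qed
      finally have "cmod v' < cmod w2" by (simp add: power2_less_imp_less)
      then have "v' \<in> Z" using w2(2)[of v'] v'L by force
      then obtain m where m: "v' = of_int m * w1" unfolding Z_def by blast
      have "v = of_int (m + round a) * w1 + of_int (round b) * w2"
        using m unfolding v'_def by (simp add: algebra_simps)
      then show "v \<in> lat w1 w2" unfolding lat_def by blast
    qed
  qed
  then show ?thesis using D unfolding rank_two_lattice_iff D_def by blast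
qed

lemma analytic_points_holomorphic:
  assumes "\<And>t. t \<in> S \<Longrightarrow> f analytic_on {t}"
  shows "f holomorphic_on S"
  by (rule analytic_imp_holomorphic, subst analytic_on_analytic_at) (use assms in blast)

lemma coprime_linear:
  fixes a b c d :: complex
  assumes "a * d - b * c \<noteq> 0"
  shows "coprime [:b, a:] [:d, c:]"
proof (rule coprimeI_no_common_root)
  fix z assume 1: "poly [:d, c:] z = 0"
  show "poly [:b, a:] z \<noteq> 0"
  proof
    assume 2: "poly [:b, a:] z = 0"
    have "d = - (z * c)" "b = - (z * a)" using 1 2 by (simp_all add: add_eq_0_iff)
    then have "a * d - b * c = 0" by simp
    with assms show False by simp
  qed
qed

lemma gsol_compose:
  assumes F: "gsol f F" and g: "cubic g" and k: "k \<noteq> 0" and pq: "coprime p q" "wronskian p q \<noteq> 0"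
    and id: "\<And>z. k ^ 2 * (poly (wronskian p q) z) ^ 2 * poly f z = hat g (poly p z) (poly q z)"
  shows "gsol g (\<lambda>t. rat_map p q (F (k * t + c)))"
  unfolding gsol_def
proof (intro conjI allI)
  show "sol_at g (\<lambda>t. rat_map p q (F (k * t + c))) a" for a
    by (rule sol_compose[OF gsolD(2)[OF F] _ k gsolD(3)[OF F] pq id])
       (use g in \<open>simp add: cubic_def\<close>)
qed (rule g)

section \<open>The values of a global solution\<close>

text \<open>Together with \<open>gsol_not_omit_ball\<close> this forces any two global solutions to
  have a finite value in common.\<close>

lemma gsol_finite_values_open:
  assumes F: "gsol f F"
  shows "\<exists>c \<epsilon>. \<epsilon> > 0 \<and> (\<forall>y\<in>ball c \<epsilon>. \<exists>t. F t = Pt y)"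
proof -
  have "\<forall>\<^sub>F t in at 0. F t \<noteq> Infty" using gsolD(5)[OF F, of 0] unfolding nonconst_at_def by blast
  then obtain u0 where u0: "F u0 \<noteq> Infty" using eventually_happens[of _ "at (0 :: complex)"] by auto
  define \<phi> where "\<phi> = (\<lambda>t. fin (F t))"
  have an: "\<phi> analytic_on {u0}" and ev: "\<forall>\<^sub>F t in nhds u0. F t \<noteq> Infty"
    unfolding \<phi>_def using hol_at_fin[OF gsolD(4)[OF F] u0] by auto
  obtain S where S: "open S" "u0 \<in> S" "\<phi> holomorphic_on S" using an analytic_at by blast
  obtain T where T: "open T" "u0 \<in> T" "\<And>t. t \<in> T \<Longrightarrow> F t \<noteq> Infty"
    using ev unfolding eventually_nhds by blast
  have "open (S \<inter> T)" "u0 \<in> S \<inter> T" using S T by auto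
  then obtain r where r: "r > 0" "ball u0 r \<subseteq> S \<inter> T" using openE by blast
  have "\<not> \<phi> constant_on ball u0 r"
  proof
    assume "\<phi> constant_on ball u0 r"
    then obtain c where c: "\<And>t. t \<in> ball u0 r \<Longrightarrow> \<phi> t = c" unfolding constant_on_def by blast
    have "F t = Pt c" if "t \<in> ball u0 r" for t
      using c[OF that] T(3)[of t] r(2) that by (cases "F t") (auto simp: \<phi>_def)
    then have "\<forall>\<^sub>F t in nhds u0. F t = Pt c"
      unfolding eventually_nhds using r(1) by (intro exI[of _ "ball u0 r"]) auto
    from eventually_at_of_nhds[OF this] have "\<forall>\<^sub>F t in at u0. F t = Pt c" .
    moreover have "\<forall>\<^sub>F t in at u0. F t \<noteq> Pt c" using gsolD(5)[OF F, of u0] unfolding nonconst_at_def by blast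
    ultimately have "\<forall>\<^sub>F t in at u0. False" by eventually_elim simp
    then show False by simp
  qed
  then have "open (\<phi> ` ball u0 r)"
    by (intro open_mapping_thm[of \<phi> "ball u0 r"]) (use S(3) r(2) in \<open>auto intro: holomorphic_on_subset\<close>)
  moreover have "\<phi> u0 \<in> \<phi> ` ball u0 r" using r(1) by simp
  ultimately obtain \<epsilon> where \<epsilon>: "\<epsilon> > 0" "ball (\<phi> u0) \<epsilon> \<subseteq> \<phi> ` ball u0 r" using openE by blast
  have "\<exists>t. F t = Pt y" if y: "y \<in> ball (\<phi> u0) \<epsilon>" for y
  proof -
    obtain t where t: "t \<in> ball u0 r" "y = \<phi> t" using y \<epsilon>(2) by blast
    then have "F t = Pt y" using T(3)[of t] r(2) by (cases "F t") (auto simp: \<phi>_def)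
    then show ?thesis by blast
  qed
  with \<epsilon>(1) show ?thesis by blast
qed

text \<open>If \<open>F\<close> avoided the disc, 1/(F - c) would be entire and bounded, with zeros
  at the poles of \<open>F\<close>. By Liouville it would be constant, and then so would
  \<open>F\<close>.\<close>

lemma gsol_not_omit_ball:
  assumes F: "gsol f F" and \<epsilon>: "\<epsilon> > 0"
  shows "\<exists>t. \<exists>y\<in>ball c \<epsilon>. F t = Pt y"
proof (rule ccontr)
  assume no: "\<not> ?thesis"
  define G where "G = (\<lambda>t. rat_map [:1, 0:] [:- c, 1:] (F t))"
  have cop: "coprime [:1, 0:] [:- c, 1:]" using coprime_linear[of 0 "- c" 1 1] by simp
  have hol: "hol_at G t" for t
    unfolding G_def by (rule hol_at_rat_map[OF gsolD(4)[OF F] cop])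
  have val: "G t \<noteq> Infty \<and> cmod (fin (G t)) \<le> 1 / \<epsilon>" for t
  proof (cases "F t")
    case Infty
    then show ?thesis using \<epsilon> by (simp add: G_def)
  next
    case (Pt z)
    then have "z \<notin> ball c \<epsilon>" using no by blast
    then have z: "\<epsilon> \<le> cmod (z - c)" by (simp add: dist_norm norm_minus_commute)
    then have "z \<noteq> c" using \<epsilon> by auto
    moreover have "1 / cmod (z - c) \<le> 1 / \<epsilon>" using z \<epsilon> by (simp add: frac_le)
    ultimately show ?thesis by (simp add: G_def Pt norm_divide)
  qed
  have "(\<lambda>t. fin (G t)) holomorphic_on UNIV"
    by (rule analytic_points_holomorphic, rule hol_at_fin(1)[OF hol]) (use val in blast)
  moreover have "bounded (range (\<lambda>t. fin (G t)))" using val by (auto simp: bounded_iff)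
  ultimately have "(\<lambda>t. fin (G t)) constant_on UNIV" by (rule Liouville_theorem)
  then obtain b where b: "\<And>t. fin (G t) = b" unfolding constant_on_def by auto
  have Gb: "G t = Pt b" for t using val[of t] b[of t] by (cases "G t") auto
  have fin: "finite {x. rat_map [:1, 0:] [:- c, 1:] x = Pt b}"
  proof (rule rational_fiber_finite, unfold rational_def, intro exI conjI)
    show "coprime [:1, 0:] [:- c, 1:]" by (rule cop)
  qed auto
  have "\<forall>\<^sub>F t in at 0. F t \<notin> {x. rat_map [:1, 0:] [:- c, 1:] x = Pt b}"
    by (rule nonconst_avoid_finite[OF gsolD(5)[OF F] fin])
  moreover have "\<forall>t. F t \<in> {x. rat_map [:1, 0:] [:- c, 1:] x = Pt b}" using Gb by (simp add: G_def)
  ultimately show False by simp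
qed

text \<open>The Moebius map \<open>z \<mapsto> e + \<delta> / (z - e)\<close> with \<open>\<delta> = f'(e) / coeff f 3\<close> permutes the branch
  points and preserves the differential equation: it is the translation by a half period.\<close>

lemma gsol_attains_root:
  assumes F: "gsol f F" "F 0 = Infty" and e: "poly f e = 0"
  shows "\<exists>u. F u = Pt e"
proof -
  define c0 c1 c2 c3 where "c0 = coeff f 0" and "c1 = coeff f 1" and "c2 = coeff f 2" and "c3 = coeff f 3"
  have d3: "degree f = 3" by (rule gsolD(2)[OF F(1)])
  have c3: "c3 \<noteq> 0" using d3 unfolding c3_def by (metis degree_0 leading_coeff_0_iff zero_neq_numeral)
  have fz: "poly f z = c0 + c1 * z + c2 * z ^ 2 + c3 * z ^ 3" for z
    using cubic_poly_eq[OF d3] by (simp add: c0_def c1_def c2_def c3_def)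
  have f'e: "poly (pderiv f) e \<noteq> 0" using gsolD(1)[OF F(1)] e by (simp add: cubic_def)
  have "(poly f has_field_derivative poly (pderiv f) e) (at e)" by (rule poly_DERIV)
  moreover have "(poly f has_field_derivative c1 + 2 * c2 * e + 3 * c3 * e ^ 2) (at e)"
    unfolding fz[abs_def] by (auto intro!: derivative_eq_intros simp: power2_eq_square)
  ultimately have f'e': "poly (pderiv f) e = c1 + 2 * c2 * e + 3 * c3 * e ^ 2" by (rule DERIV_unique)
  define \<delta> where "\<delta> = (c1 + 2 * c2 * e + 3 * c3 * e ^ 2) / c3"
  have \<delta>: "\<delta> \<noteq> 0" "\<delta> * c3 = c1 + 2 * c2 * e + 3 * c3 * e ^ 2"
    unfolding \<delta>_def using f'e f'e' c3 by auto
  define p where "p = [:\<delta> - e ^ 2, e:]"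
  define q where "q = [:- e, 1:]"
  have W: "wronskian p q = [:- \<delta>:]"
    by (simp add: wronskian_def p_def q_def pderiv_pCons power2_eq_square)
  have cop: "coprime p q"
    unfolding p_def q_def by (rule coprime_linear) (use \<delta>(1) in \<open>simp add: power2_eq_square\<close>)
  have id: "1 ^ 2 * (poly (wronskian p q) z) ^ 2 * poly f z = hat f (poly p z) (poly q z)" for z
  proof -
    define s where "s = z - e"
    have z: "z = e + s" by (simp add: s_def)
    have P: "poly p z = e * s + \<delta>" "poly q z = s" by (simp_all add: p_def q_def z algebra_simps power2_eq_square)
    have f0: "c0 + c1 * e + c2 * e ^ 2 + c3 * e ^ 3 = 0" using e fz by simp
    \<comment> \<open>Taylor expansion at e: f(e) = 0 removes the constant term and the linear
      coefficient is \<delta> c3, after which both sides agree as polynomials in s.\<close>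
    have E: "(\<delta>) ^ 2 * (c0 + c1 * (e + s) + c2 * (e + s) ^ 2 + c3 * (e + s) ^ 3)
        = s * (c3 * (e * s + \<delta>) ^ 3 + c2 * (e * s + \<delta>) ^ 2 * s + c1 * (e * s + \<delta>) * s ^ 2 + c0 * s ^ 3)"
    proof -
      have "c0 + c1 * (e + s) + c2 * (e + s) ^ 2 + c3 * (e + s) ^ 3 =
          (c0 + c1 * e + c2 * e ^ 2 + c3 * e ^ 3) + s * (c1 + 2 * c2 * e + 3 * c3 * e ^ 2)
            + s ^ 2 * (c2 + 3 * c3 * e) + c3 * s ^ 3"
        by (simp add: algebra_simps power2_eq_square power3_eq_cube)
      also have "\<dots> = s * (\<delta> * c3) + s ^ 2 * (c2 + 3 * c3 * e) + c3 * s ^ 3"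
        unfolding f0 \<delta>(2) by simp
      finally have 1: "c0 + c1 * (e + s) + c2 * (e + s) ^ 2 + c3 * (e + s) ^ 3 =
          s * (\<delta> * c3) + s ^ 2 * (c2 + 3 * c3 * e) + c3 * s ^ 3" .
      have "c3 * (e * s + \<delta>) ^ 3 + c2 * (e * s + \<delta>) ^ 2 * s + c1 * (e * s + \<delta>) * s ^ 2 + c0 * s ^ 3 =
          s ^ 3 * (c0 + c1 * e + c2 * e ^ 2 + c3 * e ^ 3) + s ^ 2 * \<delta> * (c1 + 2 * c2 * e + 3 * c3 * e ^ 2)
            + s * \<delta> ^ 2 * (c2 + 3 * c3 * e) + c3 * \<delta> ^ 3"
        by (simp add: algebra_simps power2_eq_square power3_eq_cube)
      also have "\<dots> = s ^ 2 * \<delta> * (\<delta> * c3) + s * \<delta> ^ 2 * (c2 + 3 * c3 * e) + c3 * \<delta> ^ 3"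
        unfolding f0 \<delta>(2) by simp
      finally have 2: "c3 * (e * s + \<delta>) ^ 3 + c2 * (e * s + \<delta>) ^ 2 * s + c1 * (e * s + \<delta>) * s ^ 2 + c0 * s ^ 3 =
          s ^ 2 * \<delta> * (\<delta> * c3) + s * \<delta> ^ 2 * (c2 + 3 * c3 * e) + c3 * \<delta> ^ 3" .
      show ?thesis unfolding 1 2 by (simp add: algebra_simps power2_eq_square power3_eq_cube)
    qed
    show ?thesis
      unfolding W hat_def P fz using E by (simp add: z c0_def c1_def c2_def c3_def)
  qed
  define G where "G = (\<lambda>t. rat_map p q (F (1 * t + 0)))"
  have G: "gsol f G"
    unfolding G_def by (rule gsol_compose[OF F(1) gsolD(1)[OF F(1)] _ cop _ id]) (use W \<delta>(1) in auto)
  have G0: "G 0 = Pt e" using F(2) by (simp add: G_def p_def q_def Let_def)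
  obtain c \<epsilon> where c: "\<epsilon> > 0" "\<And>y. y \<in> ball c \<epsilon> \<Longrightarrow> \<exists>t. G t = Pt y"
    using gsol_finite_values_open[OF G] by blast
  \<comment> \<open>A common value makes one of the two solutions a translate or a reflection of the
    other. Since \<open>G\<close> takes the value e at 0, \<open>F\<close> takes it as well.\<close>
  obtain u y where u: "y \<in> ball c \<epsilon>" "F u = Pt y" using gsol_not_omit_ball[OF F(1) c(1)] by blast
  obtain t where t: "G t = Pt y" using c(2)[OF u(1)] by blast
  have "F u = G t" using u t by simp
  from gsol_unique[OF F(1) G this] show ?thesis
  proof
    assume "\<forall>s. F (u + s) = G (t + s)"
    from this[rule_format, of "- t"] show ?thesis using G0 by auto
  next
    assume "\<forall>s. F (u + s) = G (t - s)"
    from this[rule_format, of t] show ?thesis using G0 by auto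
  qed
qed

lemma gsol_poles_discrete:
  assumes "gsol f F"
  obtains d where "d > 0" "\<And>v. F v = Infty \<Longrightarrow> v \<noteq> 0 \<Longrightarrow> d \<le> cmod v"
proof -
  have "\<forall>\<^sub>F t in at 0. F t \<noteq> Infty" using gsolD(5)[OF assms, of 0] unfolding nonconst_at_def by blast
  then obtain d where d: "d > 0" "\<And>t. t \<noteq> 0 \<Longrightarrow> dist t 0 < d \<Longrightarrow> F t \<noteq> Infty"
    unfolding eventually_at by blast
  show thesis
  proof (rule that[OF d(1)])
    fix v assume "F v = Infty" "v \<noteq> 0"
    then show "d \<le> cmod v" using d(2)[of v] by (auto simp: not_less[symmetric])
  qed
qed

text \<open>Two distinct roots of \<open>f\<close> are attained at points u and v, and 2u and 2v are
  poles. In a cyclic group with generator w these would be odd multiples of w, so u - v would be a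
  multiple of w and the two values would be equal.\<close>

lemma gsol_poles_lattice:
  assumes F: "gsol f F" "F 0 = Infty"
  shows "rank_two_lattice {u. F u = Infty}" (is "rank_two_lattice ?L")
proof -
  obtain d where d: "d > 0" "\<And>v. F v = Infty \<Longrightarrow> v \<noteq> 0 \<Longrightarrow> d \<le> cmod v"
    by (rule gsol_poles_discrete[OF F(1)]) blast
  have grp: "a - b \<in> ?L" if "a \<in> ?L" "b \<in> ?L" for a b
    using gsol_poles_group[OF F] that by simp
  have z: "0 \<in> ?L" using F(2) by simp
  show ?thesis
  proof (rule discrete_subgroup_lattice[OF z grp d(1)])
    fix w
    show "?L \<noteq> range (\<lambda>m. of_int m * w)"
    proof
      assume cyc: "?L = range (\<lambda>m. of_int m * w)"
      have br: "card (branch f) = 4" "finite (branch f)" by (rule cubic_branch_card[OF gsolD(1)[OF F(1)]])+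
      then have "card (branch f - {Infty}) = 3" by simp
      then obtain x y where xy: "x \<in> branch f - {Infty}" "y \<in> branch f - {Infty}" "x \<noteq> y"
        by (metis card_3_iff insertI1 insertI2)
      have att: "\<exists>u. F u = x" if "x \<in> branch f - {Infty}" for x
        using that gsol_attains_root[OF F] by (auto simp: branch_def)
      obtain u v where uv: "F u = x" "F v = y" using att xy by blast
      have "2 * u \<in> ?L" "2 * v \<in> ?L" using gsol_branch_iff[OF F] uv xy by auto
      then obtain m n where mn: "2 * u = of_int m * w" "2 * v = of_int n * w" unfolding cyc by blast
      have "u \<notin> ?L" "v \<notin> ?L" "u - v \<notin> ?L" using uv xy gsol_eq_iff[OF F, of u v] by auto
      moreover have "of_int k * w \<in> ?L" for k unfolding cyc by blast
      ultimately have ne: "u \<noteq> of_int k * w" "v \<noteq> of_int k * w" "u - v \<noteq> of_int k * w" for k by metis+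
      have odd: "odd m" "odd n"
      proof -
        show "odd m"
        proof
          assume "even m"
          then obtain k where "m = 2 * k" by blast
          then have "u = of_int k * w" using mn(1) by simp
          with ne show False by blast
        qed
        show "odd n"
        proof
          assume "even n"
          then obtain k where "n = 2 * k" by blast
          then have "v = of_int k * w" using mn(2) by simp
          with ne show False by blast
        qed
      qed
      then have "even (m - n)" by simp
      then obtain k where "m - n = 2 * k" by blast
      then have "m = n + 2 * k" by simp
      then have "2 * (u - v) = 2 * (of_int k * w)" using mn by (simp add: algebra_simps)
      then have "u - v = of_int k * w" by (metis mult_cancel_left zero_neq_numeral)
      with ne show False by blast
    qed
  qed (use d(2) in auto)
qed

text \<open>Off its poles \<open>F\<close> is an even elliptic function for the lattice of its
  poles. Its pole at 0 is double because infinity is a branch point, hence it is a polynomial of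
  degree 1 in \<wp>.\<close>

lemma gsol_affine_weierstrass:
  assumes F: "gsol f F" "F 0 = Infty"
  shows "\<exists>a b. a \<noteq> 0 \<and> (\<forall>u. F u = rat_map [:b, a:] [:1, 0:] (weierstrass_p {u. F u = Infty} u))"
proof -
  define L where "L = {u. F u = Infty}"
  have L: "rank_two_lattice L" unfolding L_def by (rule gsol_poles_lattice[OF F])
  define \<phi> where "\<phi> = (\<lambda>u. fin (F u))"
  have Fphi: "F u = Pt (\<phi> u)" if "u \<notin> L" for u using that unfolding L_def \<phi>_def by (cases "F u") auto
  have an: "\<phi> analytic_on {u}" if "u \<notin> L" for u
    unfolding \<phi>_def by (rule hol_at_fin(1)[OF gsolD(4)[OF F(1)]]) (use that in \<open>simp add: L_def\<close>)
  have ell: "elliptic L \<phi>"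
    unfolding elliptic_def
  proof (intro conjI allI impI)
    show "\<phi> holomorphic_on - L"
      using an by (intro analytic_points_holomorphic) simp
    fix u w assume "u \<notin> L" "w \<in> L"
    then show "\<phi> (u + w) = \<phi> u" using gsol_period[OF F, of w u] by (simp add: L_def \<phi>_def)
  qed
  obtain h where h: "h analytic_on {0}" "h 0 = 0" "\<forall>\<^sub>F t in nhds 0. F t = local_param (F 0) (h t)"
    by (rule hol_at_germ[OF gsolD(4)[OF F(1)]])
  have hnz: "\<forall>\<^sub>F t in at 0. h t \<noteq> 0" by (rule germ_nonzero[OF gsolD(5)[OF F(1)] h(3)])
  have "zorder h 0 = int 2"
    using sol_germ_degree[OF gsolD(1,3)[OF F(1)], of 0] F(2) germ_degree_eq_zorder[OF h(3)] by simp
  from zero_order_limit[OF h(1) hnz this] obtain c where c: "c \<noteq> 0" "((\<lambda>t. h t / t ^ 2) \<longlongrightarrow> c) (at 0)"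
    by auto
  have "((\<lambda>t. 1 / (h t / t ^ 2)) \<longlongrightarrow> 1 / c) (at 0)" using c by (intro tendsto_intros)
  moreover have "\<forall>\<^sub>F t in at 0. 1 / (h t / t ^ 2) = t ^ (2 * 1) * \<phi> t"
    using hnz eventually_at_of_nhds[OF h(3)] by eventually_elim (auto simp: F(2) \<phi>_def)
  ultimately have "((\<lambda>t. t ^ 2 * \<phi> t) \<longlongrightarrow> 1 / c) (at 0)" by (simp cong: tendsto_cong)
  then have lim: "((\<lambda>t. t ^ (2 * 1) * \<phi> t) \<longlongrightarrow> 1 / c) (at 0)" by simp
  have even: "\<phi> (- u) = \<phi> u" for u using gsol_even[OF F] by (simp add: \<phi>_def)
  obtain p where p: "degree p \<le> 1" "coeff p 1 = 1 / c" "\<And>u. u \<notin> L \<Longrightarrow> \<phi> u = poly p (pf L u)"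
    using elliptic_poly[OF L ell even lim] by blast
  have dp: "degree p = 1" using p(1,2) c(1) le_degree[of p 1] by simp
  have pe: "poly p z = coeff p 0 + coeff p 1 * z" for z
    unfolding poly_altdef dp by simp
  have "F u = rat_map [:coeff p 0, coeff p 1:] [:1, 0:] (weierstrass_p L u)" for u
  proof (cases "u \<in> L")
    case True
    then have wp: "weierstrass_p L u = Infty" by simp
    have "F u = Infty" using True by (simp add: L_def)
    then show ?thesis unfolding wp using p(2) c(1) by (simp add: Let_def)
  next
    case False
    then show ?thesis using Fphi[OF False] p(3)[OF False] pe by (simp add: weierstrass_p_pf mult.commute)
  qed
  moreover have "coeff p 1 \<noteq> 0" using p(2) c(1) by simp
  ultimately show ?thesis unfolding L_def[symmetric] by blast
qed

section \<open>Existence of global solutions\<close>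

lemma sol_at_cong:
  assumes "\<forall>\<^sub>F t in nhds a. F t = G t" "sol_at f F a"
  shows "sol_at f G a"
proof -
  have h: "hol_at F a" and ev: "\<forall>\<^sub>F t in at a. F t \<noteq> Infty \<and> deriv (\<lambda>s. fin (F s)) t \<noteq> 0 \<and>
        (deriv (\<lambda>s. fin (F s)) t) ^ 2 = poly f (fin (F t))"
    using assms(2) unfolding sol_at_def by auto
  have "\<forall>\<^sub>F t in nhds a. \<forall>\<^sub>F s in nhds t. F s = G s" using assms(1) by (simp add: eventually_eventually)
  from ev eventually_at_of_nhds[OF this] eventually_at_of_nhds[OF assms(1)]
  have "\<forall>\<^sub>F t in at a. G t \<noteq> Infty \<and> deriv (\<lambda>s. fin (G s)) t \<noteq> 0 \<and>
        (deriv (\<lambda>s. fin (G s)) t) ^ 2 = poly f (fin (G t))"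
  proof eventually_elim
    case (elim t)
    have "\<forall>\<^sub>F s in nhds t. fin (F s) = fin (G s)" using elim(2) by eventually_elim simp
    then have "deriv (\<lambda>s. fin (F s)) t = deriv (\<lambda>s. fin (G s)) t" by (rule deriv_cong_ev) simp
    with elim show ?case by simp
  qed
  with hol_at_cong[OF assms(1) h] show ?thesis unfolding sol_at_def by auto
qed

text \<open>Substituting \<open>y = x\<^sup>-\<^sup>2\<close> turns \<open>y'\<^sup>2 = 4 y\<^sup>3 - 4 a y - 4 b\<close> into
  \<open>x'\<^sup>2 = 1 - a x\<^sup>4 - b x\<^sup>6\<close>, which is solved by inverting a primitive.\<close>

lemma local_solution:
  fixes a b :: complex
  shows "\<exists>r F0. r > 0 \<and> F0 0 = Infty \<and> (\<forall>u\<in>ball 0 r. sol_at [:- 4 * b, - 4 * a, 0, 4:] F0 u)"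
proof -
  \<comment> \<open>\<open>H\<close> is the right side of the equation for x. On a disc where its
    real part is positive the principal root S is analytic and nonzero, and K, the integral of 1/S,
    inverts the solution x.\<close>
  define H where "H z = 1 - a * z ^ 4 - b * z ^ 6" for z
  have "open {z. 0 < Re (H z)}"
    unfolding H_def by (intro open_Collect_less continuous_intros)
  moreover have "0 \<in> {z. 0 < Re (H z)}" by (simp add: H_def)
  ultimately obtain r1 where r1: "r1 > 0" "ball 0 r1 \<subseteq> {z. 0 < Re (H z)}" using openE by blast
  have Hpos: "0 < Re (H z)" if "z \<in> ball 0 r1" for z using that r1(2) by blast
  define S where "S z = csqrt (H z)" for z
  have S: "S holomorphic_on ball 0 r1"
    unfolding S_def
  proof (rule holomorphic_on_csqrt')
    show "H holomorphic_on ball 0 r1" unfolding H_def by (intro holomorphic_intros)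
    show "H z \<notin> \<real>\<^sub>\<le>\<^sub>0" if "z \<in> ball 0 r1" for z
      using Hpos[OF that] by (auto simp: complex_nonpos_Reals_iff)
  qed
  have S2: "(S z) ^ 2 = H z" for z by (simp add: S_def)
  have S0: "S z \<noteq> 0" if "z \<in> ball 0 r1" for z using Hpos[OF that] by (auto simp: S_def)
  have "(\<lambda>z. 1 / S z) holomorphic_on ball 0 r1" using S S0 by (intro holomorphic_intros) auto
  then obtain K0 where K0: "\<And>z. z \<in> ball 0 r1 \<Longrightarrow> (K0 has_field_derivative 1 / S z) (at z within ball 0 r1)"
    using holomorphic_convex_primitive'[OF convex_ball open_ball] by blast
  define K where "K z = K0 z - K0 0" for z
  have K: "(K has_field_derivative 1 / S z) (at z)" if "z \<in> ball 0 r1" for z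
  proof -
    have "(K0 has_field_derivative 1 / S z) (at z)"
      using K0[OF that] at_within_open[OF that open_ball] by simp
    from DERIV_diff[OF this DERIV_const[of "K0 0"]] show ?thesis unfolding K_def by simp
  qed
  have K00: "K 0 = 0" by (simp add: K_def)
  have Khol: "K holomorphic_on ball 0 r1"
    by (subst holomorphic_on_open) (use K in blast)+
  have zr1: "0 \<in> ball 0 r1" using r1(1) by simp
  have dnz: "deriv K 0 \<noteq> 0" using DERIV_imp_deriv[OF K[OF zr1]] S0[OF zr1] by simp
  obtain r2 where r2: "r2 > 0" "ball (0 :: complex) r2 \<subseteq> ball 0 r1" "open (K ` ball 0 r2)" "inj_on K (ball 0 r2)"
    by (rule has_complex_derivative_locally_invertible[OF Khol zr1 open_ball dnz]) (rule that)
  have Khol2: "K holomorphic_on ball 0 r2" by (rule holomorphic_on_subset[OF Khol r2(2)])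
  obtain x where x: "x holomorphic_on (K ` ball 0 r2)"
      "\<And>z. z \<in> ball 0 r2 \<Longrightarrow> deriv K z * deriv x (K z) = 1" "\<And>z. z \<in> ball 0 r2 \<Longrightarrow> x (K z) = z"
    by (rule holomorphic_has_inverse[OF Khol2 open_ball r2(4)]) (rule that)
  have "0 \<in> K ` ball 0 r2" using r2(1) K00 by (intro image_eqI[of _ _ 0]) auto
  then obtain r where r: "r > 0" "ball 0 r \<subseteq> K ` ball 0 r2" by (rule openE[OF r2(3)])
  have x0: "x 0 = 0" using x(3)[of 0] r2(1) K00 by simp
  have main: "x analytic_on {u} \<and> (deriv x u) ^ 2 = H (x u) \<and> deriv x u \<noteq> 0 \<and> (u \<noteq> 0 \<longrightarrow> x u \<noteq> 0)"
    if u: "u \<in> ball 0 r" for u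
  proof -
    obtain z where z: "z \<in> ball 0 r2" "u = K z" using u r(2) by blast
    have z1: "z \<in> ball 0 r1" using z r2(2) by blast
    have xu: "x u = z" using x(3)[OF z(1)] z(2) by simp
    have "1 / S z * deriv x u = 1" using x(2)[OF z(1)] DERIV_imp_deriv[OF K[OF z1]] z(2) by simp
    then have "deriv x u = S z" using S0[OF z1] by (simp add: field_simps)
    moreover have "x analytic_on {u}" using x(1) r(2) u r2(3) unfolding analytic_at by blast
    moreover have "z = 0 \<Longrightarrow> u = 0" using z K00 by simp
    ultimately show ?thesis using S2[of z] S0[OF z1] xu by auto
  qed
  define F0 where "F0 u = mk 1 (x u ^ 2)" for u
  let ?f = "[:- 4 * b, - 4 * a, 0, 4:]"
  have pt: "F0 t \<noteq> Infty \<and> deriv (\<lambda>s. fin (F0 s)) t \<noteq> 0 \<and> (deriv (\<lambda>s. fin (F0 s)) t) ^ 2 = poly ?f (fin (F0 t))"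
    if t: "t \<in> ball 0 r" "t \<noteq> 0" for t
  proof -
    note m = main[OF t(1)]
    have xt: "x t \<noteq> 0" using m t(2) by blast
    have an: "x analytic_on {t}" using m by blast
    have dx: "(x has_field_derivative deriv x t) (at t)"
      by (rule analytic_DERIV[OF an])
    have "\<forall>\<^sub>F s in nhds t. x s \<noteq> 0" using analytic_tendsto[OF an] xt tendsto_imp_eventually_ne by blast
    then have "\<forall>\<^sub>F s in nhds t. fin (F0 s) = 1 / x s ^ 2" by eventually_elim (simp add: F0_def mk_def)
    then have "deriv (\<lambda>s. fin (F0 s)) t = deriv (\<lambda>s. 1 / x s ^ 2) t" by (rule deriv_cong_ev) (simp add: F0_def mk_def xt)
    also have "\<dots> = - 2 * deriv x t / x t ^ 3"
    proof (rule DERIV_imp_deriv)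
      have "((\<lambda>s. 1 / x s ^ 2) has_field_derivative (0 * x t ^ 2 - 1 * (2 * x t * deriv x t)) / (x t ^ 2 * x t ^ 2)) (at t)"
        using xt by (intro DERIV_divide) (auto intro!: derivative_eq_intros dx)
      then show "((\<lambda>s. 1 / x s ^ 2) has_field_derivative - 2 * deriv x t / x t ^ 3) (at t)"
        using xt by (simp add: field_simps power2_eq_square power3_eq_cube)
    qed
    finally have D: "deriv (\<lambda>s. fin (F0 s)) t = - 2 * deriv x t / x t ^ 3" .
    have "(deriv (\<lambda>s. fin (F0 s)) t) ^ 2 = 4 * H (x t) / x t ^ 6"
      unfolding D using m by (simp add: power_divide power_mult_distrib flip: power_mult)
    also have "\<dots> = poly ?f (1 / x t ^ 2)"
      using xt unfolding H_def by (simp add: field_simps power_numeral_reduce)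
    finally show ?thesis using D m xt by (simp add: F0_def mk_def)
  qed
  have "sol_at ?f F0 u" if u: "u \<in> ball 0 r" for u
    unfolding sol_at_def
  proof
    show "hol_at F0 u"
    proof (rule hol_atI[of "\<lambda>_. 1" _ "\<lambda>u. x u ^ 2"])
      show "(\<lambda>u. x u ^ 2) analytic_on {u}" using main[OF u] by (intro analytic_on_power) blast
    qed (auto simp: F0_def)
    have "\<forall>\<^sub>F t in at u. t \<in> ball 0 r"
      by (rule eventually_at_of_nhds, rule eventually_nhds_in_open) (use u in auto)
    moreover have "\<forall>\<^sub>F t in at u. t \<noteq> 0"
      by (rule eventually_neq_at_within)
    ultimately show "\<forall>\<^sub>F t in at u. F0 t \<noteq> Infty \<and> deriv (\<lambda>s. fin (F0 s)) t \<noteq> 0 \<and>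
        (deriv (\<lambda>s. fin (F0 s)) t) ^ 2 = poly ?f (fin (F0 t))"
      by eventually_elim (rule pt)
  qed
  moreover have "F0 0 = Infty" by (simp add: F0_def mk_def x0)
  ultimately show ?thesis using r(1) by blast
qed

text \<open>The left side is the square of the Wronskian P' c - P c', the right side is 16 c^3
  f(P/(4c)) for the cubic f = 4c. The fraction comes from the duplication formula \<wp>(2t) = P/(4c)
  with invariants g2 = 4a and g3 = 4b.\<close>

lemma duplication_identity:
  fixes a b z :: complex
  defines "c \<equiv> z ^ 3 - a * z - b" and "P \<equiv> z ^ 4 + 2 * a * z ^ 2 + 8 * b * z + a ^ 2"
  shows "(4 * (z ^ 3 + a * z + 2 * b) * c - P * (3 * z ^ 2 - a)) ^ 2 = P ^ 3 - 16 * a * P * c ^ 2 - 64 * b * c ^ 3"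
  unfolding c_def P_def by algebra

definition dup_num :: "complex \<Rightarrow> complex \<Rightarrow> complex poly" where
  "dup_num a b = [:a ^ 2, 8 * b, 2 * a, 0, 1:]"

text \<open>The factor 1/2 is the time scale of D(F(t/2)). At a root z of \<open>f\<close> the
  numerator equals (3z^2 - a)^2, which is nonzero because the root is simple; there the Wronskian
  cannot vanish either.\<close>

lemma duplication:
  fixes a b :: complex
  defines "f \<equiv> [:- 4 * b, - 4 * a, 0, 4:]"
  assumes f: "cubic f"
  shows "coprime (dup_num a b) f" "wronskian (dup_num a b) f \<noteq> 0"
    "(1 / 2) ^ 2 * (poly (wronskian (dup_num a b) f) z) ^ 2 * poly f z = hat f (poly (dup_num a b) z) (poly f z)"
proof -
  define c where "c z = z ^ 3 - a * z - b" for z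
  define P where "P z = z ^ 4 + 2 * a * z ^ 2 + 8 * b * z + a ^ 2" for z
  have pf: "poly f z = 4 * c z" "poly (dup_num a b) z = P z" "poly (pderiv f) z = 4 * (3 * z ^ 2 - a)" for z
    by (simp_all add: f_def dup_num_def c_def P_def pderiv_pCons algebra_simps power_numeral_reduce)
  have W: "poly (wronskian (dup_num a b) f) z
      = 4 * (4 * (z ^ 3 + a * z + 2 * b) * c z - P z * (3 * z ^ 2 - a))" for z
    unfolding wronskian_def
    by (simp add: pf) (simp add: dup_num_def pderiv_pCons algebra_simps power_numeral_reduce)
  show cop: "coprime (dup_num a b) f"
  proof (rule coprimeI_no_common_root)
    fix z assume z: "poly f z = 0"
    then have "c z = 0" by (simp add: pf(1))
    then have b: "b = z ^ 3 - a * z" by (simp add: c_def algebra_simps)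
    have "poly (pderiv f) z \<noteq> 0" using f z by (simp add: cubic_def)
    then have "3 * z ^ 2 - a \<noteq> 0" by (simp add: pf)
    moreover have "P z = (3 * z ^ 2 - a) ^ 2" unfolding P_def b by algebra
    ultimately show "poly (dup_num a b) z \<noteq> 0" by (simp add: pf)
  qed
  show id: "(1 / 2) ^ 2 * (poly (wronskian (dup_num a b) f) z) ^ 2 * poly f z
      = hat f (poly (dup_num a b) z) (poly f z)" for z
  proof -
    have "(1 / 2) ^ 2 * (poly (wronskian (dup_num a b) f) z) ^ 2 * poly f z
        = 16 * c z * (4 * (z ^ 3 + a * z + 2 * b) * c z - P z * (3 * z ^ 2 - a)) ^ 2"
    proof -
      have "(1 / 2) ^ 2 * (4 * X) ^ 2 * (4 * C) = 16 * C * X ^ 2" for X C :: complex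
        by (simp add: power2_eq_square)
      then show ?thesis unfolding W pf(1) .
    qed
    also have "\<dots> = 16 * c z * (P z ^ 3 - 16 * a * P z * c z ^ 2 - 64 * b * c z ^ 3)"
      unfolding c_def P_def duplication_identity ..
    also have "\<dots> = hat f (P z) (4 * c z)"
      unfolding hat_def f_def by (simp add: numeral_3_eq_3 numeral_2_eq_2 algebra_simps)
    finally show ?thesis by (simp add: pf)
  qed
  show "wronskian (dup_num a b) f \<noteq> 0"
  proof
    assume W0: "wronskian (dup_num a b) f = 0"
    obtain z where z: "poly f z = 0"
      using fundamental_theorem_of_algebra[of f] constant_degree[of f] f by (auto simp: cubic_def)
    then have "P z * (3 * z ^ 2 - a) = 0" using W[of z] W0 by (simp add: pf)
    then have "poly (dup_num a b) z = 0 \<or> poly (pderiv f) z = 0" by (auto simp: pf)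
    then show False using coprime_no_common_root[OF cop, of z] z f by (auto simp: cubic_def)
  qed
qed

text \<open>D(F0(u/2)) and F0(u) are solutions with a pole at 0; infinity is a branch point, so they
  agree. Hence the n-fold iterate of D at F0(u/2^n) continues F0 to the disc of radius 2^n r, and
  these continuations are compatible.\<close>

lemma depressed_global_solution:
  fixes a b :: complex
  defines "f \<equiv> [:- 4 * b, - 4 * a, 0, 4:]"
  assumes f: "cubic f"
  shows "\<exists>F. gsol f F \<and> F 0 = Infty"
proof -
  obtain r F0 where r: "r > 0" and F0: "F0 0 = Infty" "\<And>u. u \<in> ball 0 r \<Longrightarrow> sol_at f F0 u"
    using local_solution[of b a] unfolding f_def by blast
  note dup = duplication[OF f[unfolded f_def], folded f_def]
  define D where "D = rat_map (dup_num a b) f"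
  have d3: "degree f = 3" using f by (simp add: cubic_def)
  have DInf: "D Infty = Infty" by (simp add: D_def dup_num_def f_def Let_def numeral_eq_Suc)
  have step: "sol_at f (\<lambda>t. D (G (t / 2))) u" if "sol_at f G (u / 2)" for G u
    using sol_compose[OF d3 d3 _ _ dup(1,2) dup(3), of G u 0] that by (simp add: D_def)
  have loc: "D (F0 (u / 2)) = F0 u" if u: "u \<in> ball 0 r" for u
  proof (rule hol_eq_on[of "ball 0 r" 0])
    have s1: "sol_at f (\<lambda>u. D (F0 (u / 2))) t" if "t \<in> ball 0 r" for t
      by (rule step, rule F0(2)) (use that r in auto)
    show "hol_at (\<lambda>u. D (F0 (u / 2))) t" "hol_at F0 t" if "t \<in> ball 0 r" for t
      using sol_at_hol[OF s1[OF that]] sol_at_hol[OF F0(2)[OF that]] by auto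
    show "\<forall>\<^sub>F t in nhds 0. D (F0 (t / 2)) = F0 t"
      by (rule sol_unique_branch[OF d3 s1 F0(2)]) (use r F0(1) DInf in auto)
  qed (use r u in auto)
  define E where "E n u = (D ^^ n) (F0 (u / 2 ^ n))" for n u
  have E_sol: "sol_at f (E n) u" if "cmod u < 2 ^ n * r" for n u
    using that
  proof (induction n arbitrary: u)
    case 0
    then show ?case using F0(2)[of u] by (simp add: E_def[abs_def])
  next
    case (Suc n)
    have "sol_at f (\<lambda>t. D (E n (t / 2))) u"
      by (rule step, rule Suc.IH) (use Suc.prems in \<open>simp add: norm_divide\<close>)
    then show ?case by (simp add: E_def[abs_def])
  qed
  have E_Suc: "E (Suc n) u = E n u" if "cmod u < 2 ^ n * r" for n u
  proof -
    have "cmod (u / 2 ^ n) < r" using that by (simp add: norm_divide norm_power field_simps)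
    then have "D (F0 (u / 2 ^ n / 2)) = F0 (u / 2 ^ n)" by (intro loc) simp
    then show ?thesis by (simp add: E_def funpow_swap1 mult.commute)
  qed
  have E_mono: "E (n + m) u = E n u" if "cmod u < 2 ^ n * r" for n m u
  proof (induction m)
    case (Suc m)
    have "(2 :: real) ^ n * r \<le> 2 ^ (n + m) * r" using r by (intro mult_right_mono power_increasing) auto
    then have "cmod u < 2 ^ (n + m) * r" using that by linarith
    from E_Suc[OF this] Suc show ?case by simp
  qed simp
  define N where "N u = (LEAST n. cmod u < 2 ^ n * r)" for u
  have ex: "\<exists>n. cmod u < 2 ^ n * r" for u
  proof -
    obtain n where "cmod u / r < 2 ^ n" using real_arch_pow[of 2 "cmod u / r"] by auto
    then have "cmod u < 2 ^ n * r" using r by (simp add: field_simps)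
    then show ?thesis by blast
  qed
  define F where "F u = E (N u) u" for u
  have F_eq: "F u = E n u" if "cmod u < 2 ^ n * r" for n u
  proof -
    have 1: "cmod u < 2 ^ N u * r" unfolding N_def using ex by (rule LeastI_ex)
    have "N u \<le> n" unfolding N_def by (rule Least_le) (rule that)
    then obtain m where "n = N u + m" using le_Suc_ex by blast
    then show ?thesis using E_mono[OF 1, of m] by (simp add: F_def)
  qed
  have "sol_at f F u" for u
  proof -
    obtain n where n: "cmod u < 2 ^ n * r" using ex by blast
    have "\<forall>\<^sub>F t in nhds u. t \<in> ball 0 (2 ^ n * r)"
      by (rule eventually_nhds_in_open) (use n in auto)
    then have "\<forall>\<^sub>F t in nhds u. E n t = F t" by eventually_elim (simp add: F_eq)
    then show ?thesis by (rule sol_at_cong) (rule E_sol[OF n])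
  qed
  moreover have "F 0 = Infty" using F_eq[of 0 0] r F0(1) by (simp add: E_def)
  ultimately show ?thesis using f unfolding gsol_def by blast
qed

text \<open>An affine change of the value leads to the depressed cubic g with \<alpha>^2 g(z) =
  f(\<alpha> z + \<beta>): the shift \<beta> removes the quadratic term, and \<alpha> = 4/c3 makes
  the leading coefficient 4.\<close>

lemma global_solution:
  assumes f: "cubic f"
  shows "\<exists>F. gsol f F \<and> F 0 = Infty"
proof -
  define c0 c1 c2 c3 where "c0 = coeff f 0" and "c1 = coeff f 1" and "c2 = coeff f 2" and "c3 = coeff f 3"
  have d3: "degree f = 3" using f by (simp add: cubic_def)
  have c3: "c3 \<noteq> 0" using d3 unfolding c3_def by (metis degree_0 leading_coeff_0_iff zero_neq_numeral)
  have fz: "poly f z = c0 + c1 * z + c2 * z ^ 2 + c3 * z ^ 3" for z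
    using cubic_poly_eq[OF d3] by (simp add: c0_def c1_def c2_def c3_def)
  define \<alpha> \<beta> where "\<alpha> = 4 / c3" and "\<beta> = - c2 / (3 * c3)"
  have \<alpha>: "\<alpha> \<noteq> 0" "\<alpha> * c3 = 4" using c3 by (simp_all add: \<alpha>_def)
  have \<beta>: "3 * c3 * \<beta> = - c2" using c3 by (simp add: \<beta>_def)
  define A0 A1 where "A0 = c0 + c1 * \<beta> + c2 * \<beta> ^ 2 + c3 * \<beta> ^ 3"
    and "A1 = c1 + 2 * c2 * \<beta> + 3 * c3 * \<beta> ^ 2"
  define a b where "a = - A1 / (4 * \<alpha>)" and "b = - A0 / (4 * \<alpha> ^ 2)"
  have A: "A0 = \<alpha> ^ 2 * (- 4 * b)" "A1 = \<alpha> * (- 4 * a)"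
    using \<alpha>(1) by (simp_all add: a_def b_def)
  define g where "g = [:- 4 * b, - 4 * a, 0, 4:]"
  have gz: "\<alpha> ^ 2 * poly g z = poly f (\<alpha> * z + \<beta>)" for z
  proof -
    have "poly f (\<alpha> * z + \<beta>) = A0 + \<alpha> * z * A1 + \<alpha> ^ 2 * z ^ 2 * (c2 + 3 * c3 * \<beta>) + \<alpha> ^ 2 * z ^ 3 * (\<alpha> * c3)"
      unfolding fz A0_def A1_def by (simp add: algebra_simps power2_eq_square power3_eq_cube)
    also have "\<dots> = \<alpha> ^ 2 * (- 4 * b) + \<alpha> * z * (\<alpha> * (- 4 * a)) + \<alpha> ^ 2 * z ^ 3 * 4"
      unfolding \<alpha>(2) \<beta> A by simp
    also have "\<dots> = \<alpha> ^ 2 * poly g z"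
      by (simp add: g_def algebra_simps power2_eq_square power3_eq_cube)
    finally show ?thesis by simp
  qed
  have gpoly: "smult (\<alpha> ^ 2) g = pcompose f [:\<beta>, \<alpha>:]"
  proof -
    have "poly (smult (\<alpha> ^ 2) g) z = poly (pcompose f [:\<beta>, \<alpha>:]) z" for z
      using gz[of z] by (simp add: poly_pcompose algebra_simps)
    then show ?thesis by (simp add: poly_eq_poly_eq_iff[symmetric] fun_eq_iff)
  qed
  have gder: "\<alpha> * poly (pderiv g) z = poly (pderiv f) (\<alpha> * z + \<beta>)" for z
  proof -
    have "poly (pderiv (smult (\<alpha> ^ 2) g)) z = poly (pderiv (pcompose f [:\<beta>, \<alpha>:])) z" by (simp only: gpoly)
    then have "\<alpha> ^ 2 * poly (pderiv g) z = poly (pderiv f) (\<alpha> * z + \<beta>) * \<alpha>"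
      by (simp add: pderiv_smult pderiv_pcompose poly_pcompose pderiv_pCons algebra_simps)
    then show ?thesis using \<alpha>(1) by (simp add: power2_eq_square)
  qed
  have g: "cubic g"
    unfolding cubic_def
  proof (intro conjI allI impI)
    show "degree g = 3" by (simp add: g_def)
    fix z assume "poly g z = 0"
    then have "poly f (\<alpha> * z + \<beta>) = 0" using gz[of z] by simp
    then have "poly (pderiv f) (\<alpha> * z + \<beta>) \<noteq> 0" using f by (simp add: cubic_def)
    then show "poly (pderiv g) z \<noteq> 0" using gder[of z] by auto
  qed
  obtain F where F: "gsol g F" "F 0 = Infty"
    using depressed_global_solution[OF g[unfolded g_def]] unfolding g_def by blast
  have W: "wronskian [:\<beta>, \<alpha>:] [:1, 0:] = [:\<alpha>:]" by (simp add: wronskian_def pderiv_pCons)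
  have "gsol f (\<lambda>t. rat_map [:\<beta>, \<alpha>:] [:1, 0:] (F (1 * t + 0)))"
  proof (rule gsol_compose[OF F(1) f])
    show "coprime [:\<beta>, \<alpha>:] [:1, 0:]" using coprime_linear[of \<alpha> 1 \<beta> 0] \<alpha>(1) by simp
    show "wronskian [:\<beta>, \<alpha>:] [:1, 0:] \<noteq> 0" unfolding W using \<alpha>(1) by simp
    show "1 ^ 2 * (poly (wronskian [:\<beta>, \<alpha>:] [:1, 0:]) z) ^ 2 * poly g z = hat f (poly [:\<beta>, \<alpha>:] z) (poly [:1, 0:] z)" for z
      unfolding W using gz[of z] hat_eq[OF d3, of 1 "\<alpha> * z + \<beta>"] by (simp add: algebra_simps)
  qed simp
  moreover have "rat_map [:\<beta>, \<alpha>:] [:1, 0:] (F (1 * 0 + 0)) = Infty" using F(2) \<alpha>(1) by (simp add: Let_def)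
  ultimately show ?thesis by blast
qed

section \<open>Linear fractional maps\<close>

text \<open>Meant for any matrix of nonzero determinant, which makes compositions and inverses easy
  to form; \<open>linear_fractional_mob\<close> restores determinant 1.\<close>

definition mob :: "complex \<Rightarrow> complex \<Rightarrow> complex \<Rightarrow> complex \<Rightarrow> csphere \<Rightarrow> csphere" where
  "mob a b c d = rat_map [:b, a:] [:d, c:]"

lemma mob_degree:
  fixes a b c d :: complex
  assumes "a * d - b * c \<noteq> 0"
  shows "max (degree [:b, a:]) (degree [:d, c:]) = 1"
  using assms by auto

lemma mob_mk:
  assumes det: "a * d - b * c \<noteq> 0" and AB: "A \<noteq> 0 \<or> B \<noteq> 0"
  shows "mob a b c d (mk A B) = mk (a * A + b * B) (c * A + d * B)"
  unfolding mob_def rat_map_mk[OF coprime_linear[OF det] mob_degree[OF det, symmetric] AB]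
  by (simp add: hom_def add.commute)

lemma mob_mk_nonzero:
  fixes a b c d :: complex
  assumes det: "a * d - b * c \<noteq> 0" and AB: "A \<noteq> 0 \<or> B \<noteq> 0"
  shows "a * A + b * B \<noteq> 0 \<or> c * A + d * B \<noteq> 0"
proof (rule ccontr)
  assume "\<not> ?thesis"
  then have "a * A + b * B = 0" "c * A + d * B = 0" by auto
  moreover have "(a * d - b * c) * A = d * (a * A + b * B) - b * (c * A + d * B)"
    "(a * d - b * c) * B = a * (c * A + d * B) - c * (a * A + b * B)" by (simp_all add: algebra_simps)
  ultimately have "(a * d - b * c) * A = 0" "(a * d - b * c) * B = 0" by simp_all
  then show False using det AB by simp
qed

lemma linear_fractional_mob:
  assumes "a * d - b * c \<noteq> 0"
  shows "linear_fractional (mob a b c d)"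
proof -
  \<comment> \<open>Multiplying the matrix by a square root of the inverse determinant leaves the
    map unchanged and makes the determinant 1.\<close>
  define s where "s = csqrt (1 / (a * d - b * c))"
  have s2: "s * s = 1 / (a * d - b * c)" using power2_csqrt[of "1 / (a * d - b * c)"] by (simp add: s_def power2_eq_square)
  have s0: "s \<noteq> 0" using assms by (simp add: s_def)
  have "(s * a) * (s * d) - (s * b) * (s * c) = s * s * (a * d - b * c)" by (simp add: algebra_simps)
  then have det: "(s * a) * (s * d) - (s * b) * (s * c) = 1" using assms by (simp add: s2)
  have "mob a b c d x = mob (s * a) (s * b) (s * c) (s * d) x" for x
  proof -
    obtain A B where AB: "A \<noteq> 0 \<or> B \<noteq> 0" "x = mk A B" using csphere_mk by blast
    have "mob (s * a) (s * b) (s * c) (s * d) x = mk (s * (a * A + b * B)) (s * (c * A + d * B))"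
      unfolding AB(2) by (subst mob_mk[OF _ AB(1)]) (use det in \<open>auto simp: algebra_simps\<close>)
    then show ?thesis unfolding AB(2) mob_mk[OF assms AB(1)] using mk_scale[OF s0] by simp
  qed
  then have "mob a b c d = rat_map [:s * b, s * a:] [:s * d, s * c:]" by (simp add: fun_eq_iff mob_def)
  then show ?thesis unfolding linear_fractional_def using det by blast
qed

lemma linear_fractionalE:
  assumes "linear_fractional l"
  obtains a b c d where "a * d - b * c \<noteq> 0" "l = mob a b c d"
  using assms unfolding linear_fractional_def mob_def by (metis one_neq_zero)

lemma mob_comp:
  assumes "a * d - b * c \<noteq> 0" "a' * d' - b' * c' \<noteq> 0"
  shows "mob a b c d \<circ> mob a' b' c' d' = mob (a * a' + b * c') (a * b' + b * d') (c * a' + d * c') (c * b' + d * d')"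
    and "(a * a' + b * c') * (c * b' + d * d') - (a * b' + b * d') * (c * a' + d * c') \<noteq> 0"
proof -
  have "(a * a' + b * c') * (c * b' + d * d') - (a * b' + b * d') * (c * a' + d * c')
      = (a * d - b * c) * (a' * d' - b' * c')" by (simp add: algebra_simps)
  then show det: "(a * a' + b * c') * (c * b' + d * d') - (a * b' + b * d') * (c * a' + d * c') \<noteq> 0"
    using assms by simp
  show "mob a b c d \<circ> mob a' b' c' d' = mob (a * a' + b * c') (a * b' + b * d') (c * a' + d * c') (c * b' + d * d')"
  proof
    fix x
    obtain A B where AB: "A \<noteq> 0 \<or> B \<noteq> 0" "x = mk A B" using csphere_mk by blast
    show "(mob a b c d \<circ> mob a' b' c' d') x
        = mob (a * a' + b * c') (a * b' + b * d') (c * a' + d * c') (c * b' + d * d') x"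
      unfolding AB(2) o_apply mob_mk[OF assms(2) AB(1)] mob_mk[OF assms(1) mob_mk_nonzero[OF assms(2) AB(1)]]
        mob_mk[OF det AB(1)]
      by (simp add: algebra_simps)
  qed
qed

lemma mob_id: "mob a 0 0 a x = x" if "a \<noteq> 0"
  using that by (cases x) (auto simp: mob_def Let_def)

lemma linear_fractional_id: "linear_fractional id"
proof -
  have "mob 1 0 0 1 = id" using mob_id[of 1] by (simp add: fun_eq_iff)
  then show ?thesis using linear_fractional_mob[of 1 1 0 0] by simp
qed

lemma linear_fractional_comp:
  assumes "linear_fractional l" "linear_fractional l'"
  shows "linear_fractional (l \<circ> l')"
proof -
  obtain a b c d where 1: "a * d - b * c \<noteq> 0" "l = mob a b c d" using linear_fractionalE[OF assms(1)] .
  obtain a' b' c' d' where 2: "a' * d' - b' * c' \<noteq> 0" "l' = mob a' b' c' d'" using linear_fractionalE[OF assms(2)] .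
  show ?thesis unfolding 1(2) 2(2) mob_comp(1)[OF 1(1) 2(1)] by (rule linear_fractional_mob[OF mob_comp(2)[OF 1(1) 2(1)]])
qed

lemma linear_fractional_inverse:
  assumes "linear_fractional l"
  obtains l' where "linear_fractional l'" "l \<circ> l' = id" "l' \<circ> l = id"
proof -
  obtain a b c d where 1: "a * d - b * c \<noteq> 0" "l = mob a b c d" using linear_fractionalE[OF assms] .
  have 2: "d * a - (- b) * (- c) \<noteq> 0" using 1 by (simp add: mult.commute)
  have "l \<circ> mob d (- b) (- c) a = mob (a * d - b * c) 0 0 (a * d - b * c)"
    unfolding 1(2) mob_comp(1)[OF 1(1) 2] by (simp add: algebra_simps)
  moreover have "mob d (- b) (- c) a \<circ> l = mob (a * d - b * c) 0 0 (a * d - b * c)"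
    unfolding 1(2) mob_comp(1)[OF 2 1(1)] by (simp add: algebra_simps)
  moreover have "mob (a * d - b * c) 0 0 (a * d - b * c) = id" using mob_id[OF 1(1)] by (simp add: fun_eq_iff)
  ultimately show thesis using that[of "mob d (- b) (- c) a"] linear_fractional_mob[OF 2] by simp
qed

lemma linear_fractional_bij: "linear_fractional l \<Longrightarrow> bij l"
  by (rule linear_fractional_inverse) (auto intro: o_bij)

lemma linear_fractional_move:
  obtains l where "linear_fractional l" "l x = Infty"
proof (cases x)
  case Infty
  then show ?thesis using that[OF linear_fractional_id] by simp
next
  case (Pt c)
  have "linear_fractional (mob 0 1 1 (- c))" by (rule linear_fractional_mob) simp
  moreover have "mob 0 1 1 (- c) x = Infty" by (simp add: mob_def Pt)
  ultimately show ?thesis by (rule that)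
qed

lemma linear_fractional_rational: "linear_fractional l \<Longrightarrow> rational l"
proof (erule linear_fractionalE)
  fix a b c d assume *: "a * d - b * c \<noteq> 0" "l = mob a b c d"
  show "rational l"
    unfolding rational_def
    by (intro exI[of _ "[:b, a:]"] exI[of _ "[:d, c:]"] conjI coprime_linear[OF *(1)])
       (use mob_degree[OF *(1)] * in \<open>auto simp: mob_def\<close>)
qed

lemma local_degree_id: "local_degree id x = 1"
  unfolding local_degree_def
  by (rule zorder_eqI[of UNIV _ "\<lambda>_. 1"]) auto

text \<open>The local degrees of \<open>l\<close> and of its inverse are positive integers with
  product 1.\<close>

lemma linear_fractional_local_degree:
  assumes "linear_fractional l"
  shows "local_degree l x = 1"
proof -
  obtain l' where l': "linear_fractional l'" "l \<circ> l' = id" "l' \<circ> l = id"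
    using linear_fractional_inverse[OF assms] .
  note r = linear_fractional_rational[OF assms] linear_fractional_rational[OF l'(1)]
  have "local_degree l' (l x) * local_degree l x = 1"
    using local_degree_comp[OF r(2,1), of x] l'(3) local_degree_id by simp
  then show ?thesis
    using local_degree_pos[OF r(1), of x] local_degree_pos[OF r(2), of "l x"]
    by (metis pos_zmult_eq_1_iff)
qed

section \<open>Invariance of the class\<close>

text \<open>In homogeneous coordinates \<open>l\<close> acts linearly on the pair of polynomials,
  and an invertible matrix preserves both their coprimality and their common degree.\<close>

lemma rational_comp_left:
  assumes "rational R" "linear_fractional l"
  shows "rational (l \<circ> R)"
proof -
  obtain p q where pq: "coprime p q" "max (degree p) (degree q) > 0" "R = rat_map p q"
    using assms(1) unfolding rational_def by blast
  obtain a b c d where l: "a * d - b * c \<noteq> 0" "l = mob a b c d" using linear_fractionalE[OF assms(2)] .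
  define n where "n = max (degree p) (degree q)"
  define p' where "p' = smult a p + smult b q"
  define q' where "q' = smult c p + smult d q"
  have cop: "coprime p' q'"
  proof (rule coprimeI_no_common_root)
    fix z assume 1: "poly q' z = 0"
    show "poly p' z \<noteq> 0"
      using mob_mk_nonzero[OF l(1), of "poly p z" "poly q z"] coprime_no_common_root[OF pq(1), of z] 1
      by (auto simp: p'_def q'_def)
  qed
  have le: "degree p' \<le> n" "degree q' \<le> n"
    unfolding p'_def q'_def n_def by (auto intro!: degree_add_le order_trans[OF degree_smult_le])
  have hom': "hom n p' A B = a * hom n p A B + b * hom n q A B" "hom n q' A B = c * hom n p A B + d * hom n q A B" for A B
    unfolding hom_def p'_def q'_def by (simp_all add: sum_distrib_left sum.distrib algebra_simps)
  have nz: "hom n p A B \<noteq> 0 \<or> hom n q A B \<noteq> 0" if "A \<noteq> 0 \<or> B \<noteq> 0" for A B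
    by (rule hom_pair_nonzero[OF pq(1) n_def that])
  have "coeff p' n \<noteq> 0 \<or> coeff q' n \<noteq> 0"
    using hom'[of 1 0] mob_mk_nonzero[OF l(1) nz[of 1 0]] by (auto simp: hom_0)
  then have deg: "n = max (degree p') (degree q')"
    using le le_degree[of p' n] le_degree[of q' n] by auto
  have "(l \<circ> R) x = rat_map p' q' x" for x
  proof -
    obtain A B where AB: "A \<noteq> 0 \<or> B \<noteq> 0" "x = mk A B" using csphere_mk by blast
    show ?thesis
      unfolding AB(2) o_apply l(2) pq(3) rat_map_mk[OF pq(1) n_def AB(1)] mob_mk[OF l(1) nz[OF AB(1)]]
        rat_map_mk[OF cop deg AB(1)] hom' ..
  qed
  then have "l \<circ> R = rat_map p' q'" by (simp add: fun_eq_iff)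
  moreover have "max (degree p') (degree q') > 0" using deg pq(2) unfolding n_def by linarith
  ultimately show ?thesis unfolding rational_def using cop by blast
qed

text \<open>For deg p at most n this is v^n p(u/v), the substitution of a fraction with its
  denominators cleared.\<close>

definition hom_poly :: "nat \<Rightarrow> complex poly \<Rightarrow> complex poly \<Rightarrow> complex poly \<Rightarrow> complex poly" where
  "hom_poly n p u v = (\<Sum>i\<le>n. smult (coeff p i) (u ^ i * v ^ (n - i)))"

lemma poly_hom_poly: "poly (hom_poly n p u v) z = hom n p (poly u z) (poly v z)"
  unfolding hom_poly_def hom_def by (simp add: poly_sum mult.assoc)

lemma degree_linear_power_le: "degree ([:b, a:] ^ i) \<le> i"
  by (rule order_trans[OF degree_power_le]) simp

lemma degree_linear_powers:
  fixes a b c d :: complex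
  assumes "i \<le> n"
  shows "degree ([:b, a:] ^ i * [:d, c:] ^ (n - i)) \<le> n"
proof -
  have "degree ([:b, a:] ^ i) \<le> i" "degree ([:d, c:] ^ (n - i)) \<le> n - i"
    by (rule degree_linear_power_le)+
  then show ?thesis using assms degree_mult_le[of "[:b, a:] ^ i" "[:d, c:] ^ (n - i)"] by linarith
qed

lemma coeff_linear_power: "coeff ([:b, a:] ^ i) i = (a :: complex) ^ i"
proof (induction i)
  case (Suc i)
  have "degree ([:b, a:] ^ i) \<le> i" by (rule degree_linear_power_le)
  then have "coeff ([:b, a:] ^ i) (Suc i) = 0" by (intro coeff_eq_0) simp
  with Suc show ?case by (simp add: coeff_pCons)
qed simp

lemma coeff_linear_powers:
  fixes a b c d :: complex
  assumes "i \<le> n"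
  shows "coeff ([:b, a:] ^ i * [:d, c:] ^ (n - i)) n = a ^ i * c ^ (n - i)"
proof -
  have le: "degree ([:b, a:] ^ i) \<le> i" "degree ([:d, c:] ^ (n - i)) \<le> n - i"
    by (rule degree_linear_power_le)+
  have "coeff ([:b, a:] ^ i * [:d, c:] ^ (n - i)) n =
      (\<Sum>j\<le>n. coeff ([:b, a:] ^ i) j * coeff ([:d, c:] ^ (n - i)) (n - j))"
    by (rule coeff_mult)
  also have "\<dots> = (\<Sum>j\<in>{i}. coeff ([:b, a:] ^ i) j * coeff ([:d, c:] ^ (n - i)) (n - j))"
  proof (rule sum.mono_neutral_right)
    show "\<forall>j\<in>{..n} - {i}. coeff ([:b, a:] ^ i) j * coeff ([:d, c:] ^ (n - i)) (n - j) = 0"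
    proof
      fix j assume j: "j \<in> {..n} - {i}"
      show "coeff ([:b, a:] ^ i) j * coeff ([:d, c:] ^ (n - i)) (n - j) = 0"
      proof (cases "j > i")
        case True
        then show ?thesis using le(1) by (simp add: coeff_eq_0)
      next
        case False
        then have "n - j > n - i" using j assms by auto
        then show ?thesis using le(2) by (simp add: coeff_eq_0)
      qed
    qed
  qed (use assms in auto)
  finally show ?thesis by (simp add: coeff_linear_power)
qed

text \<open>The degrees of the substituted polynomials may drop one at a time but not both: their
  coefficients of index n are the values of the two forms at \<open>[a : c]\<close>, the image of
  infinity, where the forms have no common zero.\<close>

lemma rational_comp_right:
  assumes "rational R" "linear_fractional l"
  shows "rational (R \<circ> l)"
proof -
  obtain p q where pq: "coprime p q" "max (degree p) (degree q) > 0" "R = rat_map p q"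
    using assms(1) unfolding rational_def by blast
  obtain a b c d where l: "a * d - b * c \<noteq> 0" "l = mob a b c d" using linear_fractionalE[OF assms(2)] .
  define n where "n = max (degree p) (degree q)"
  define H where "H r = hom_poly n r [:b, a:] [:d, c:]" for r
  have le: "degree (H r) \<le> n" for r
    unfolding H_def hom_poly_def
    by (intro degree_sum_le) (auto intro!: order_trans[OF degree_smult_le] degree_linear_powers)
  have Hc: "coeff (H r) n = hom n r a c" for r
    unfolding H_def hom_poly_def hom_def coeff_sum
    by (intro sum.cong) (auto simp: coeff_linear_powers mult.assoc)
  have nz: "hom n p A B \<noteq> 0 \<or> hom n q A B \<noteq> 0" if "A \<noteq> 0 \<or> B \<noteq> 0" for A B
    by (rule hom_pair_nonzero[OF pq(1) n_def that])
  have hom_scale: "hom n r (s * A) (s * B) = s ^ n * hom n r A B" for r s A B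
    unfolding hom_def sum_distrib_left
    by (intro sum.cong) (auto simp: power_mult_distrib mult_ac simp flip: power_add)
  have cop: "coprime (H p) (H q)"
  proof (rule coprimeI_no_common_root)
    fix z assume 1: "poly (H q) z = 0"
    have "a * z + b * 1 \<noteq> 0 \<or> c * z + d * 1 \<noteq> 0" by (rule mob_mk_nonzero[OF l(1)]) simp
    then have "hom n p (b + z * a) (d + z * c) \<noteq> 0 \<or> hom n q (b + z * a) (d + z * c) \<noteq> 0"
      by (intro nz) (simp add: algebra_simps)
    then show "poly (H p) z \<noteq> 0" using 1 by (simp add: H_def poly_hom_poly)
  qed
  have "a \<noteq> 0 \<or> c \<noteq> 0" using l(1) by auto
  then have "coeff (H p) n \<noteq> 0 \<or> coeff (H q) n \<noteq> 0" unfolding Hc by (rule nz)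
  then have deg: "n = max (degree (H p)) (degree (H q))"
    using le[of p] le[of q] le_degree[of "H p" n] le_degree[of "H q" n] by auto
  have homH: "hom n (H r) A B = hom n r (a * A + b * B) (c * A + d * B)" for r A B
  proof (cases "B = 0")
    case True
    then show ?thesis using hom_scale[of r A a c] by (simp add: hom_0 Hc mult.commute)
  next
    case False
    have "hom n (H r) A B = B ^ n * hom n r (b + A / B * a) (d + A / B * c)"
      unfolding hom_nonzero[OF False le] by (simp add: H_def poly_hom_poly)
    also have "\<dots> = hom n r (B * (b + A / B * a)) (B * (d + A / B * c))" by (simp add: hom_scale)
    finally show ?thesis using False by (simp add: algebra_simps)
  qed
  have "(R \<circ> l) x = rat_map (H p) (H q) x" for x
  proof -
    obtain A B where AB: "A \<noteq> 0 \<or> B \<noteq> 0" "x = mk A B" using csphere_mk by blast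
    show ?thesis
      unfolding AB(2) o_apply l(2) pq(3) mob_mk[OF l(1) AB(1)]
        rat_map_mk[OF pq(1) n_def mob_mk_nonzero[OF l(1) AB(1)]] rat_map_mk[OF cop deg AB(1)] homH ..
  qed
  then have "R \<circ> l = rat_map (H p) (H q)" by (simp add: fun_eq_iff)
  moreover have "max (degree (H p)) (degree (H q)) > 0" using deg pq(2) unfolding n_def by linarith
  ultimately show ?thesis unfolding rational_def using cop by blast
qed

lemma twisted_rational:
  assumes "twisted_zolotarev R"
  shows "rational R"
proof -
  obtain p q where pq: "coprime p q" "R = rat_map p q"
    using assms unfolding twisted_zolotarev_def rational_of_degree_def by blast
  have "max (degree p) (degree q) > 0"
  proof (rule ccontr)
    assume "\<not> ?thesis"
    then have "degree p = 0" "degree q = 0" by auto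
    then obtain a b where ab: "p = [:a:]" "q = [:b:]" by (metis degree_eq_zeroE)
    have "R x = R Infty" for x by (cases x) (auto simp: pq(2) ab Let_def)
    then have "R ` critical_points R \<subseteq> {R Infty}" by auto
    then have "card (R ` critical_points R) \<le> card {R Infty}" by (intro card_mono) auto
    then show False using assms by (simp add: twisted_zolotarev_def)
  qed
  with pq show ?thesis unfolding rational_def by blast
qed

lemma conj_local_degree:
  assumes "rational R" "linear_fractional l" "linear_fractional l1"
  shows "local_degree (l \<circ> R \<circ> l1) x = local_degree R (l1 x)"
  using local_degree_comp[OF linear_fractional_rational[OF assms(2)] rational_comp_right[OF assms(1,3)], of x]
    local_degree_comp[OF assms(1) linear_fractional_rational[OF assms(3)], of x]
  by (simp add: linear_fractional_local_degree assms o_assoc)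

lemma conj_critical:
  assumes "rational R" "linear_fractional l" "linear_fractional l1"
  shows "(l \<circ> R \<circ> l1) ` critical_points (l \<circ> R \<circ> l1) = l ` (R ` critical_points R)"
proof -
  have c: "x \<in> critical_points (l \<circ> R \<circ> l1) \<longleftrightarrow> l1 x \<in> critical_points R" for x
    by (simp add: critical_points_def conj_local_degree[OF assms])
  have "l1 ` critical_points (l \<circ> R \<circ> l1) = critical_points R"
    using c linear_fractional_bij[OF assms(3)] by (auto simp: bij_def surj_def image_iff) metis
  then show ?thesis by (metis image_comp)
qed

lemma twisted_conj:
  assumes R: "twisted_zolotarev R" and l: "linear_fractional l" "linear_fractional l1"
  shows "twisted_zolotarev (l \<circ> R \<circ> l1)"
proof -
  note r = twisted_rational[OF R]
  have "rational (l \<circ> R \<circ> l1)" using rational_comp_left[OF rational_comp_right[OF r l(2)] l(1)] by (simp add: o_assoc)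
  then have "\<exists>n. rational_of_degree n (l \<circ> R \<circ> l1)" unfolding rational_def rational_of_degree_def by blast
  moreover have "\<forall>x\<in>critical_points (l \<circ> R \<circ> l1). local_degree (l \<circ> R \<circ> l1) x = 2"
    using R by (simp add: critical_points_def conj_local_degree[OF r l] twisted_zolotarev_def)
  moreover have "card ((l \<circ> R \<circ> l1) ` critical_points (l \<circ> R \<circ> l1)) = 4"
    unfolding conj_critical[OF r l]
    using R card_image[OF inj_on_subset[OF bij_is_inj[OF linear_fractional_bij[OF l(1)]]], of "R ` critical_points R"]
    by (simp add: twisted_zolotarev_def)
  ultimately show ?thesis unfolding twisted_zolotarev_def by blast
qed

lemma same_class_refl: "same_class R R"
  unfolding same_class_def using linear_fractional_id by (metis comp_id id_comp)

lemma same_class_sym: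
  assumes "same_class R1 R2"
  shows "same_class R2 R1"
proof -
  obtain l l1 where l: "linear_fractional l" "linear_fractional l1" "R2 = l \<circ> R1 \<circ> l1"
    using assms unfolding same_class_def by blast
  obtain k where k: "linear_fractional k" "l \<circ> k = id" "k \<circ> l = id" using linear_fractional_inverse[OF l(1)] .
  obtain k1 where k1: "linear_fractional k1" "l1 \<circ> k1 = id" "k1 \<circ> l1 = id" using linear_fractional_inverse[OF l(2)] .
  have "k \<circ> R2 \<circ> k1 = (k \<circ> l) \<circ> R1 \<circ> (l1 \<circ> k1)" unfolding l(3) by (simp add: o_assoc)
  then have "R1 = k \<circ> R2 \<circ> k1" using k k1 by simp
  then show ?thesis unfolding same_class_def using k(1) k1(1) by blast
qed

lemma same_class_trans:
  assumes "same_class R1 R2" "same_class R2 R3"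
  shows "same_class R1 R3"
proof -
  obtain l l1 where l: "linear_fractional l" "linear_fractional l1" "R2 = l \<circ> R1 \<circ> l1"
    using assms unfolding same_class_def by blast
  obtain k k1 where k: "linear_fractional k" "linear_fractional k1" "R3 = k \<circ> R2 \<circ> k1"
    using assms unfolding same_class_def by blast
  have "R3 = (k \<circ> l) \<circ> R1 \<circ> (l1 \<circ> k1)" unfolding l(3) k(3) by (simp add: o_assoc)
  then show ?thesis unfolding same_class_def using linear_fractional_comp l k by blast
qed

section \<open>Local degrees and orders of polynomials\<close>

lemma zorder_quotient:
  fixes N D :: "complex poly"
  assumes N: "N \<noteq> 0" and D: "poly D z \<noteq> 0"
    and f: "\<And>t. t \<noteq> 0 \<Longrightarrow> poly D (z + t) \<noteq> 0 \<Longrightarrow> f t = poly N (z + t) / poly D (z + t)"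
  shows "zorder f 0 = int (order z N)"
proof -
  obtain r where r: "N = [:- z, 1:] ^ order z N * r" "\<not> [:- z, 1:] dvd r" using order_decomp[OF N] by blast
  have rz: "poly r z \<noteq> 0" using r(2) by (simp add: poly_eq_0_iff_dvd)
  show ?thesis
  proof (rule zorder_eqI[where S = "{t. poly D (z + t) \<noteq> 0}" and g = "\<lambda>t. poly r (z + t) / poly D (z + t)"])
    show "open {t. poly D (z + t) \<noteq> 0}" by (intro open_Collect_neq continuous_intros)
    show "(\<lambda>t. poly r (z + t) / poly D (z + t)) holomorphic_on {t. poly D (z + t) \<noteq> 0}"
      by (intro holomorphic_intros) auto
    fix t assume t: "t \<in> {t. poly D (z + t) \<noteq> 0}" "t \<noteq> 0"
    have "poly N (z + t) = t ^ order z N * poly r (z + t)"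
      by (subst r(1)) (simp add: poly_power)
    then show "f t = poly r (z + t) / poly D (z + t) * (t - 0) powi int (order z N)"
      using f[of t] t by simp
  qed (use D rz in auto)
qed

text \<open>Its roots are the finite points of the fibre over \<open>x\<close>, with their local
  degrees as multiplicities.\<close>

definition lam :: "complex poly \<Rightarrow> complex poly \<Rightarrow> csphere \<Rightarrow> complex poly" where
  "lam p q x = (case x of Pt v \<Rightarrow> p - smult v q | Infty \<Rightarrow> q)"

lemma lam_nonzero:
  assumes "coprime p q" "max (degree p) (degree q) > 0"
  shows "lam p q x \<noteq> 0"
  using coprime_nonconst_comb[OF assms] by (auto simp: lam_def split: csphere.split)

lemma lam_zero_iff:
  assumes "coprime p q"
  shows "poly (lam p q x) z = 0 \<longleftrightarrow> rat_map p q (Pt z) = x"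
  using coprime_no_common_root[OF assms, of z] by (cases x) (auto simp: lam_def field_simps)

lemma local_degree_order:
  assumes pq: "coprime p q" "max (degree p) (degree q) > 0"
  shows "local_degree (rat_map p q) (Pt z) = int (order z (lam p q (rat_map p q (Pt z))))"
proof (cases "rat_map p q (Pt z)")
  case (Pt v)
  then have qz: "poly q z \<noteq> 0" by (auto split: if_splits)
  show ?thesis
    unfolding local_degree_def Pt
  proof (rule zorder_quotient[OF lam_nonzero[OF pq] qz])
    fix t assume "poly q (z + t) \<noteq> 0"
    then show "local_coord (Pt v) (rat_map p q (local_param (Pt z) t)) = poly (lam p q (Pt v)) (z + t) / poly q (z + t)"
      by (simp add: lam_def diff_divide_distrib)
  qed
next
  case Infty
  then have "poly q z = 0" by (auto split: if_splits)
  then have pz: "poly p z \<noteq> 0" using coprime_no_common_root[OF pq(1)] by blast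
  show ?thesis
    unfolding local_degree_def Infty
  proof (rule zorder_quotient[OF lam_nonzero[OF pq] pz])
    fix t assume "poly p (z + t) \<noteq> 0"
    then show "local_coord Infty (rat_map p q (local_param (Pt z) t)) = poly (lam p q Infty) (z + t) / poly p (z + t)"
      by (simp add: lam_def)
  qed
qed

text \<open>The term N' D has order exactly one less than N, while N D' has at least the order of
  N.\<close>

lemma wronskian_order:
  assumes N: "N \<noteq> 0" and root: "poly N z = 0" and D: "poly D z \<noteq> 0"
  shows "wronskian N D \<noteq> 0" "order z (wronskian N D) = order z N - 1"
proof -
  define m where "m = order z (pderiv N)"
  have oN: "order z N = Suc m" unfolding m_def by (rule order_pderiv[OF N root])
  have N': "pderiv N \<noteq> 0"
  proof
    assume "pderiv N = 0"
    then obtain c where "N = [:c:]" by (meson pderiv_iszero)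
    then show False using N root by simp
  qed
  have D0: "D \<noteq> 0" using D by auto
  have o1: "order z (pderiv N * D) = m"
    using N' D0 D by (simp add: order_mult m_def order_0I)
  have d1: "[:- z, 1:] ^ m dvd pderiv N * D" using o1 by (metis order_1)
  have "[:- z, 1:] ^ Suc m dvd N" using oN by (metis order_1)
  then have d2: "[:- z, 1:] ^ Suc m dvd N * pderiv D" by (rule dvd_mult2)
  have nd: "\<not> [:- z, 1:] ^ Suc m dvd wronskian N D"
  proof
    assume "[:- z, 1:] ^ Suc m dvd wronskian N D"
    then have "[:- z, 1:] ^ Suc m dvd wronskian N D + N * pderiv D" using d2 by (rule dvd_add)
    then have "[:- z, 1:] ^ Suc m dvd pderiv N * D" by (simp add: wronskian_def)
    then show False using o1 N' D0 order_divides[of z "Suc m" "pderiv N * D"] by auto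
  qed
  then show "wronskian N D \<noteq> 0" by auto
  have "[:- z, 1:] ^ m dvd N * pderiv D" using d2 by (rule power_le_dvd) simp
  then have "[:- z, 1:] ^ m dvd wronskian N D" unfolding wronskian_def using d1 by (intro dvd_diff)
  then have "order z (wronskian N D) = m" using nd by (rule order_unique_lemma)
  then show "order z (wronskian N D) = order z N - 1" using oN by simp
qed

lemma order_uminus_poly: "order z (- p) = order z (p :: complex poly)"
  using order_smult[of "-1" z p] by simp

text \<open>The Wronskian is unchanged by p -> p - v q and only changes sign when p and q are
  exchanged. So the polynomial of the fibre through z may serve as numerator, whether the value is
  finite or not.\<close>

lemma wronskian_order_local_degree:
  assumes pq: "coprime p q" "max (degree p) (degree q) > 0"
  shows "wronskian p q \<noteq> 0" "int (order z (wronskian p q)) = local_degree (rat_map p q) (Pt z) - 1"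
proof -
  have main: "wronskian p q \<noteq> 0 \<and> int (order z (wronskian p q)) = local_degree (rat_map p q) (Pt z) - 1"
  proof (cases "rat_map p q (Pt z)")
    case (Pt v)
    then have qz: "poly q z \<noteq> 0" by (auto split: if_splits)
    have root: "poly (lam p q (Pt v)) z = 0" using lam_zero_iff[OF pq(1)] Pt by simp
    have eq: "wronskian (lam p q (Pt v)) q = wronskian p q"
      by (simp add: wronskian_def lam_def pderiv_diff pderiv_smult algebra_simps)
    note w = wronskian_order[OF lam_nonzero[OF pq] root qz, unfolded eq]
    have "order z (lam p q (Pt v)) > 0" using root lam_nonzero[OF pq] by (simp add: order_gt_0_iff)
    then show ?thesis using w local_degree_order[OF pq, of z] Pt by (auto simp: of_nat_diff)
  next
    case Infty
    then have root: "poly (lam p q Infty) z = 0" using lam_zero_iff[OF pq(1)] by simp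
    then have pz: "poly p z \<noteq> 0" using coprime_no_common_root[OF pq(1)] by (auto simp: lam_def)
    have eq: "wronskian (lam p q Infty) p = - wronskian p q"
      by (simp add: wronskian_def lam_def algebra_simps)
    note w = wronskian_order[OF lam_nonzero[OF pq] root pz, unfolded eq order_uminus_poly]
    have "order z (lam p q Infty) > 0" using root lam_nonzero[OF pq] by (simp add: order_gt_0_iff)
    then show ?thesis using w local_degree_order[OF pq, of z] Infty by (auto simp: of_nat_diff)
  qed
  then show "wronskian p q \<noteq> 0" "int (order z (wronskian p q)) = local_degree (rat_map p q) (Pt z) - 1" by auto
qed

lemma local_degree_at_infinity:
  assumes lt: "degree q < degree p" and q: "q \<noteq> 0"
  shows "local_degree (rat_map p q) Infty = int (degree p - degree q)"
proof -
  have RI: "rat_map p q Infty = Infty" using lt by (simp add: Let_def max_def coeff_eq_0)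
  have p: "p \<noteq> 0" using lt by auto
  show ?thesis
    unfolding local_degree_def RI
  proof (rule zorder_eqI[where S = "{t. poly (reflect_poly p) t \<noteq> 0}"
        and g = "\<lambda>t. poly (reflect_poly q) t / poly (reflect_poly p) t"])
    show "open {t. poly (reflect_poly p) t \<noteq> 0}" by (intro open_Collect_neq continuous_intros)
    show "(\<lambda>t. poly (reflect_poly q) t / poly (reflect_poly p) t) holomorphic_on {t. poly (reflect_poly p) t \<noteq> 0}"
      by (intro holomorphic_intros) auto
    fix t assume t: "t \<in> {t. poly (reflect_poly p) t \<noteq> 0}" "t \<noteq> 0"
    have rp: "poly (reflect_poly p) t = t ^ degree p * poly p (1 / t)"
      "poly (reflect_poly q) t = t ^ degree q * poly q (1 / t)"
      using poly_reflect_poly_nz[OF t(2)] by (simp_all add: inverse_eq_divide)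
    have pz: "poly p (1 / t) \<noteq> 0" using t rp(1) by auto
    have "local_coord Infty (rat_map p q (local_param Infty t)) = poly q (1 / t) / poly p (1 / t)"
      using t(2) pz by simp
    also have "\<dots> = poly (reflect_poly q) t / poly (reflect_poly p) t * t ^ (degree p - degree q)"
      unfolding rp using t(2) pz lt by (simp add: power_diff field_simps)
    finally show "local_coord Infty (rat_map p q (local_param Infty t))
        = poly (reflect_poly q) t / poly (reflect_poly p) t * (t - 0) powi int (degree p - degree q)"
      by simp
  qed (use p q in auto)
qed

text \<open>The leading terms of p' q and p q' carry the factors deg p and deg q; these differ, so
  nothing cancels.\<close>

lemma degree_wronskian:
  fixes p q :: "complex poly"
  assumes lt: "degree q < degree p" and q: "q \<noteq> 0"
  shows "degree (wronskian p q) = degree p + degree q - 1"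
proof -
  define n where "n = degree p + degree q - 1"
  have p: "p \<noteq> 0" using lt by auto
  have dp: "degree (pderiv p) = degree p - 1" "degree (pderiv q) = degree q - 1" by (rule degree_pderiv)+
  have n1: "n = degree (pderiv p) + degree q" using dp lt by (simp add: n_def)
  have c1: "coeff (pderiv p * q) n = of_nat (degree p) * lead_coeff p * lead_coeff q"
  proof -
    have "coeff (pderiv p) (degree p - 1) = of_nat (degree p) * lead_coeff p"
      using lt by (simp add: coeff_pderiv)
    moreover have "coeff (pderiv p * q) n = lead_coeff (pderiv p) * lead_coeff q"
      unfolding n1 by (rule coeff_mult_degree_sum)
    ultimately show ?thesis by (simp add: dp)
  qed
  have c2: "coeff (p * pderiv q) n = of_nat (degree q) * lead_coeff p * lead_coeff q \<and> degree (p * pderiv q) \<le> n"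
  proof (cases "degree q = 0")
    case True
    then obtain c where "q = [:c:]" by (metis degree_eq_zeroE)
    then show ?thesis by simp
  next
    case False
    have n2: "n = degree p + degree (pderiv q)" using dp False by (simp add: n_def)
    have "coeff (pderiv q) (degree q - 1) = of_nat (degree q) * lead_coeff q"
      using False by (simp add: coeff_pderiv)
    moreover have "coeff (p * pderiv q) n = lead_coeff p * lead_coeff (pderiv q)"
      unfolding n2 by (rule coeff_mult_degree_sum)
    ultimately have "coeff (p * pderiv q) n = of_nat (degree q) * lead_coeff p * lead_coeff q"
      by (simp add: dp)
    moreover have "degree (p * pderiv q) \<le> n" unfolding n2 by (rule degree_mult_le)
    ultimately show ?thesis by blast
  qed
  have "coeff (wronskian p q) n = (of_nat (degree p) - of_nat (degree q)) * (lead_coeff p * lead_coeff q)"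
    unfolding wronskian_def using c1 c2 by (simp add: algebra_simps)
  moreover have "(of_nat (degree p) :: complex) - of_nat (degree q) \<noteq> 0"
    using lt by (metis eq_iff_diff_eq_0 nat_neq_iff of_nat_eq_iff)
  ultimately have "coeff (wronskian p q) n \<noteq> 0" using p q by simp
  moreover have "degree (wronskian p q) \<le> n"
    unfolding wronskian_def using c2 degree_mult_le[of "pderiv p" q] n1 by (intro degree_diff_le) auto
  ultimately show ?thesis using le_degree[of "wronskian p q" n] unfolding n_def by simp
qed

lemma dvd_of_orders:
  fixes a b :: "complex poly"
  assumes "a \<noteq> 0" "b \<noteq> 0" "\<And>z. order z a \<le> order z b"
  shows "a dvd b"
  using assms
proof (induction "degree a" arbitrary: a b)
  case 0
  then have "is_unit a" by (simp add: is_unit_iff_degree)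
  then show ?case by (rule unit_imp_dvd)
next
  case (Suc n)
  obtain z where z: "poly a z = 0"
    using fundamental_theorem_of_algebra[of a] constant_degree[of a] Suc(2) by auto
  then have "order z a > 0" using Suc(3) by (simp add: order_gt_0_iff)
  then have "poly b z = 0" using Suc(5)[of z] Suc(4) by (simp add: order_root)
  with z obtain a' b' where ab: "a = [:- z, 1:] * a'" "b = [:- z, 1:] * b'"
    unfolding poly_eq_0_iff_dvd by (elim dvdE)
  have nz: "a' \<noteq> 0" "b' \<noteq> 0" using ab Suc(3,4) by auto
  have "a' dvd b'"
  proof (rule Suc(1)[OF _ nz])
    show "n = degree a'" using Suc(2) nz unfolding ab by (subst (asm) degree_mult_eq) auto
    fix w
    have "order w [:- z, 1:] + order w a' \<le> order w [:- z, 1:] + order w b'"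
    proof -
      have "order w a = order w [:- z, 1:] + order w a'" unfolding ab(1) by (rule order_mult) (use Suc(3) ab(1) in metis)
      moreover have "order w b = order w [:- z, 1:] + order w b'" unfolding ab(2) by (rule order_mult) (use Suc(4) ab(2) in metis)
      ultimately show ?thesis using Suc(5)[of w] by simp
    qed
    then show "order w a' \<le> order w b'" by simp
  qed
  then show ?case unfolding ab by (rule mult_dvd_mono[OF dvd_refl])
qed

section \<open>The differential equation of a twisted fraction\<close>

lemma cubic_of_roots:
  fixes v1 v2 v3 :: complex
  assumes "v1 \<noteq> v2" "v1 \<noteq> v3" "v2 \<noteq> v3"
  defines "g \<equiv> [:- v1, 1:] * [:- v2, 1:] * [:- v3, 1:]"
  shows "cubic g" "hat g A B = B * (A - v1 * B) * (A - v2 * B) * (A - v3 * B)"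
proof -
  have d: "degree g = 3" unfolding g_def by (simp add: degree_mult_eq)
  have gz: "poly g z = (z - v1) * (z - v2) * (z - v3)" for z by (simp add: g_def algebra_simps)
  have g'z: "poly (pderiv g) z = (z - v2) * (z - v3) + (z - v1) * (z - v3) + (z - v1) * (z - v2)" for z
    unfolding g_def by (simp add: pderiv_mult pderiv_pCons algebra_simps)
  show "cubic g"
    unfolding cubic_def
  proof (intro conjI allI impI d)
    fix z assume "poly g z = 0"
    then show "poly (pderiv g) z \<noteq> 0" unfolding gz g'z using assms(1-3) by auto
  qed
  show "hat g A B = B * (A - v1 * B) * (A - v2 * B) * (A - v3 * B)"
  proof (cases "B = 0")
    case False
    then have "hat g A B = B ^ 4 * ((A / B - v1) * (A / B - v2) * (A / B - v3))"
      by (simp add: hat_eq[OF d] gz)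
    also have "\<dots> = B * (B * (A / B - v1)) * (B * (A / B - v2)) * (B * (A / B - v3))"
      by (simp add: power_numeral_reduce)
    finally show ?thesis using False by (simp add: right_diff_distrib mult.commute)
  qed (simp add: hat_def)
qed

text \<open>The product T = q (p - v1 q)(p - v2 q)(p - v3 q) vanishes at the finite points over the
  critical values, to the order d of the local degree; the Wronskian W vanishes to order d - 1. As d
  is at most 2, W^2 divides T, and the quotient \<open>P\<close> has simple zeros at the points with
  d = 1. For degrees m > n of p and q it has degree 3m + n - 2(m + n - 1) = m - n + 2, and m - n is
  the local degree at infinity.\<close>

lemma twisted_normal_form:
  assumes R: "twisted_zolotarev R" and inf: "R Infty = Infty" "Infty \<in> R ` critical_points R"
  obtains p q P g where "coprime p q" "R = rat_map p q" "wronskian p q \<noteq> 0" "cubic g"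
    "\<And>z. (poly (wronskian p q) z) ^ 2 * poly P z = hat g (poly p z) (poly q z)"
    "int (degree P) = local_degree R Infty + 2"
    "\<And>z. poly P z = 0 \<Longrightarrow> poly (pderiv P) z \<noteq> 0 \<and> R (Pt z) \<in> R ` critical_points R \<and> local_degree R (Pt z) = 1"
proof -
  obtain p q where pq: "coprime p q" "max (degree p) (degree q) > 0" and Rpq: "R = rat_map p q"
    using twisted_rational[OF R] unfolding rational_def by blast
  define V where "V = R ` critical_points R"
  have V4: "card V = 4" using R by (simp add: twisted_zolotarev_def V_def)
  then have Vf: "finite V" using card.infinite by fastforce
  have "card (V - {Infty}) = 3" using V4 Vf inf(2) by (simp add: V_def)
  then obtain x1 x2 x3 where x: "V - {Infty} = {x1, x2, x3}" "x1 \<noteq> x2" "x1 \<noteq> x3" "x2 \<noteq> x3"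
    unfolding card_3_iff by auto
  have "x1 \<noteq> Infty" "x2 \<noteq> Infty" "x3 \<noteq> Infty" using x(1) by auto
  then obtain v1 v2 v3 where v: "x1 = Pt v1" "x2 = Pt v2" "x3 = Pt v3" by (metis csphere.exhaust)
  have V: "V = {Infty, Pt v1, Pt v2, Pt v3}" using x(1) inf(2) v unfolding V_def by blast
  have vd: "v1 \<noteq> v2" "v1 \<noteq> v3" "v2 \<noteq> v3" using x v by auto
  define g where "g = [:- v1, 1:] * [:- v2, 1:] * [:- v3, 1:]"
  note g = cubic_of_roots[OF vd, folded g_def]
  have ld_pos: "local_degree R x > 0" for x by (rule local_degree_pos[OF twisted_rational[OF R]])
  have ld2: "local_degree R x = 1 \<or> local_degree R x = 2 \<and> R x \<in> V" for x
  proof (cases "local_degree R x > 1")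
    case True
    then have "x \<in> critical_points R" by (simp add: critical_points_def)
    then show ?thesis using R by (auto simp: twisted_zolotarev_def V_def)
  next
    case False
    then show ?thesis using ld_pos[of x] by linarith
  qed
  have lt: "degree q < degree p"
  proof -
    have c: "coeff q (max (degree p) (degree q)) = 0" using inf(1) unfolding Rpq by (simp add: Let_def split: if_splits)
    show ?thesis
    proof (rule ccontr)
      assume "\<not> ?thesis"
      then have "max (degree p) (degree q) = degree q" by simp
      with c coprime_nonconst_comb(1)[OF pq] show False by simp
    qed
  qed
  have q0: "q \<noteq> 0" by (rule coprime_nonconst_comb(1)[OF pq])
  define W where "W = wronskian p q"
  have W0: "W \<noteq> 0" and Word: "int (order z W) = local_degree R (Pt z) - 1" for z
    unfolding W_def Rpq using wronskian_order_local_degree[OF pq] by auto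
  define l0 l1 l2 l3 where "l0 = lam p q Infty" and "l1 = lam p q (Pt v1)" and "l2 = lam p q (Pt v2)" and "l3 = lam p q (Pt v3)"
  have l_nz: "l0 \<noteq> 0" "l1 \<noteq> 0" "l2 \<noteq> 0" "l3 \<noteq> 0"
    unfolding l0_def l1_def l2_def l3_def by (rule lam_nonzero[OF pq])+
  define T where "T = l0 * l1 * l2 * l3"
  have T0: "T \<noteq> 0" using l_nz by (simp add: T_def)
  have ord_lam: "int (order z (lam p q x)) = (if R (Pt z) = x then local_degree R (Pt z) else 0)" for z x
  proof (cases "R (Pt z) = x")
    case True
    then show ?thesis using local_degree_order[OF pq, of z] by (simp add: Rpq)
  next
    case False
    then have "poly (lam p q x) z \<noteq> 0" using lam_zero_iff[OF pq(1)] by (simp add: Rpq)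
    then show ?thesis using False by (simp add: order_0I)
  qed
  have Tord: "int (order z T) = (if R (Pt z) \<in> V then local_degree R (Pt z) else 0)" for z
  proof -
    have "order z T = order z l0 + order z l1 + order z l2 + order z l3"
      unfolding T_def using l_nz by (simp add: order_mult)
    then have "int (order z T) = (if R (Pt z) = Infty then local_degree R (Pt z) else 0)
       + (if R (Pt z) = Pt v1 then local_degree R (Pt z) else 0)
       + (if R (Pt z) = Pt v2 then local_degree R (Pt z) else 0)
       + (if R (Pt z) = Pt v3 then local_degree R (Pt z) else 0)"
      unfolding l0_def l1_def l2_def l3_def by (simp add: ord_lam)
    then show ?thesis unfolding V using vd by auto
  qed
  have "W ^ 2 dvd T"
  proof (rule dvd_of_orders[OF _ T0])
    show "W ^ 2 \<noteq> 0" using W0 by simp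
    fix z
    have "order z (W ^ 2) = 2 * order z W" using W0 by (simp add: power2_eq_square order_mult)
    then have "int (order z (W ^ 2)) = 2 * (local_degree R (Pt z) - 1)" using Word[of z] by simp
    also have "\<dots> \<le> int (order z T)" unfolding Tord using ld2[of "Pt z"] by auto
    finally show "order z (W ^ 2) \<le> order z T" by simp
  qed
  then obtain P where P: "T = W ^ 2 * P" by (rule dvdE)
  have P0: "P \<noteq> 0" using P T0 by auto
  have Pord: "int (order z P) = int (order z T) - 2 * (local_degree R (Pt z) - 1)" for z
  proof -
    have "order z T = 2 * order z W + order z P"
      unfolding P using W0 P0 by (simp add: power2_eq_square order_mult)
    then show ?thesis using Word[of z] by simp
  qed
  have dT: "degree T = 3 * degree p + degree q"
  proof -
    have "degree (p - smult v q) = degree p" for v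
    proof -
      have "degree (smult v q) < degree p" using lt degree_smult_le[of v q] by linarith
      then show ?thesis using degree_add_eq_left[of "- smult v q" p] by simp
    qed
    then show ?thesis using l_nz unfolding T_def l0_def l1_def l2_def l3_def lam_def by (simp add: degree_mult_eq)
  qed
  have dW: "degree W = degree p + degree q - 1" unfolding W_def by (rule degree_wronskian[OF lt q0])
  have "degree T = 2 * degree W + degree P" unfolding P using W0 P0 by (simp add: degree_mult_eq degree_power_eq)
  then have dP: "int (degree P) = local_degree R Infty + 2"
    using dT dW lt local_degree_at_infinity[OF lt q0] by (simp add: Rpq of_nat_diff)
  have "(poly W z) ^ 2 * poly P z = hat g (poly p z) (poly q z)" for z
  proof -
    have "(poly W z) ^ 2 * poly P z = poly T z" unfolding P by (simp add: poly_power)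
    also have "\<dots> = hat g (poly p z) (poly q z)"
      unfolding g(2) T_def l0_def l1_def l2_def l3_def lam_def by simp
    finally show ?thesis .
  qed
  moreover have "poly (pderiv P) z \<noteq> 0 \<and> R (Pt z) \<in> V \<and> local_degree R (Pt z) = 1" if z: "poly P z = 0" for z
  proof -
    have pos: "order z P > 0" using z P0 by (simp add: order_gt_0_iff)
    have RV: "R (Pt z) \<in> V"
    proof (rule ccontr)
      assume n: "R (Pt z) \<notin> V"
      then have "local_degree R (Pt z) = 1" using ld2 by blast
      then show False using Pord[of z] Tord[of z] n pos by simp
    qed
    then have e: "int (order z P) = 2 - local_degree R (Pt z)" using Pord[of z] Tord[of z] by simp
    then have l1: "local_degree R (Pt z) = 1" using pos ld2[of "Pt z"] by auto
    then have "order z P = 1" using e by simp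
    moreover have "order z P = Suc (order z (pderiv P))" by (rule order_pderiv[OF P0 z])
    ultimately have "order z (pderiv P) = 0" by simp
    moreover have "pderiv P \<noteq> 0"
    proof
      assume "pderiv P = 0"
      then obtain c where "P = [:c:]" by (meson pderiv_iszero)
      then show False using P0 z by simp
    qed
    ultimately have "poly (pderiv P) z \<noteq> 0" by (simp add: order_root)
    with RV l1 show ?thesis by blast
  qed
  ultimately show thesis
    using that[OF pq(1) Rpq _ g(1) _ dP] W0 unfolding W_def V_def by blast
qed

text \<open>Puts a chosen point and its critical value at infinity, as the polynomial normal form
  demands; local degrees and the points over critical values are transported along
  \<open>l1\<close>.\<close>

lemma twisted_move:
  assumes R: "twisted_zolotarev R" and x: "R x \<in> R ` critical_points R"
  obtains l l1 where "linear_fractional l" "linear_fractional l1" "twisted_zolotarev (l \<circ> R \<circ> l1)"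
    "l1 Infty = x" "(l \<circ> R \<circ> l1) Infty = Infty"
    "Infty \<in> (l \<circ> R \<circ> l1) ` critical_points (l \<circ> R \<circ> l1)"
    "\<And>y. local_degree (l \<circ> R \<circ> l1) y = local_degree R (l1 y)"
    "\<And>y. (l \<circ> R \<circ> l1) y \<in> (l \<circ> R \<circ> l1) ` critical_points (l \<circ> R \<circ> l1) \<longleftrightarrow> R (l1 y) \<in> R ` critical_points R"
proof -
  obtain k1 where k1: "linear_fractional k1" "k1 x = Infty" by (rule linear_fractional_move)
  obtain l1 where l1: "linear_fractional l1" "k1 \<circ> l1 = id" "l1 \<circ> k1 = id" using linear_fractional_inverse[OF k1(1)] .
  obtain l where l: "linear_fractional l" "l (R x) = Infty" by (rule linear_fractional_move)
  have l1x: "l1 Infty = x" using l1(3) k1(2) by (metis comp_apply id_apply)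
  note r = twisted_rational[OF R]
  note cc = conj_critical[OF r l(1) l1(1)]
  have "Infty \<in> (l \<circ> R \<circ> l1) ` critical_points (l \<circ> R \<circ> l1)"
    unfolding cc using x l(2) by (metis image_eqI)
  moreover have "(l \<circ> R \<circ> l1) y \<in> (l \<circ> R \<circ> l1) ` critical_points (l \<circ> R \<circ> l1) \<longleftrightarrow> R (l1 y) \<in> R ` critical_points R" for y
    unfolding cc using inj_image_mem_iff[OF bij_is_inj[OF linear_fractional_bij[OF l(1)]]] by simp
  ultimately show thesis
    using that[OF l(1) l1(1) twisted_conj[OF R l(1) l1(1)] l1x] l(2) l1x conj_local_degree[OF r l(1) l1(1)] by simp
qed

text \<open>With a critical point at infinity the polynomial \<open>P\<close> has degree 4, hence a root.\<close>

lemma twisted_unramified_point: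
  assumes R: "twisted_zolotarev R"
  shows "\<exists>x. R x \<in> R ` critical_points R \<and> local_degree R x = 1"
proof -
  have "critical_points R \<noteq> {}" using R by (auto simp: twisted_zolotarev_def)
  then obtain x0 where x0: "x0 \<in> critical_points R" by blast
  then have "R x0 \<in> R ` critical_points R" by blast
  from twisted_move[OF R this] obtain l l1 where l: "linear_fractional l" "linear_fractional l1"
    and R': "twisted_zolotarev (l \<circ> R \<circ> l1)" "l1 Infty = x0" "(l \<circ> R \<circ> l1) Infty = Infty"
    "Infty \<in> (l \<circ> R \<circ> l1) ` critical_points (l \<circ> R \<circ> l1)"
    "\<And>y. local_degree (l \<circ> R \<circ> l1) y = local_degree R (l1 y)"
    "\<And>y. (l \<circ> R \<circ> l1) y \<in> (l \<circ> R \<circ> l1) ` critical_points (l \<circ> R \<circ> l1) \<longleftrightarrow> R (l1 y) \<in> R ` critical_points R"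
    by blast
  from twisted_normal_form[OF R'(1,3,4)] obtain P where
    dP: "int (degree P) = local_degree (l \<circ> R \<circ> l1) Infty + 2" and
    P: "\<And>z. poly P z = 0 \<Longrightarrow> (l \<circ> R \<circ> l1) (Pt z) \<in> (l \<circ> R \<circ> l1) ` critical_points (l \<circ> R \<circ> l1)
        \<and> local_degree (l \<circ> R \<circ> l1) (Pt z) = 1"
    by metis
  have "local_degree (l \<circ> R \<circ> l1) Infty > 0" using local_degree_pos[OF twisted_rational[OF R'(1)]] .
  then have "degree P \<noteq> 0" using dP by auto
  then obtain z where z: "poly P z = 0"
    using fundamental_theorem_of_algebra[of P] constant_degree[of P] by auto
  have "R (l1 (Pt z)) \<in> R ` critical_points R" using P[OF z] R'(6)[of "Pt z"] by metis
  moreover have "local_degree R (l1 (Pt z)) = 1" using P[OF z] R'(5)[of "Pt z"] by metis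
  ultimately show ?thesis by blast
qed

section \<open>From a twisted fraction to its lattices\<close>

lemma affine_mob:
  assumes "a \<noteq> 0"
  shows "rat_map [:b, a:] [:1, 0:] = mob a b 0 1" "linear_fractional (mob a b 0 1)" "mob a b 0 1 Infty = Infty"
  using assms linear_fractional_mob[of a 1 b 0] by (auto simp: mob_def Let_def)

text \<open>With an unramified point at infinity \<open>P\<close> has degree 3. A global solution F
  for \<open>P\<close> and its image \<open>S \<circ> F\<close> are both affine images of
  Weierstrass functions of their pole lattices M and L, and M lies in L because S fixes
  infinity.\<close>

lemma twisted_from_lattices:
  assumes R: "twisted_zolotarev R"
  shows "\<exists>(L, M)\<in>lattice_pairs. same_class (lattice_fraction L M) R"
proof -
  obtain x where x: "R x \<in> R ` critical_points R" "local_degree R x = 1"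
    using twisted_unramified_point[OF R] by blast
  from twisted_move[OF R x(1)] obtain l l1 where l: "linear_fractional l" "linear_fractional l1"
    and R': "twisted_zolotarev (l \<circ> R \<circ> l1)" "l1 Infty = x" "(l \<circ> R \<circ> l1) Infty = Infty"
    "Infty \<in> (l \<circ> R \<circ> l1) ` critical_points (l \<circ> R \<circ> l1)"
    "\<And>y. local_degree (l \<circ> R \<circ> l1) y = local_degree R (l1 y)"
    by blast
  define S where "S = l \<circ> R \<circ> l1"
  have S: "twisted_zolotarev S" "S Infty = Infty" "Infty \<in> S ` critical_points S" "local_degree S Infty = 1"
    using R' x(2) unfolding S_def by auto
  have RS: "same_class R S" unfolding same_class_def S_def using l by blast
  obtain p q P g where pq: "coprime p q" "S = rat_map p q" "wronskian p q \<noteq> 0" and g: "cubic g"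
    and id: "\<And>z. (poly (wronskian p q) z) ^ 2 * poly P z = hat g (poly p z) (poly q z)"
    and dP: "int (degree P) = local_degree S Infty + 2"
    and Pr: "\<And>z. poly P z = 0 \<Longrightarrow> poly (pderiv P) z \<noteq> 0 \<and> S (Pt z) \<in> S ` critical_points S \<and> local_degree S (Pt z) = 1"
    using twisted_normal_form[OF S(1-3)] by metis
  have P: "cubic P" unfolding cubic_def using dP S(4) Pr by auto
  obtain F where F: "gsol P F" "F 0 = Infty" using global_solution[OF P] by blast
  define G where "G = (\<lambda>t. rat_map p q (F (1 * t + 0)))"
  have G: "gsol g G" unfolding G_def
    by (rule gsol_compose[OF F(1) g _ pq(1,3)]) (use id in auto)
  have GS: "G t = S (F t)" for t by (simp add: G_def pq(2))
  have G0: "G 0 = Infty" using F(2) S(2) by (simp add: GS)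
  define M where "M = {u. F u = Infty}"
  define L where "L = {u. G u = Infty}"
  have lat: "rank_two_lattice M" "rank_two_lattice L"
    unfolding M_def L_def by (rule gsol_poles_lattice[OF F], rule gsol_poles_lattice[OF G G0])
  have sub: "M \<subseteq> L" unfolding M_def L_def by (auto simp: GS S(2))
  obtain a b where ab: "a \<noteq> 0" "\<And>u. F u = rat_map [:b, a:] [:1, 0:] (weierstrass_p M u)"
    using gsol_affine_weierstrass[OF F] unfolding M_def by blast
  obtain a' b' where ab': "a' \<noteq> 0" "\<And>u. G u = rat_map [:b', a':] [:1, 0:] (weierstrass_p L u)"
    using gsol_affine_weierstrass[OF G G0] unfolding L_def by blast
  note lf = affine_mob(2)[OF ab(1), of b] affine_mob(2)[OF ab'(1), of b']
  obtain k where k: "linear_fractional k" "mob a' b' 0 1 \<circ> k = id" "k \<circ> mob a' b' 0 1 = id"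
    using linear_fractional_inverse[OF lf(2)] .
  define Q where "Q = k \<circ> S \<circ> mob a b 0 1"
  have "Q (weierstrass_p M u) = weierstrass_p L u" for u
  proof -
    have "Q (weierstrass_p M u) = k (S (F u))" unfolding Q_def ab(2) affine_mob(1)[OF ab(1)] by simp
    also have "\<dots> = k (mob a' b' 0 1 (weierstrass_p L u))" using ab'(2)[of u] unfolding affine_mob(1)[OF ab'(1)] GS by simp
    also have "\<dots> = weierstrass_p L u" using k(3) by (metis comp_apply id_apply)
    finally show ?thesis .
  qed
  then have Q: "lattice_fraction L M = Q" by (rule lattice_fraction_eqI[OF lat(2,1) sub])
  have SQ: "same_class S Q" unfolding same_class_def Q_def using k(1) lf(1) by blast
  have "twisted_zolotarev Q" unfolding Q_def by (rule twisted_conj[OF S(1) k(1) lf(1)])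
  then have "(L, M) \<in> lattice_pairs"
    unfolding lattice_pairs_iff using lat sub lattice_fraction_twisted_iff(1)[OF lat(2,1) sub] Q by simp
  moreover have "same_class (lattice_fraction L M) R"
    unfolding Q using same_class_trans[OF RS SQ] by (rule same_class_sym)
  ultimately show ?thesis by blast
qed

section \<open>Homothetic pairs and equivalent fractions\<close>

text \<open>Every term of the series is homogeneous of degree -2 under a common scaling of u and
  v.\<close>

lemma weierstrass_p_homothety:
  assumes c: "c \<noteq> 0"
  shows "weierstrass_p ((*) c ` L) (c * u) = mob (1 / c ^ 2) 0 0 1 (weierstrass_p L u)"
proof (cases "u \<in> L")
  case True
  then have wp: "weierstrass_p L u = Infty" "weierstrass_p ((*) c ` L) (c * u) = Infty" by auto
  show ?thesis unfolding wp using affine_mob(3)[of "1 / c ^ 2" 0] c by simp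
next
  case False
  then have u: "c * u \<notin> (*) c ` L" using c by auto
  have im: "(*) c ` L - {0} = (*) c ` (L - {0})" using c by auto
  have inj: "inj_on ((*) c) (L - {0})" using c by (auto simp: inj_on_def)
  have "(\<Sum>\<^sub>\<infinity>v\<in>(*) c ` L - {0}. 1 / (c * u - v) ^ 2 - 1 / v ^ 2)
      = (\<Sum>\<^sub>\<infinity>v\<in>L - {0}. 1 / (c * u - c * v) ^ 2 - 1 / (c * v) ^ 2)"
    unfolding im infsum_reindex[OF inj] by (simp add: o_def)
  also have "\<dots> = (\<Sum>\<^sub>\<infinity>v\<in>L - {0}. 1 / c ^ 2 * (1 / (u - v) ^ 2 - 1 / v ^ 2))"
  proof (rule infsum_cong)
    fix v
    have "1 / (c * x) ^ 2 - 1 / (c * v) ^ 2 = 1 / c ^ 2 * (1 / x ^ 2 - 1 / v ^ 2)" for x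
      by (simp add: power_mult_distrib right_diff_distrib)
    from this[of "u - v"] show "1 / (c * u - c * v) ^ 2 - 1 / (c * v) ^ 2 = 1 / c ^ 2 * (1 / (u - v) ^ 2 - 1 / v ^ 2)"
      by (simp only: right_diff_distrib[of c u v])
  qed
  also have "\<dots> = 1 / c ^ 2 * (\<Sum>\<^sub>\<infinity>v\<in>L - {0}. 1 / (u - v) ^ 2 - 1 / v ^ 2)"
    by (rule infsum_cmult_right')
  finally have "pf ((*) c ` L) (c * u) = 1 / c ^ 2 * pf L u"
    unfolding pf_eq[OF u] pf_eq[OF False] by (simp add: distrib_left power_mult_distrib)
  then show ?thesis using u False by (simp add: weierstrass_p_pf mob_def mult.commute)
qed

lemma homothetic_same_class:
  assumes "(L, M) \<in> lattice_pairs" "(L', M') \<in> lattice_pairs" "homothetic (L, M) (L', M')"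
  shows "same_class (lattice_fraction L M) (lattice_fraction L' M')"
proof -
  obtain c where c: "c \<noteq> 0" "L' = (*) c ` L" "M' = (*) c ` M"
    using assms(3) unfolding homothetic_def by auto
  have lat: "rank_two_lattice L" "rank_two_lattice M" "M \<subseteq> L" and lat': "rank_two_lattice L'" "rank_two_lattice M'" "M' \<subseteq> L'"
    using assms(1,2) unfolding lattice_pairs_iff by auto
  define m where "m = mob (1 / c ^ 2) 0 0 1"
  have m: "linear_fractional m" unfolding m_def by (rule affine_mob(2)) (use c in simp)
  obtain k where k: "linear_fractional k" "m \<circ> k = id" "k \<circ> m = id" using linear_fractional_inverse[OF m] .
  have "(m \<circ> lattice_fraction L M \<circ> k) (weierstrass_p M' u) = weierstrass_p L' u" for u
  proof -
    define w where "w = u / c"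
    have u: "u = c * w" using c by (simp add: w_def)
    have "k (weierstrass_p M' u) = weierstrass_p M w"
      unfolding u c(3) weierstrass_p_homothety[OF c(1)] m_def[symmetric] using k(3) by (metis comp_apply id_apply)
    then show ?thesis
      unfolding u c(2) weierstrass_p_homothety[OF c(1)] m_def[symmetric]
      using lattice_fraction(2)[OF lat, of w] c(3) u by simp
  qed
  then have "lattice_fraction L' M' = m \<circ> lattice_fraction L M \<circ> k" by (rule lattice_fraction_eqI[OF lat'])
  then show ?thesis unfolding same_class_def using m k(1) by blast
qed

section \<open>Linear forms of the branch points\<close>

text \<open>The form in homogeneous coordinates with its only zero at \<open>x\<close>, normalised
  so that the product over \<open>branch f\<close> is \<open>hat f\<close> up to the leading
  coefficient of the cubic.\<close>

definition linear_form :: "csphere \<Rightarrow> complex \<Rightarrow> complex \<Rightarrow> complex" where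
  "linear_form x A B = (case x of Pt e \<Rightarrow> A - e * B | Infty \<Rightarrow> B)"

lemma linear_form_mk:
  assumes "u \<noteq> 0 \<or> v \<noteq> 0"
  shows "\<exists>s. s \<noteq> 0 \<and> (\<forall>A B. linear_form (mk u v) A B = s * (A * v - u * B))"
proof (cases "v = 0")
  case True
  then show ?thesis using assms by (intro exI[of _ "- 1 / u"]) (auto simp: linear_form_def mk_def)
next
  case False
  then show ?thesis by (intro exI[of _ "1 / v"]) (auto simp: linear_form_def mk_def field_simps)
qed

text \<open>A nonzero linear form is determined by its zero up to a factor, and this factor depends
  on \<open>x\<close> but not on \<open>A\<close> and \<open>B\<close>.\<close>

lemma linear_form_mob:
  assumes det: "a * d - b * c \<noteq> 0"
  shows "\<exists>s. s \<noteq> 0 \<and> (\<forall>A B. linear_form (mob a b c d x) (a * A + b * B) (c * A + d * B) = s * linear_form x A B)"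
proof -
  obtain u v where uv: "u \<noteq> 0 \<or> v \<noteq> 0" "x = mk u v" using csphere_mk by blast
  obtain s where s: "s \<noteq> 0" "\<And>A B. linear_form x A B = s * (A * v - u * B)"
    using linear_form_mk[OF uv(1)] uv(2) by blast
  obtain s' where s': "s' \<noteq> 0" "\<And>A B. linear_form (mob a b c d x) A B = s' * (A * (c * u + d * v) - (a * u + b * v) * B)"
    using linear_form_mk[OF mob_mk_nonzero[OF det uv(1)]] mob_mk[OF det uv(1)] uv(2) by metis
  have "linear_form (mob a b c d x) (a * A + b * B) (c * A + d * B) = s' * (a * d - b * c) / s * linear_form x A B" for A B
  proof -
    have "(a * A + b * B) * (c * u + d * v) - (a * u + b * v) * (c * A + d * B) = (a * d - b * c) * (A * v - u * B)"
      by (simp add: algebra_simps)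
    then show ?thesis unfolding s s' using s(1) by simp
  qed
  then show ?thesis using s(1) s'(1) det by (intro exI[of _ "s' * (a * d - b * c) / s"]) simp
qed

lemma hat_linear_forms:
  assumes f: "cubic f"
  shows "hat f A B = coeff f 3 * (\<Prod>x\<in>branch f. linear_form x A B)"
proof -
  define Z where "Z = {z. poly f z = 0}"
  have d: "degree f = 3" and f0: "f \<noteq> 0" using f by (auto simp: cubic_def)
  have Zf: "finite Z" unfolding Z_def by (rule poly_roots_finite[OF f0])
  have "card (insert Infty (Pt ` Z)) = 4" using cubic_branch_card[OF f] by (simp add: branch_def Z_def)
  moreover have "card (Pt ` Z) = card Z" by (rule card_image) (auto simp: inj_on_def)
  moreover have "Infty \<notin> Pt ` Z" by auto
  ultimately have Z3: "card Z = 3" using Zf by simp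
  have "rsquarefree f" using f unfolding rsquarefree_roots cubic_def by blast
  then have "smult (lead_coeff f) (\<Prod>z\<in>Z. [:- z, 1:]) = f"
    unfolding Z_def by (rule complex_poly_decompose_rsquarefree)
  then have fz: "poly f z = coeff f 3 * (\<Prod>e\<in>Z. z - e)" for z
    by (subst (asm) eq_commute) (metis (no_types, lifting) d poly_smult poly_prod prod.cong poly_pCons poly_0 mult_zero_right add_0_right mult_1_right uminus_add_conv_diff)
  have "hat f A B = coeff f 3 * (B * (\<Prod>e\<in>Z. A - e * B))"
  proof (cases "B = 0")
    case False
    have "hat f A B = B ^ 4 * (coeff f 3 * (\<Prod>e\<in>Z. A / B - e))" unfolding hat_eq[OF d False] fz ..
    also have "\<dots> = coeff f 3 * (B * (B ^ card Z * (\<Prod>e\<in>Z. A / B - e)))"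
      unfolding Z3 by (simp add: power_numeral_reduce)
    also have "B ^ card Z * (\<Prod>e\<in>Z. A / B - e) = (\<Prod>e\<in>Z. B * (A / B - e))" by (simp add: prod.distrib)
    also have "\<dots> = (\<Prod>e\<in>Z. A - e * B)"
      by (intro prod.cong refl) (use False in \<open>simp add: field_simps\<close>)
    finally show ?thesis .
  qed (simp add: hat_def)
  moreover have "(\<Prod>x\<in>branch f. linear_form x A B) = B * (\<Prod>e\<in>Z. A - e * B)"
  proof -
    have "(\<Prod>x\<in>branch f. linear_form x A B) = linear_form Infty A B * (\<Prod>x\<in>Pt ` Z. linear_form x A B)"
      unfolding branch_def Z_def[symmetric] by (rule prod.insert) (use Zf in auto)
    also have "(\<Prod>x\<in>Pt ` Z. linear_form x A B) = (\<Prod>e\<in>Z. linear_form (Pt e) A B)"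
      by (rule prod.reindex_cong[of Pt]) (auto simp: inj_on_def)
    finally show ?thesis by (simp add: linear_form_def)
  qed
  ultimately show ?thesis by simp
qed

text \<open>Describes the values of \<wp>(u|M) at half periods in terms of the fraction alone, so
  that every equivalence of fractions must respect them.\<close>

lemma lattice_fraction_unramified:
  assumes "(L, M) \<in> lattice_pairs"
  shows "x \<in> branch (wcubic M) \<longleftrightarrow>
    lattice_fraction L M x \<in> lattice_fraction L M ` critical_points (lattice_fraction L M) \<and>
    local_degree (lattice_fraction L M) x = 1"
proof -
  have lat: "rank_two_lattice L" "rank_two_lattice M" "M \<subseteq> L" and ex: "\<exists>v\<in>L. 2 * v \<notin> M"
    using assms unfolding lattice_pairs_iff by auto
  obtain u where u: "weierstrass_p M u = x" using weierstrass_p_surj[OF lat(2)] by blast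
  have "x \<in> branch (wcubic M) \<longleftrightarrow> 2 * u \<in> M" using weierstrass_p_branch_iff[OF lat(2), of u] u by simp
  moreover have "lattice_fraction L M x \<in> branch (wcubic L) \<longleftrightarrow> 2 * u \<in> L"
    using weierstrass_p_branch_iff[OF lat(1), of u] lattice_fraction(2)[OF lat, of u] u by simp
  moreover have "local_degree (lattice_fraction L M) x = (if 2 * u \<in> L \<and> 2 * u \<notin> M then 2 else 1)"
    using lattice_fraction_local_degree[OF lat, of u] u by simp
  ultimately show ?thesis
    unfolding lattice_fraction_twisted_iff(2)[OF lat ex] using lat(3) by auto
qed

text \<open>Both sides solve the differential equation of \<open>\<wp>(\<cdot>|M)\<close>: a Moebius map multiplies every linear
  form by a constant, so it preserves the product of the forms of the branch points up to a factor,
  which \<open>k\<close> absorbs.\<close>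

lemma weierstrass_p_mob:
  assumes M: "rank_two_lattice M" and M': "rank_two_lattice M'" and l: "linear_fractional l"
    and br: "\<And>x. x \<in> branch (wcubic M') \<longleftrightarrow> l x \<in> branch (wcubic M)"
  shows "\<exists>k u0. k \<noteq> 0 \<and> (\<forall>t. weierstrass_p M t = l (weierstrass_p M' (k * t + u0)))"
proof -
  obtain a b c d where det: "a * d - b * c \<noteq> 0" and lm: "l = mob a b c d" using linear_fractionalE[OF l] .
  define p where "p = [:b, a:]"
  define q where "q = [:d, c:]"
  note F = wcubic[OF M] and F' = wcubic[OF M']
  have W: "wronskian p q = [:a * d - b * c:]"
    unfolding p_def q_def by (simp add: wronskian_def pderiv_pCons algebra_simps)
  obtain s where s: "\<And>x. s x \<noteq> 0" "\<And>x A B. linear_form (l x) (a * A + b * B) (c * A + d * B) = s x * linear_form x A B"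
    using linear_form_mob[OF det] unfolding lm by metis
  have bij: "bij_betw l (branch (wcubic M')) (branch (wcubic M))"
    unfolding bij_betw_def
  proof
    have lb: "bij l" by (rule linear_fractional_bij[OF l])
    show "inj_on l (branch (wcubic M'))" using lb by (meson bij_is_inj inj_on_subset subset_UNIV)
    show "l ` branch (wcubic M') = branch (wcubic M)"
    proof
      show "l ` branch (wcubic M') \<subseteq> branch (wcubic M)" using br by blast
      show "branch (wcubic M) \<subseteq> l ` branch (wcubic M')"
      proof
        fix y assume y: "y \<in> branch (wcubic M)"
        obtain x where "y = l x" using bij_is_surj[OF lb] by (metis surjD)
        then show "y \<in> l ` branch (wcubic M')" using y br by blast
      qed
    qed
  qed
  have lc: "coeff (wcubic M) 3 \<noteq> 0" "coeff (wcubic M') 3 \<noteq> 0"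
    using gsolD(2)[OF F] gsolD(2)[OF F'] by (metis degree_0 leading_coeff_0_iff zero_neq_numeral)+
  define K where "K = coeff (wcubic M) 3 * (\<Prod>x\<in>branch (wcubic M'). s x) / coeff (wcubic M') 3"
  have K0: "K \<noteq> 0" unfolding K_def using lc s(1) cubic_branch_card(1)[OF gsolD(1)[OF F']] by simp
  have hatK: "hat (wcubic M) (a * A + b * B) (c * A + d * B) = K * hat (wcubic M') A B" for A B
  proof -
    have "(\<Prod>x\<in>branch (wcubic M). linear_form x (a * A + b * B) (c * A + d * B))
        = (\<Prod>x\<in>branch (wcubic M'). linear_form (l x) (a * A + b * B) (c * A + d * B))"
      by (rule prod.reindex_bij_betw[OF bij, symmetric])
    also have "\<dots> = (\<Prod>x\<in>branch (wcubic M'). s x) * (\<Prod>x\<in>branch (wcubic M'). linear_form x A B)"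
      by (simp add: s(2) prod.distrib)
    finally show ?thesis
      unfolding hat_linear_forms[OF gsolD(1)[OF F]] hat_linear_forms[OF gsolD(1)[OF F']] K_def
      using lc by simp
  qed
  \<comment> \<open>The Wronskian of l is its determinant, so \<open>gsol_compose\<close> requires
    the time scale to satisfy k^2 (ad - bc)^2 = K.\<close>
  define k where "k = csqrt (K / (a * d - b * c) ^ 2)"
  have k2: "k ^ 2 * (a * d - b * c) ^ 2 = K" using det by (simp add: k_def)
  have k0: "k \<noteq> 0" using k2 K0 by auto
  \<comment> \<open>The shift u0 is chosen to give \<open>G\<close> a pole at 0. Infinity is a
    branch point, so this value alone identifies \<open>G\<close> with \<wp>(t|M).\<close>
  obtain y where y: "l y = Infty" using bij_is_surj[OF linear_fractional_bij[OF l]] by (metis surjD)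
  obtain u0 where u0: "weierstrass_p M' u0 = y" using weierstrass_p_surj[OF M'] by blast
  define G where "G = (\<lambda>t. rat_map p q (weierstrass_p M' (k * t + u0)))"
  have G: "gsol (wcubic M) G"
    unfolding G_def
  proof (rule gsol_compose[OF F' gsolD(1)[OF F] k0])
    show "coprime p q" unfolding p_def q_def by (rule coprime_linear[OF det])
    show "wronskian p q \<noteq> 0" unfolding W using det by simp
    fix z
    have "hat (wcubic M) (poly p z) (poly q z) = K * hat (wcubic M') z 1"
      using hatK[of z 1] by (simp add: p_def q_def algebra_simps)
    then show "k ^ 2 * (poly (wronskian p q) z) ^ 2 * poly (wcubic M') z = hat (wcubic M) (poly p z) (poly q z)"
      unfolding W using k2 hat_eq[OF gsolD(2)[OF F'], of 1 z] by simp
  qed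
  have Gl: "G t = l (weierstrass_p M' (k * t + u0))" for t by (simp add: G_def lm mob_def p_def q_def)
  have "G 0 = Infty" using u0 y by (simp add: Gl)
  then have eq: "weierstrass_p M 0 = G 0" using weierstrass_p_0[OF M] by simp
  have "weierstrass_p M 0 \<in> branch (wcubic M)" unfolding weierstrass_p_0[OF M] by simp
  from gsol_unique_branch(1)[OF F G eq this] have "weierstrass_p M t = G t" for t by simp
  then show ?thesis using k0 Gl by (intro exI[of _ k] exI[of _ u0]) simp
qed

text \<open>A lattice is the full group of periods of its Weierstrass function. An injective
  \<open>l\<close> and the shift \<open>u0\<close> do not affect periods, and \<open>k\<close>
  multiplies them.\<close>

lemma weierstrass_p_lattice_eq:
  assumes L: "rank_two_lattice L" and L': "rank_two_lattice L'" and l: "inj l" and k: "k \<noteq> 0"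
    and eq: "\<And>t. weierstrass_p L t = l (weierstrass_p L' (k * t + u0))"
  shows "L' = (*) k ` L"
proof -
  have period: "w \<in> N \<longleftrightarrow> (\<forall>t. weierstrass_p N (t + w) = weierstrass_p N t)" if N: "rank_two_lattice N" for w N
  proof
    assume "\<forall>t. weierstrass_p N (t + w) = weierstrass_p N t"
    then have "weierstrass_p N (0 + w) = weierstrass_p N 0" by blast
    then have "weierstrass_p N w = Infty" using weierstrass_p_0[OF N] by simp
    then show "w \<in> N" by simp
  qed (use weierstrass_p_periodic[OF N] in blast)
  have iff: "w \<in> L \<longleftrightarrow> k * w \<in> L'" for w
  proof -
    have "w \<in> L \<longleftrightarrow> (\<forall>t. weierstrass_p L' (k * (t + w) + u0) = weierstrass_p L' (k * t + u0))"
      unfolding period[OF L] eq using l by (auto dest: injD)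
    also have "\<dots> \<longleftrightarrow> (\<forall>t. weierstrass_p L' (t + k * w) = weierstrass_p L' t)"
    proof
      assume H: "\<forall>t. weierstrass_p L' (k * (t + w) + u0) = weierstrass_p L' (k * t + u0)"
      show "\<forall>t. weierstrass_p L' (t + k * w) = weierstrass_p L' t"
      proof
        fix t
        have "k * ((t - u0) / k + w) + u0 = t + k * w" "k * ((t - u0) / k) + u0 = t"
          using k by (simp_all add: field_simps)
        then show "weierstrass_p L' (t + k * w) = weierstrass_p L' t"
          using H[rule_format, of "(t - u0) / k"] by simp
      qed
    next
      assume H: "\<forall>t. weierstrass_p L' (t + k * w) = weierstrass_p L' t"
      show "\<forall>t. weierstrass_p L' (k * (t + w) + u0) = weierstrass_p L' (k * t + u0)"
      proof
        fix t
        have "k * (t + w) + u0 = (k * t + u0) + k * w" by (simp add: algebra_simps)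
        then show "weierstrass_p L' (k * (t + w) + u0) = weierstrass_p L' (k * t + u0)" using H by metis
      qed
    qed
    finally show ?thesis using period[OF L'] by blast
  qed
  show ?thesis
  proof
    show "(*) k ` L \<subseteq> L'" using iff by blast
    show "L' \<subseteq> (*) k ` L"
    proof
      fix x assume "x \<in> L'"
      moreover have "x = k * (x / k)" using k by simp
      ultimately have "x / k \<in> L" using iff by metis
      then show "x \<in> (*) k ` L" using \<open>x = k * (x / k)\<close> by blast
    qed
  qed
qed

text \<open>Since \<open>l1\<close> matches the half period values of M' and M, it transforms one
  Weierstrass function into the other after t -> k t + u0. Applying R' to this relation gives the
  corresponding one for L and L' with the same k, so a single factor serves both lattices.\<close>

lemma same_class_homothetic:
  assumes P: "(L, M) \<in> lattice_pairs" and P': "(L', M') \<in> lattice_pairs"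
    and same: "same_class (lattice_fraction L M) (lattice_fraction L' M')"
  shows "homothetic (L, M) (L', M')"
proof -
  have lat: "rank_two_lattice L" "rank_two_lattice M" "M \<subseteq> L" and lat': "rank_two_lattice L'" "rank_two_lattice M'" "M' \<subseteq> L'"
    using P P' unfolding lattice_pairs_iff by auto
  define R where "R = lattice_fraction L M"
  define R' where "R' = lattice_fraction L' M'"
  obtain l l1 where l: "linear_fractional l" "linear_fractional l1" and R': "R' = l \<circ> R \<circ> l1"
    using same unfolding same_class_def R_def R'_def by blast
  have r: "rational R" unfolding R_def by (rule lattice_fraction(1)[OF lat])
  have "x \<in> branch (wcubic M') \<longleftrightarrow> l1 x \<in> branch (wcubic M)" for x
  proof -
    have "R' x \<in> R' ` critical_points R' \<longleftrightarrow> R (l1 x) \<in> R ` critical_points R"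
      unfolding R' conj_critical[OF r l]
      using inj_image_mem_iff[OF bij_is_inj[OF linear_fractional_bij[OF l(1)]]] by simp
    moreover have "local_degree R' x = local_degree R (l1 x)" unfolding R' by (rule conj_local_degree[OF r l])
    ultimately show ?thesis
      using lattice_fraction_unramified[OF P, of "l1 x"] lattice_fraction_unramified[OF P', of x]
      unfolding R_def R'_def by simp
  qed
  from weierstrass_p_mob[OF lat(2) lat'(2) l(2) this] obtain k u0 where k: "k \<noteq> 0"
    "\<And>t. weierstrass_p M t = l1 (weierstrass_p M' (k * t + u0))" by blast
  have M': "M' = (*) k ` M"
    by (rule weierstrass_p_lattice_eq[OF lat(2) lat'(2) bij_is_inj[OF linear_fractional_bij[OF l(2)]] k])
  obtain m where m: "linear_fractional m" "l \<circ> m = id" "m \<circ> l = id" using linear_fractional_inverse[OF l(1)] .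
  have "weierstrass_p L t = m (weierstrass_p L' (k * t + u0))" for t
  proof -
    have "weierstrass_p L' (k * t + u0) = R' (weierstrass_p M' (k * t + u0))"
      unfolding R'_def lattice_fraction(2)[OF lat'] ..
    also have "\<dots> = l (R (weierstrass_p M t))" by (simp add: R' k(2))
    also have "\<dots> = l (weierstrass_p L t)" unfolding R_def lattice_fraction(2)[OF lat] ..
    finally show ?thesis using m(3) by (metis comp_apply id_apply)
  qed
  then have "L' = (*) k ` L"
    by (rule weierstrass_p_lattice_eq[OF lat(1) lat'(1) bij_is_inj[OF linear_fractional_bij[OF m(1)]] k(1)])
  with M' k(1) show ?thesis unfolding homothetic_def by auto
qed

section \<open>Passage to equivalence classes\<close>

lemma equiv_homothety: "equiv lattice_pairs homothety_rel"
proof (rule equivI)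
  show "homothety_rel \<subseteq> lattice_pairs \<times> lattice_pairs" by (auto simp: homothety_rel_def)
  show "refl_on lattice_pairs homothety_rel"
    unfolding refl_on_def homothety_rel_def homothetic_def by (auto intro!: exI[of _ 1])
  show "sym homothety_rel"
  proof (rule symI)
    fix P P' assume "(P, P') \<in> homothety_rel"
    then obtain L M L' M' c where *: "P = (L, M)" "P' = (L', M')" "P \<in> lattice_pairs" "P' \<in> lattice_pairs"
      "c \<noteq> 0" "L' = (*) c ` L" "M' = (*) c ` M"
      by (cases P; cases P') (auto simp: homothety_rel_def homothetic_def)
    have "(*) (1 / c) ` (*) c ` S = S" for S :: "complex set" using *(5) by (auto simp: image_image)
    then have "homothetic P' P" unfolding * homothetic_def using *(5)
      by (auto intro!: exI[of _ "1 / c"])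
    then show "(P', P) \<in> homothety_rel" using * by (simp add: homothety_rel_def)
  qed
  show "trans homothety_rel"
  proof (rule transI)
    fix P P' P'' assume "(P, P') \<in> homothety_rel" "(P', P'') \<in> homothety_rel"
    moreover obtain L M where "P = (L, M)" by (cases P)
    ultimately obtain L' M' L'' M'' c d where *: "P = (L, M)" "P'' = (L'', M'')"
      "P \<in> lattice_pairs" "P'' \<in> lattice_pairs"
      "c \<noteq> 0" "L' = (*) c ` L" "M' = (*) c ` M" "d \<noteq> 0" "L'' = (*) d ` L'" "M'' = (*) d ` M'"
      by (cases P'; cases P'') (auto simp: homothety_rel_def homothetic_def)
    have "L'' = (*) (d * c) ` L" "M'' = (*) (d * c) ` M" "d * c \<noteq> 0"
      using *(5-10) by (auto simp: image_image mult.assoc)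
    then have "homothetic P P''" unfolding *(1,2) homothetic_def by (auto intro!: exI[of _ "d * c"])
    then show "(P, P'') \<in> homothety_rel" using * by (simp add: homothety_rel_def)
  qed
qed

lemma equiv_zolotarev: "equiv (Collect twisted_zolotarev) zolotarev_rel"
proof (rule equivI)
  show "zolotarev_rel \<subseteq> Collect twisted_zolotarev \<times> Collect twisted_zolotarev" by (auto simp: zolotarev_rel_def)
  show "refl_on (Collect twisted_zolotarev) zolotarev_rel"
    unfolding refl_on_def zolotarev_rel_def by (auto intro: same_class_refl)
  show "sym zolotarev_rel" unfolding sym_def zolotarev_rel_def by (auto intro: same_class_sym)
  show "trans zolotarev_rel" unfolding trans_def zolotarev_rel_def by (auto intro: same_class_trans)
qed

text \<open>The forward direction of \<open>iff\<close> frees the induced map from the choice of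
  representatives, and the backward direction makes it injective.\<close>

lemma quotient_bijection:
  assumes r: "equiv A r" and s: "equiv B s" and f: "\<And>x. x \<in> A \<Longrightarrow> f x \<in> B"
    and iff: "\<And>x y. x \<in> A \<Longrightarrow> y \<in> A \<Longrightarrow> (x, y) \<in> r \<longleftrightarrow> (f x, f y) \<in> s"
    and surj: "\<And>b. b \<in> B \<Longrightarrow> \<exists>a\<in>A. (f a, b) \<in> s"
  shows "\<exists>\<Phi>. bij_betw \<Phi> (A // r) (B // s) \<and> (\<forall>a\<in>A. \<Phi> (r `` {a}) = s `` {f a})"
proof -
  define \<Phi> where "\<Phi> X = s `` {f (SOME a. a \<in> X \<and> a \<in> A)}" for X
  have Phi: "\<Phi> (r `` {a}) = s `` {f a}" if a: "a \<in> A" for a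
  proof -
    define b where "b = (SOME b. b \<in> r `` {a} \<and> b \<in> A)"
    have "a \<in> r `` {a} \<and> a \<in> A" using equiv_class_self[OF r a] a by blast
    then have "b \<in> r `` {a} \<and> b \<in> A" unfolding b_def by (rule someI)
    then have "(f a, f b) \<in> s" using iff[OF a, of b] by blast
    then have "s `` {f a} = s `` {f b}" by (rule equiv_class_eq[OF s])
    then show ?thesis by (simp add: \<Phi>_def b_def)
  qed
  have "bij_betw \<Phi> (A // r) (B // s)"
    unfolding bij_betw_def
  proof
    show "inj_on \<Phi> (A // r)"
    proof (rule inj_onI)
      fix X Y assume "X \<in> A // r" "Y \<in> A // r" and eq: "\<Phi> X = \<Phi> Y"
      then obtain x y where xy: "x \<in> A" "X = r `` {x}" "y \<in> A" "Y = r `` {y}" by (auto elim!: quotientE)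
      then have "s `` {f x} = s `` {f y}" using eq Phi by simp
      then have "(f x, f y) \<in> s" using eq_equiv_class[OF _ s f[OF xy(3)]] by blast
      then have "(x, y) \<in> r" using iff xy by blast
      then show "X = Y" unfolding xy by (rule equiv_class_eq[OF r])
    qed
    show "\<Phi> ` (A // r) = B // s"
    proof
      show "\<Phi> ` (A // r) \<subseteq> B // s"
        using Phi f by (auto elim!: quotientE intro!: quotientI)
      show "B // s \<subseteq> \<Phi> ` (A // r)"
      proof
        fix Y assume "Y \<in> B // s"
        then obtain b where b: "b \<in> B" "Y = s `` {b}" by (auto elim!: quotientE)
        obtain a where a: "a \<in> A" "(f a, b) \<in> s" using surj[OF b(1)] by blast
        have "Y = \<Phi> (r `` {a})" unfolding Phi[OF a(1)] b(2) using equiv_class_eq[OF s a(2)] by simp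
        then show "Y \<in> \<Phi> ` (A // r)" using quotientI[OF a(1)] by blast
      qed
    qed
  qed
  with Phi show ?thesis by blast
qed

theorem theorem1:
  "(\<forall>L M. rank_two_lattice L \<and> rank_two_lattice M \<and> M \<subseteq> L \<longrightarrow>
      (\<exists>!R. is_lattice_fraction L M R)) \<and>
   (\<forall>(L, M)\<in>lattice_pairs. twisted_zolotarev (lattice_fraction L M)) \<and>
   (\<forall>R. twisted_zolotarev R \<longrightarrow>
      (\<exists>(L, M)\<in>lattice_pairs. same_class (lattice_fraction L M) R)) \<and>
   (\<forall>(L, M)\<in>lattice_pairs. \<forall>(L', M')\<in>lattice_pairs.
      same_class (lattice_fraction L M) (lattice_fraction L' M') \<longleftrightarrow>
      homothetic (L, M) (L', M')) \<and>
   equiv lattice_pairs homothety_rel \<and>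
   equiv (Collect twisted_zolotarev) zolotarev_rel \<and>
   (\<exists>\<Phi>. bij_betw \<Phi> (lattice_pairs // homothety_rel)
                 (Collect twisted_zolotarev // zolotarev_rel) \<and>
        (\<forall>(L, M)\<in>lattice_pairs.
           \<Phi> (homothety_rel `` {(L, M)}) = zolotarev_rel `` {lattice_fraction L M}))"
proof -
  have 1: "\<exists>!R. is_lattice_fraction L M R" if "rank_two_lattice L \<and> rank_two_lattice M \<and> M \<subseteq> L" for L M
    using that lattice_fraction_ex1 by blast
  have 2: "twisted_zolotarev (lattice_fraction L M)" if "(L, M) \<in> lattice_pairs" for L M
    using that lattice_fraction_twisted_iff(1)[of L M] unfolding lattice_pairs_iff by blast
  have 4: "same_class (lattice_fraction L M) (lattice_fraction L' M') \<longleftrightarrow> homothetic (L, M) (L', M')"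
    if "(L, M) \<in> lattice_pairs" "(L', M') \<in> lattice_pairs" for L M L' M'
    using homothetic_same_class[OF that] same_class_homothetic[OF that] by blast
  have "\<exists>\<Phi>. bij_betw \<Phi> (lattice_pairs // homothety_rel) (Collect twisted_zolotarev // zolotarev_rel) \<and>
      (\<forall>P\<in>lattice_pairs. \<Phi> (homothety_rel `` {P}) = zolotarev_rel `` {(\<lambda>(L, M). lattice_fraction L M) P})"
  proof (rule quotient_bijection[OF equiv_homothety equiv_zolotarev])
    show "(\<lambda>(L, M). lattice_fraction L M) P \<in> Collect twisted_zolotarev" if "P \<in> lattice_pairs" for P
      using that 2 by (cases P) auto
    show "(P, P') \<in> homothety_rel \<longleftrightarrow>
        ((\<lambda>(L, M). lattice_fraction L M) P, (\<lambda>(L, M). lattice_fraction L M) P') \<in> zolotarev_rel"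
      if "P \<in> lattice_pairs" "P' \<in> lattice_pairs" for P P'
      using that 2 4 by (cases P; cases P') (auto simp: homothety_rel_def zolotarev_rel_def)
    show "\<exists>P\<in>lattice_pairs. ((\<lambda>(L, M). lattice_fraction L M) P, R) \<in> zolotarev_rel"
      if R: "R \<in> Collect twisted_zolotarev" for R
    proof -
      obtain L M where "(L, M) \<in> lattice_pairs" "same_class (lattice_fraction L M) R"
        using twisted_from_lattices[of R] R by auto
      then show ?thesis using 2 R by (intro bexI[of _ "(L, M)"]) (auto simp: zolotarev_rel_def)
    qed
  qed
  then have 5: "\<exists>\<Phi>. bij_betw \<Phi> (lattice_pairs // homothety_rel) (Collect twisted_zolotarev // zolotarev_rel) \<and>
      (\<forall>(L, M)\<in>lattice_pairs. \<Phi> (homothety_rel `` {(L, M)}) = zolotarev_rel `` {lattice_fraction L M})"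
    by (simp add: case_prod_unfold)
  show ?thesis
    using 1 2 4 5 twisted_from_lattices equiv_homothety equiv_zolotarev by auto
qed

end
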